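(* Let $n\ge2$ and let $E\subset\mathbb R^{n+1}$ be uniformly rectifiable in the parabolic sense. Let $\mathbb D(E)=\mathcal G\cup\mathcal B$, $\mathcal G=\bigcup_{\mathbf S^*\in\mathcal S}\mathbf S^*$, $\{\Gamma_{\mathbf S^*}\}_{\mathbf S^*\in\mathcal S}$ be the bilateral corona decomposition of $E$ with constants $\eta\ll1$, $K=\eta^{-1}$ and $b_2=b_2(n,ADR,\text{P-UR})$, and let $M_0=M_0(n,2,1+b_2)>1$ be the local square function constant with $\tilde b_1=2$, $\tilde b_2=1+b_2$ (see context). If $\eta$ is sufficiently small, depending only on the dimension $n$ and the ADR constant of $E$, then the following holds. Let $\mathbf S^*\in\mathcal S$. For every coherent subregime $\mathbf S$ of $\mathbf S^*$, with maximal cube $Q_{\mathbf S}$, there is a $t$-independent plane $P_{\mathbf S}$ and two regular Lip(1/2,1) graphs $\Gamma^\pm_{\mathbf S}$ over $P_{\mathbf S}$, given by functions $\psi^\pm=\psi^\pm_{\eta,\mathbf S}$, with Lip(1/2,1) constants at most $C_n\eta^{15/16}$ ($C_n$ depending only on $n$) and $\|D_t^{1/2}\psi^\pm\|_{P\text{-}BMO}\le 1+b_2$, with the following properties in the coordinates $(t,x',x_n)$ given by $P_{\mathbf S}\oplus P_{\mathbf S}^\perp$, where $\{\pm x_n>\pm\psi^\pm(t,x')\}$ denotes $\{(t,X)=(t,x',x_n):\pm x_n>\pm\psi^\pm(t,x')\}$: (1) If $Q\in\mathbf S$ then $\mathcal W_Q$ has a disjoint decomposition $\mathcal W_Q=\mathcal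 W_Q^+\cup\mathcal W_Q^-$ and, with $U_Q^\pm:=\bigcup_{I\in\mathcal W_Q^\pm}I$, $$U_Q^\pm\subseteq B\big((t_{Q_{\mathbf S}},X_{Q_{\mathbf S}}),K^{3/4}\operatorname{diam}(Q_{\mathbf S})\big)\cap\{\pm x_n>\pm\psi^\pm(t,x')\};$$ in particular $\bigcup_{Q\in\mathbf S}U_Q^\pm$ is contained in the set on the right. (2) If $(t,X)\in\bigcup_{Q\in\mathbf S}U_Q^\pm$ then $\operatorname{dist}((t,X),E)\approx_\eta\operatorname{dist}((t,X),\Gamma^\pm_{\mathbf S})$. (3) If $(t,X)\in B\big((t_{Q_{\mathbf S}},X_{Q_{\mathbf S}}),(K/32)\operatorname{diam}(Q_{\mathbf S})\big)\cap\{\pm x_n>\pm\psi^\pm(t,x')\}$, then $\operatorname{dist}((t,X),E)\ge\operatorname{dist}((t,X),\Gamma^\pm_{\mathbf S})$. (4) $B\big((t_{Q_{\mathbf S}},X_{Q_{\mathbf S}}),(K/32)\operatorname{diam}(Q_{\mathbf S})\big)\cap\{\pm x_n>\pm\psi^\pm(t,x')\}\subseteq\bigcup_{Q\in\mathbf S}U_Q^*$. (5) There exist $(t^\pm_{\mathbf S},X^\pm_{\mathbf S})\in\Gamma^\pm_{\mathbf S}$ such that $$B\big((t_{Q_{\mathbf S}},X_{Q_{\mathbf S}}),M_0K^{3/4}\operatorname{diam}(Q_{\mathbf S})\big)\subset B\big((t^\pm_{\mathbf S},X^\pm_{\mathbf S}),K^{7/8}\operatorname{diam}(Q_{\mathbf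 S})\big)$$ and $$B\big((t^\pm_{\mathbf S},X^\pm_{\mathbf S}),K^{7/8}\operatorname{diam}(Q_{\mathbf S})\big)\subset B\big((t_{Q_{\mathbf S}},X_{Q_{\mathbf S}}),(K/32)\operatorname{diam}(Q_{\mathbf S})\big).$$ All statements with $\pm$ hold for each of the two choices of sign; $\approx_\eta$ means comparability up to constants depending on $\eta$ (and on $n$ and the ADR constant).
   Context: Metric. Points of $\mathbb R^{n+1}=\mathbb R\times\mathbb R^n$ are written $(t,X)$. The parabolic distance is $\operatorname{dist}((t,X),(s,Y))=|X-Y|+|t-s|^{1/2}$, $\operatorname{dist}(A,B)$ is the infimum over pairs; balls $B(\cdot,r)$ (open) and $\operatorname{diam}$ refer to it. $\mathcal H^{n+1}_p$ is the $(n+1)$-dimensional Hausdorff measure of this metric. ADR and P-UR. $E$ is ADR if it is closed and for some $C_0$ (the ADR constant): $C_0^{-1}r^{n+1}\le\mathcal H^{n+1}_p(B((t,X),r)\cap E)\le C_0r^{n+1}$ for all $(t,X)\in E$, $0<r<\operatorname{diam}(E)$; $\sigma:=\mathcal H^{n+1}_p|_E$. An $n$-plane is $t$-independent if it contains a line in the $t$-direction. With $\beta(t,X,r):=\inf_P\big(r^{-n-1}\int_{B((t,X),r)\cap E}(\operatorname{dist}((s,Y),P)/r)^2d\sigma\big)^{1/2}$ (infimum over $t$-independent $n$-planes), $E$ is uniformly rectifiable in the parabolic sense (P-UR) if it is ADR and for some $M$, $\int_0^\rho\int_{B((t,X),\rho)\cap E}\beta(s,Y,r)^2d\sigma\frac{dr}r\le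 M\rho^{n+1}$ for all $(t,X)\in E$, $0<\rho<\operatorname{diam}(E)$. "Depending on ADR / P-UR" means on $C_0$ / on $C_0,M$. Dyadic cubes. $\mathbb D(E)=\bigcup_{k\in\mathbb Z}\mathbb D_k$ is a fixed dyadic decomposition of $E$: for constants $a_0,\gamma>0$, $c_*<\infty$ (depending on $n$, ADR), $\mathbb D_k=\{Q^k_j\}_j$ is a countable family of Borel subsets of $E$ with (i) $E=\bigcup_jQ^k_j$ for each $k$; (ii) if $m\ge k$, either $Q^m_i\subset Q^k_j$ or $Q^m_i\cap Q^k_j=\emptyset$; (iii) for each $(j,k)$ and $m<k$ there is a unique $i$ with $Q^k_j\subset Q^m_i$; (iv) $\operatorname{diam}(Q^k_j)\le c_*2^{-k}$; (v) each $Q^k_j$ contains $E\cap B(z^k_j,a_02^{-k})$ for some $z^k_j\in E$; (vi) $\sigma(\{z\in Q^k_j:\operatorname{dist}(z,E\setminus Q^k_j)\le\varrho2^{-k}\})\le c_*\varrho^\gamma\sigma(Q^k_j)$ for $\varrho\in(0,a_0)$. $(t_Q,X_Q)\in E$ denotes the center of $Q$, i.e. a point with $E\cap B((t_Q,X_Q),r)\subset Q\subset E\cap B((t_Q,X_Q),Cr)$, $r\approx\operatorname{diam}(Q)$. For $K>1$, $KQ:=\{z\in E:\operatorname{dist}(z,Q)<(K-1)\operatorname{diam}(Q)\}$. Regular Lip(1/2,1) graphs. Let $P$ be a $t$-independent plane, identified with $\mathbb R^n=\{(t,x'):t\in\mathbb R,x'\in\mathbb R^{n-1}\}$. The graph $\{(p,\psi(p)):p\in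 P\}$ of $\psi:P\to P^\perp$ is a regular Lip(1/2,1) graph if for some $b_1,b_2$: $|\psi(t,x')-\psi(s,y')|\le b_1(|x'-y'|+|t-s|^{1/2})$ (the Lip(1/2,1) constant is at most $b_1$), and $\|D_t^{1/2}\psi\|_{P\text{-}BMO(\mathbb R^n)}\le b_2$, where $P$-$BMO$ is BMO with respect to parabolic balls and $D_t^{1/2}\psi(t,x')=\hat c\,\mathrm{p.v.}\int_{\mathbb R}\frac{\psi(s,x')-\psi(t,x')}{|s-t|^{3/2}}ds$ ($\hat c$ the normalizing constant) is the half-order time derivative. Coherency. $\mathbf S\subset\mathbb D(E)$ is coherent if (a) it has a unique maximal element $Q(\mathbf S)$ containing all other elements; (b) $Q\in\mathbf S$ and $Q\subset\widetilde Q\subset Q(\mathbf S)$ imply $\widetilde Q\in\mathbf S$; (c) for $Q\in\mathbf S$, either all children of $Q$ belong to $\mathbf S$ or none do. A coherent subregime of $\mathbf S^*$ is a coherent $\mathbf S\subseteq\mathbf S^*$; $Q_{\mathbf S}:=Q(\mathbf S)$. Bilateral corona decomposition with constants $\eta$, $K=\eta^{-1}$, $b_2$ (known to exist for P-UR sets for every $0<\eta\ll1$, with $b_2$ depending only on $n$, ADR, P-UR and not on $\eta$, and $C_\eta$ also on $\eta$): a disjoint decomposition $\mathbb D(E)=\mathcal G\cup\mathcal B$ with (1) $\mathcal G=\bigcup_{\mathbf S^*\in\mathcal S}\mathbf S^*$ a disjoint union of coherent families; (2) $\sum_{Q'\subset Q,Q'\in\mathcal B}\sigma(Q')+\sum_{\mathbf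 S^*:Q(\mathbf S^* )\subset Q}\sigma(Q(\mathbf S^* ))\le C_\eta\sigma(Q)$ for all $Q\in\mathbb D(E)$; (3) for each $\mathbf S^*$ a regular Lip(1/2,1) graph $\Gamma_{\mathbf S^*}$ whose defining function has Lip(1/2,1) constant at most $\eta$ and half-order time derivative with $P$-$BMO$ norm at most $b_2$, such that for every $Q\in\mathbf S^*$, $\sup_{z\in KQ}\operatorname{dist}(z,\Gamma_{\mathbf S^*})+\sup_{z\in B((t_Q,X_Q),K\operatorname{diam}(Q))\cap\Gamma_{\mathbf S^*}}\operatorname{dist}(z,E)<\eta\operatorname{diam}(Q)$. Whitney regions. $\mathcal W(E^c)$ is a Whitney decomposition of $E^c=\mathbb R^{n+1}\setminus E$ into closed parabolic dyadic cubes with disjoint interiors, with $4\operatorname{diam}(I)\le\operatorname{dist}(4I,E)\le\operatorname{dist}(I,E)\le100\operatorname{diam}(I)$. For $Q\in\mathbb D(E)$, $\mathcal W_Q=\{I\in\mathcal W(E^c):\eta^{1/4}\operatorname{diam}(Q)\le\operatorname{dist}(I,E)\le\operatorname{dist}(I,Q)\le K^{1/4}\operatorname{diam}(Q)\}$, $\mathcal W^*_Q=\{I\in\mathcal W(E^c):\eta^4\operatorname{diam}(Q)\le\operatorname{dist}(I,E)\le\operatorname{dist}(I,Q)\le K\operatorname{diam}(Q)\}$, and $U^*_Q=\bigcup_{I\in\mathcal W^*_Q}I$. The constant $M_0$. It is known that for $\tilde b_1,\tilde b_2\ge0$ there are $M_0=M_0(n,\tilde b_1,\tilde b_2)>1$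 and $c_5=c_5(n,\tilde b_1,\tilde b_2)$ such that, whenever $\varphi$ is Lip(1/2,1) with constant $\tilde b_1$, $\|D_t^{1/2}\varphi\|_{P\text{-}BMO}\le\tilde b_2$, $\Omega^+=\{x_n>\varphi(t,x')\}$, $z_0\in\partial\Omega^+$, $r>0$, and $u$ is a bounded solution of $(\partial_t-\Delta_X)u=0$ in $B(z_0,M_0r)\cap\Omega^+$, one has $\iint_{B(z_0,r)\cap\Omega^+}|\nabla_X u|^2\operatorname{dist}(\cdot,\partial\Omega^+)\,dY\,ds\le c_5r^{n+1}\|u\|^2_{L^\infty(B(z_0,M_0r)\cap\Omega^+)}$ (and similarly for $\Omega^-=\{x_n<\varphi\}$). $M_0$ here denotes this constant for $\tilde b_1=2$, $\tilde b_2=1+b_2$.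
   Formalization: The first inclusion in (5) is proved for η below a threshold that may also depend on M_0 (hence on b_2), since it forces M_0 ≤ K^{1/8} and so cannot hold for η small depending only on n and ADR; all other claims hold with the stated dependence. *)

theory Defs
  imports "HOL-Analysis.Analysis"
begin

text \<open>
  Points \<open>(t, X)\<close> of space-time are pairs; the spatial part lives in \<open>real ^ 'n\<close>, so that
  \<open>n\<close> is \<open>CARD('n)\<close>. The parameter space \<open>\<real> \<times> \<real>^(n-1)\<close> of a \<open>t\<close>-independent plane is
  \<open>real \<times> real ^ 'm\<close> with \<open>CARD('n) = CARD('m) + 1\<close>.
\<close>

type_synonym 'n stpt = "real \<times> (real, 'n) vec"
type_synonym 'n cube = "'n stpt set"


section \<open>Parabolic metric and Hausdorff measure\<close>

definition pdist :: "real \<times> 'a::real_normed_vector \<Rightarrow> real \<times> 'a \<Rightarrow> real" where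
  "pdist z w = norm (snd z - snd w) + sqrt \<bar>fst z - fst w\<bar>"

definition pball :: "real \<times> 'a::real_normed_vector \<Rightarrow> real \<Rightarrow> (real \<times> 'a) set" where
  "pball z r = {w. pdist z w < r}"

text \<open>Diameters and distances are extended reals, so that unbounded sets have diameter \<open>\<infinity>\<close> and the
  distance to the empty set is \<open>\<infinity>\<close>; \<open>rdiam\<close> is only used for bounded sets.\<close>

definition pdiam :: "(real \<times> 'a::real_normed_vector) set \<Rightarrow> ennreal" where
  "pdiam A = (SUP z\<in>A. SUP w\<in>A. ennreal (pdist z w))"

definition rdiam :: "(real \<times> 'a::real_normed_vector) set \<Rightarrow> real" where
  "rdiam A = enn2real (pdiam A)"

definition pdist_set :: "(real \<times> 'a::real_normed_vector) set \<Rightarrow> (real \<times> 'a) set \<Rightarrow> ennreal" where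
  "pdist_set A B = (INF z\<in>A. INF w\<in>B. ennreal (pdist z w))"

definition pdist_pt :: "real \<times> 'a::real_normed_vector \<Rightarrow> (real \<times> 'a) set \<Rightarrow> ennreal" where
  "pdist_pt z B = pdist_set {z} B"

definition hausdorff_pre ::
    "nat \<Rightarrow> ennreal \<Rightarrow> (real \<times> 'a::real_normed_vector) set \<Rightarrow> ennreal" where
  "hausdorff_pre d \<delta> A =
     (INF U \<in> {U :: nat \<Rightarrow> (real \<times> 'a) set. A \<subseteq> (\<Union>i. U i) \<and> (\<forall>i. pdiam (U i) \<le> \<delta>)}.
        \<Sum>i. pdiam (U i) ^ d)"

definition hausdorff_outer :: "nat \<Rightarrow> (real \<times> 'a::real_normed_vector) set \<Rightarrow> ennreal" where
  "hausdorff_outer d A = (SUP \<delta>\<in>{0<..}. hausdorff_pre d \<delta> A)"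

text \<open>The parabolic and the Euclidean metric have the same Borel sets. The surface measure of a
  closed set \<open>E\<close> is the restriction of \<open>pH\<close> to \<open>E\<close>.\<close>

definition pH :: "'n::finite stpt measure" where
  "pH = measure_of UNIV (sets borel) (hausdorff_outer (CARD('n) + 1))"


section \<open>ADR and P-UR sets\<close>

definition ADR :: "real \<Rightarrow> 'n::finite stpt set \<Rightarrow> bool" where
  "ADR C0 E \<longleftrightarrow> closed E \<and> C0 > 0 \<and>
     (\<forall>z\<in>E. \<forall>r>0. ennreal r < pdiam E \<longrightarrow>
        ennreal (r ^ (CARD('n) + 1) / C0) \<le> emeasure pH (pball z r \<inter> E) \<and>
        emeasure pH (pball z r \<inter> E) \<le> ennreal (C0 * r ^ (CARD('n) + 1)))"

definition t_indep_plane :: "'n::finite stpt set \<Rightarrow> bool" where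
  "t_indep_plane P \<longleftrightarrow> affine P \<and> aff_dim P = int CARD('n) \<and> (\<exists>X. \<forall>s. (s, X) \<in> P)"

definition beta :: "'n::finite stpt set \<Rightarrow> 'n stpt \<Rightarrow> real \<Rightarrow> real" where
  "beta E z r =
     (INF P \<in> {P. t_indep_plane P}.
        sqrt (enn2real (\<integral>\<^sup>+ w \<in> pball z r \<inter> E. (pdist_pt w P / ennreal r)\<^sup>2 \<partial>pH)
              / r ^ (CARD('n) + 1)))"

definition PUR :: "real \<Rightarrow> real \<Rightarrow> 'n::finite stpt set \<Rightarrow> bool" where
  "PUR C0 M E \<longleftrightarrow> ADR C0 E \<and>
     (\<forall>z\<in>E. \<forall>\<rho>>0. ennreal \<rho> < pdiam E \<longrightarrow>
        (\<integral>\<^sup>+ r \<in> {0<..<\<rho>}.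
            (\<integral>\<^sup>+ w \<in> pball z \<rho> \<inter> E. ennreal ((beta E w r)\<^sup>2) \<partial>pH) * ennreal (1 / r) \<partial>lborel)
        \<le> ennreal (M * \<rho> ^ (CARD('n) + 1)))"


section \<open>Dyadic cubes and coherency\<close>

definition dyadic_system ::
    "'n::finite stpt set \<Rightarrow> real \<Rightarrow> real \<Rightarrow> real \<Rightarrow> (int \<Rightarrow> 'n cube set) \<Rightarrow> bool" where
  "dyadic_system E a0 \<gamma> cs D \<longleftrightarrow>
     (\<forall>k. countable (D k) \<and> (\<forall>Q\<in>D k. Q \<in> sets borel \<and> Q \<subseteq> E)) \<and>
     (\<forall>k. E = \<Union>(D k)) \<and>
     (\<forall>k m. k \<le> m \<longrightarrow> (\<forall>Q\<in>D m. \<forall>Q'\<in>D k. Q \<subseteq> Q' \<or> Q \<inter> Q' = {})) \<and>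
     (\<forall>k m. m < k \<longrightarrow> (\<forall>Q\<in>D k. \<exists>!Q'. Q' \<in> D m \<and> Q \<subseteq> Q')) \<and>
     (\<forall>k. \<forall>Q\<in>D k. pdiam Q \<le> ennreal (cs * 2 powr (- real_of_int k))) \<and>
     (\<forall>k. \<forall>Q\<in>D k. \<exists>z\<in>E. E \<inter> pball z (a0 * 2 powr (- real_of_int k)) \<subseteq> Q) \<and>
     (\<forall>k. \<forall>Q\<in>D k. \<forall>\<rho>\<in>{0<..<a0}.
        emeasure pH {z \<in> Q. pdist_pt z (E - Q) \<le> ennreal (\<rho> * 2 powr (- real_of_int k))}
        \<le> ennreal (cs * \<rho> powr \<gamma>) * emeasure pH Q)"

definition cubes :: "(int \<Rightarrow> 'n cube set) \<Rightarrow> 'n cube set" where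
  "cubes D = (\<Union>k. D k)"

text \<open>The constant \<open>Cc\<close> makes the two comparabilities in the definition of the center explicit.\<close>

definition is_center :: "'n::finite stpt set \<Rightarrow> real \<Rightarrow> 'n cube \<Rightarrow> 'n stpt \<Rightarrow> bool" where
  "is_center E Cc Q z \<longleftrightarrow> z \<in> E \<and>
     (\<exists>r. rdiam Q / Cc \<le> r \<and> r \<le> Cc * rdiam Q \<and>
          E \<inter> pball z r \<subseteq> Q \<and> Q \<subseteq> E \<inter> pball z (Cc * r))"

definition dilate_cube :: "'n::finite stpt set \<Rightarrow> real \<Rightarrow> 'n cube \<Rightarrow> 'n cube" where
  "dilate_cube E K Q = {z \<in> E. pdist_pt z Q < ennreal ((K - 1) * rdiam Q)}"

text \<open>A cube is a set and may belong to several generations. Requiring proper inclusion makes the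
  children of \<open>Q\<close> those taken from the finest generation containing \<open>Q\<close>; in particular \<open>Q\<close> is
  not a child of itself.\<close>

definition is_child :: "(int \<Rightarrow> 'n cube set) \<Rightarrow> 'n cube \<Rightarrow> 'n cube \<Rightarrow> bool" where
  "is_child D Q' Q \<longleftrightarrow> (\<exists>k. Q \<in> D k \<and> Q' \<in> D (k + 1) \<and> Q' \<subset> Q)"

definition is_top :: "'n cube set \<Rightarrow> 'n cube \<Rightarrow> bool" where
  "is_top S Q \<longleftrightarrow> Q \<in> S \<and> (\<forall>Q'\<in>S. Q' \<subseteq> Q)"

definition top_cube :: "'n cube set \<Rightarrow> 'n cube" where
  "top_cube S = (THE Q. is_top S Q)"

definition coherent :: "(int \<Rightarrow> 'n cube set) \<Rightarrow> 'n cube set \<Rightarrow> bool" where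
  "coherent D S \<longleftrightarrow> S \<subseteq> cubes D \<and>
     (\<exists>!Q. is_top S Q) \<and>
     (\<forall>Q\<in>S. \<forall>Q'\<in>cubes D. Q \<subseteq> Q' \<and> Q' \<subseteq> top_cube S \<longrightarrow> Q' \<in> S) \<and>
     (\<forall>Q\<in>S. (\<forall>Q'. is_child D Q' Q \<longrightarrow> Q' \<in> S) \<or> (\<forall>Q'. is_child D Q' Q \<longrightarrow> Q' \<notin> S))"


section \<open>Regular Lip(1/2,1) graphs\<close>

definition lip_half_one :: "real \<Rightarrow> (real \<times> 'a::real_normed_vector \<Rightarrow> real) \<Rightarrow> bool" where
  "lip_half_one b \<psi> \<longleftrightarrow> (\<forall>z w. \<bar>\<psi> z - \<psi> w\<bar> \<le> b * pdist z w)"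

definition half_trunc ::
    "(real \<times> 'a::real_normed_vector \<Rightarrow> real) \<Rightarrow> real \<times> 'a \<Rightarrow> real \<times> real \<Rightarrow> real" where
  "half_trunc \<psi> z = (\<lambda>(\<epsilon>, R).
     LINT s:{s. \<epsilon> < \<bar>s - fst z\<bar> \<and> \<bar>s - fst z\<bar> < R}|lborel.
       (\<psi> (s, snd z) - \<psi> z) / \<bar>s - fst z\<bar> powr (3/2))"

text \<open>For a Lip(1/2,1) function the integrand is in general not absolutely integrable at \<open>s = t\<close>
  nor at infinity; the principal value is the limit of the truncations at both ends.\<close>

definition pv_filter :: "(real \<times> real) filter" where
  "pv_filter = at_right 0 \<times>\<^sub>F at_top"

definition half_deriv_exists ::
    "(real \<times> 'a::real_normed_vector \<Rightarrow> real) \<Rightarrow> real \<times> 'a \<Rightarrow> bool" where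
  "half_deriv_exists \<psi> z \<longleftrightarrow> (\<exists>l. (half_trunc \<psi> z \<longlongrightarrow> l) pv_filter)"

text \<open>The factor normalizes the multiplier of the operator to be the square root of \<open>\<bar>\<tau>\<bar>\<close>, where
  that of the time derivative is \<open>\<i> \<tau>\<close>: the integral of \<open>(exp (\<i> \<tau> h) - 1) / \<bar>h\<bar> powr (3/2)\<close>
  over \<open>h\<close> is \<open>- 2 * sqrt (2 * pi) * sqrt \<bar>\<tau>\<bar>\<close>.\<close>

definition half_deriv :: "(real \<times> 'a::real_normed_vector \<Rightarrow> real) \<Rightarrow> real \<times> 'a \<Rightarrow> real" where
  "half_deriv \<psi> z = - 1 / (2 * sqrt (2 * pi)) * Lim pv_filter (half_trunc \<psi> z)"

definition pavg :: "(real \<times> 'a::euclidean_space) set \<Rightarrow> (real \<times> 'a \<Rightarrow> real) \<Rightarrow> real" where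
  "pavg B f = (LINT w:B|lborel. f w) / measure lborel B"

definition pbmo_norm :: "(real \<times> 'a::euclidean_space \<Rightarrow> real) \<Rightarrow> ennreal" where
  "pbmo_norm f =
     (if \<forall>z r. set_integrable lborel (pball z r) f
      then SUP z. SUP r\<in>{0<..}.
             ennreal (pavg (pball z r) (\<lambda>w. \<bar>f w - pavg (pball z r) f\<bar>))
      else \<infinity>)"

definition regular_fun :: "real \<Rightarrow> real \<Rightarrow> (real \<times> 'a::euclidean_space \<Rightarrow> real) \<Rightarrow> bool" where
  "regular_fun b1 b2 \<psi> \<longleftrightarrow> lip_half_one b1 \<psi> \<and>
     (AE z in lborel. half_deriv_exists \<psi> z) \<and> pbmo_norm (half_deriv \<psi>) \<le> ennreal b2"

text \<open>Orthonormal coordinates \<open>(t, x', x\<^sub>n)\<close> adapted to a \<open>t\<close>-independent plane \<open>P\<close>: an origin \<open>q\<close>,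
  an isometric identification \<open>L\<close> of the spatial directions of \<open>P\<close> with \<open>\<real>^(n-1)\<close>, and a unit
  normal \<open>\<nu>\<close>.\<close>

definition plane_coords ::
    "'n::finite stpt set \<Rightarrow> real^'n \<Rightarrow> (real^'m \<Rightarrow> real^'n) \<Rightarrow> real^'n \<Rightarrow> bool" where
  "plane_coords P q L \<nu> \<longleftrightarrow> linear L \<and> (\<forall>x. norm (L x) = norm x) \<and>
     norm \<nu> = 1 \<and> (\<forall>x. L x \<bullet> \<nu> = 0) \<and> P = {(t, q + L x) | t x. True}"

definition chart ::
    "real^'n \<Rightarrow> (real^'m \<Rightarrow> real^'n) \<Rightarrow> real^'n \<Rightarrow> real \<Rightarrow> real^'m \<Rightarrow> real \<Rightarrow> 'n stpt" where
  "chart q L \<nu> t x y = (t, q + L x + y *\<^sub>R \<nu>)"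

definition graph_over ::
    "real^'n \<Rightarrow> (real^'m \<Rightarrow> real^'n) \<Rightarrow> real^'n \<Rightarrow> ('m stpt \<Rightarrow> real) \<Rightarrow> 'n stpt set" where
  "graph_over q L \<nu> \<psi> = {chart q L \<nu> t x (\<psi> (t, x)) | t x. True}"

text \<open>The sign \<open>s\<close> is \<open>1\<close> or \<open>-1\<close>; this is the set where \<open>s x\<^sub>n > s \<psi>(t, x')\<close>.\<close>

definition graph_side ::
    "real^'n \<Rightarrow> (real^'m \<Rightarrow> real^'n) \<Rightarrow> real^'n \<Rightarrow> real \<Rightarrow> ('m stpt \<Rightarrow> real)
       \<Rightarrow> 'n stpt set" where
  "graph_side q L \<nu> s \<psi> = {chart q L \<nu> t x y | t x y. s * y > s * \<psi> (t, x)}"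

definition regular_graph :: "'m::finite itself \<Rightarrow> real \<Rightarrow> real \<Rightarrow> 'n::finite stpt set \<Rightarrow> bool" where
  "regular_graph _ b1 b2 \<Gamma> \<longleftrightarrow>
     (\<exists>P q (L :: real^'m \<Rightarrow> real^'n) \<nu> \<psi>.
        t_indep_plane P \<and> plane_coords P q L \<nu> \<and> regular_fun b1 b2 \<psi> \<and>
        \<Gamma> = graph_over q L \<nu> \<psi>)"


section \<open>Bilateral corona decomposition\<close>

definition bilateral_corona ::
    "'m::finite itself \<Rightarrow> 'n::finite stpt set \<Rightarrow> (int \<Rightarrow> 'n cube set) \<Rightarrow> ('n cube \<Rightarrow> 'n stpt)
       \<Rightarrow> real \<Rightarrow> real \<Rightarrow> real \<Rightarrow> 'n cube set \<Rightarrow> 'n cube set \<Rightarrow> 'n cube set set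
       \<Rightarrow> ('n cube set \<Rightarrow> 'n stpt set) \<Rightarrow> bool" where
  "bilateral_corona T E D ctr \<eta> b2 C\<eta> \<G> \<B> \<S> \<Gamma> \<longleftrightarrow>
     cubes D = \<G> \<union> \<B> \<and> \<G> \<inter> \<B> = {} \<and>
     \<G> = \<Union>\<S> \<and> pairwise disjnt \<S> \<and> (\<forall>S\<in>\<S>. coherent D S) \<and>
     (\<forall>Q\<in>cubes D.
        (\<Sum>\<^sub>\<infinity>Q'\<in>{Q'\<in>\<B>. Q' \<subseteq> Q}. emeasure pH Q') +
        (\<Sum>\<^sub>\<infinity>S\<in>{S\<in>\<S>. top_cube S \<subseteq> Q}. emeasure pH (top_cube S))
        \<le> ennreal C\<eta> * emeasure pH Q) \<and>
     (\<forall>S\<in>\<S>. regular_graph T \<eta> b2 (\<Gamma> S) \<and>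
        (\<forall>Q\<in>S.
           (SUP z \<in> dilate_cube E (1 / \<eta>) Q. pdist_pt z (\<Gamma> S)) +
           (SUP z \<in> pball (ctr Q) (1 / \<eta> * rdiam Q) \<inter> \<Gamma> S. pdist_pt z E)
           < ennreal (\<eta> * rdiam Q)))"


section \<open>Whitney regions\<close>

text \<open>The closed parabolic cube with center \<open>z\<close>, spatial side length \<open>l\<close> and time length \<open>l\<^sup>2\<close>.\<close>

definition pcube :: "'n::finite stpt \<Rightarrow> real \<Rightarrow> 'n stpt set" where
  "pcube z l = {w. \<bar>fst w - fst z\<bar> \<le> l\<^sup>2 / 2 \<and> (\<forall>i. \<bar>snd w $ i - snd z $ i\<bar> \<le> l / 2)}"

definition dyadic_params :: "'n::finite stpt \<Rightarrow> real \<Rightarrow> bool" where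
  "dyadic_params z l \<longleftrightarrow>
     (\<exists>k::int. l = 2 powr (real_of_int k)) \<and>
     (\<exists>j::int. fst z = (real_of_int j + 1/2) * l\<^sup>2) \<and>
     (\<forall>i. \<exists>j::int. snd z $ i = (real_of_int j + 1/2) * l)"

definition whitney :: "'n::finite stpt set \<Rightarrow> 'n stpt set set \<Rightarrow> bool" where
  "whitney E W \<longleftrightarrow>
     \<Union>W = - E \<and>
     (\<forall>I\<in>W. \<forall>J\<in>W. I \<noteq> J \<longrightarrow> interior I \<inter> interior J = {}) \<and>
     (\<forall>I\<in>W. \<exists>z l. dyadic_params z l \<and> I = pcube z l \<and>
        4 * pdiam I \<le> pdist_set (pcube z (4 * l)) E \<and>
        pdist_set (pcube z (4 * l)) E \<le> pdist_set I E \<and>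
        pdist_set I E \<le> 100 * pdiam I)"

text \<open>\<open>whitney_near E W a b Q\<close> with \<open>(a, b)\<close> equal to \<open>(\<eta>^(1/4), K^(1/4))\<close> and \<open>(\<eta>^4, K)\<close> gives
  the two families of Whitney cubes associated with \<open>Q\<close>.\<close>

definition whitney_near ::
    "'n::finite stpt set \<Rightarrow> 'n stpt set set \<Rightarrow> real \<Rightarrow> real \<Rightarrow> 'n cube \<Rightarrow> 'n stpt set set" where
  "whitney_near E W a b Q =
     {I\<in>W. ennreal (a * rdiam Q) \<le> pdist_set I E \<and> pdist_set I E \<le> pdist_set I Q \<and>
           pdist_set I Q \<le> ennreal (b * rdiam Q)}"

definition W_Q ::
    "'n::finite stpt set \<Rightarrow> 'n stpt set set \<Rightarrow> real \<Rightarrow> 'n cube \<Rightarrow> 'n stpt set set" where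
  "W_Q E W \<eta> Q = whitney_near E W (\<eta> powr (1/4)) ((1 / \<eta>) powr (1/4)) Q"

definition Wstar_Q ::
    "'n::finite stpt set \<Rightarrow> 'n stpt set set \<Rightarrow> real \<Rightarrow> 'n cube \<Rightarrow> 'n stpt set set" where
  "Wstar_Q E W \<eta> Q = whitney_near E W (\<eta> ^ 4) (1 / \<eta>) Q"

definition Ustar_Q ::
    "'n::finite stpt set \<Rightarrow> 'n stpt set set \<Rightarrow> real \<Rightarrow> 'n cube \<Rightarrow> 'n stpt set" where
  "Ustar_Q E W \<eta> Q = \<Union>(Wstar_Q E W \<eta> Q)"


section \<open>The local square function constant\<close>

definition dt :: "(real \<times> 'a \<Rightarrow> real) \<Rightarrow> real \<times> 'a \<Rightarrow> real" where
  "dt u z = deriv (\<lambda>s. u (s, snd z)) (fst z)"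

definition dx :: "'a::real_normed_vector \<Rightarrow> (real \<times> 'a \<Rightarrow> real) \<Rightarrow> real \<times> 'a \<Rightarrow> real" where
  "dx e u z = deriv (\<lambda>h. u (fst z, snd z + h *\<^sub>R e)) 0"

text \<open>Classical solutions; by interior regularity every weak solution is one.\<close>

definition heat_solution :: "(real \<times> 'a::euclidean_space) set \<Rightarrow> (real \<times> 'a \<Rightarrow> real) \<Rightarrow> bool" where
  "heat_solution D u \<longleftrightarrow>
     continuous_on D u \<and> continuous_on D (dt u) \<and>
     (\<forall>e\<in>Basis. continuous_on D (dx e u)) \<and>
     (\<forall>e\<in>Basis. \<forall>f\<in>Basis. continuous_on D (dx f (dx e u))) \<and>
     (\<forall>z\<in>D. (\<lambda>s. u (s, snd z)) differentiable (at (fst z)) \<and>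
        (\<forall>e\<in>Basis. (\<lambda>h. u (fst z, snd z + h *\<^sub>R e)) differentiable (at 0) \<and>
           (\<forall>f\<in>Basis. (\<lambda>h. dx e u (fst z, snd z + h *\<^sub>R f)) differentiable (at 0))) \<and>
        dt u z - (\<Sum>e\<in>Basis. dx e (dx e u) z) = 0)"

text \<open>Here the spatial variable is \<open>(x', x\<^sub>n)\<close> in \<open>real ^ 'm \<times> real\<close>, and \<open>n + 1 = CARD('m) + 2\<close>.\<close>

definition side_domain ::
    "real \<Rightarrow> ('m stpt \<Rightarrow> real) \<Rightarrow> (real \<times> (real^'m) \<times> real) set" where
  "side_domain s \<phi> = {(t, x, y). s * y > s * \<phi> (t, x)}"

definition square_function_const :: "'m::finite itself \<Rightarrow> real \<Rightarrow> real \<Rightarrow> real \<Rightarrow> bool" where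
  "square_function_const _ b1 b2 M0 \<longleftrightarrow> M0 > 1 \<and>
     (\<exists>c5. \<forall>\<phi> :: 'm stpt \<Rightarrow> real. regular_fun b1 b2 \<phi> \<longrightarrow>
        (\<forall>s\<in>{1, -1}. \<forall>z0\<in>frontier (side_domain s \<phi>). \<forall>r>0. \<forall>u.
           heat_solution (pball z0 (M0 * r) \<inter> side_domain s \<phi>) u \<and>
           bounded (u ` (pball z0 (M0 * r) \<inter> side_domain s \<phi>)) \<longrightarrow>
           (\<integral>\<^sup>+ z \<in> pball z0 r \<inter> side_domain s \<phi>.
              ennreal (\<Sum>e\<in>Basis. (dx e u z)\<^sup>2) * pdist_pt z (frontier (side_domain s \<phi>)) \<partial>lborel)
           \<le> ennreal (c5 * r ^ (CARD('m) + 2) *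
                (SUP z \<in> pball z0 (M0 * r) \<inter> side_domain s \<phi>. \<bar>u z\<bar>)\<^sup>2)))"

end

theory Submission
  imports Defs
begin

text \<open>
  Over the plane of the corona graph, with defining function \<open>\<psi>\<close>, put
  \<open>\<psi>\<^sup>\<plusminus> = \<psi> \<plusminus> \<eta>^(15/16) g\<close>, where \<open>g(p)\<^sup>2\<close> is the infimum of
  \<open>diam(Q)\<^sup>2 + \<bar>x - y\<bar>\<^sup>2 + \<bar>t - s\<bar>\<close> over \<open>Q \<in> S\<close> and projections \<open>(s, y)\<close> of points of \<open>Q\<close>,
  capped at \<open>diam(Q\<^sub>S)\<^sup>2\<close>. As an infimum, \<open>g\<^sup>2\<close> is 1-Lipschitz in time, hence
  \<open>\<bar>g(s) - g(t)\<bar> \<le> min (\<bar>s - t\<bar> / m) m\<close> with \<open>m = max (g(s)) (g(t))\<close>. Since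
  \<open>min (\<bar>u\<bar> / m) m / \<bar>u\<bar>^(3/2)\<close> has integral 8 for every \<open>m > 0\<close>, Tonelli's theorem bounds the mean over a
  parabolic ball of the part of \<open>D\<^sub>t\<^sup>1\<^sup>/\<^sup>2 g\<close> coming from increments inside the ball; the part
  coming from longer increments has bounded oscillation. So \<open>D\<^sub>t\<^sup>1\<^sup>/\<^sup>2 g\<close> is in BMO, without any
  smoothing.

  On the scale \<open>g\<close> the set \<open>E\<close> is within \<open>O(\<eta> g)\<close> of the graph of \<open>\<psi>\<close>, which is much less
  than \<open>\<eta>^(15/16) g\<close>: thus \<open>E\<close> lies between the two shifted graphs. Conversely Whitney cubes in
  \<open>W_Q\<close> are at distance at least \<open>\<eta>^(1/4) diam(Q)\<close> from \<open>E\<close>, and \<open>\<eta>^(15/16) g\<close> is much smaller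
  than that there, so they lie outside.
\<close>

section \<open>Measurability of the half-order time derivative\<close>

text \<open>Why the exponent 15/16: the shift must dominate the corona error
  \<open>2 * eta * g\<close>, and at points of the Whitney cubes of Q, where g can be as large as
  about \<eta>^(-1/4) diam(Q), it must remain far below their clearance \<eta>^(1/4) diam(Q).
  Exponents strictly between 1/2 and 1 meet both demands, and the small factor also makes the BMO
  norm of the shift at most 1. The cap bounds the time increments of g, so that its principal value
  converges absolutely almost everywhere, which that of \<psi> need not do. The geometric obstacle
  is that g measures horizontal distance only: a cube that realises it may be too small to see a
  given point of space. The remedy is to pass to an ancestor in \<open>S\<close> of prescribed size;
  this needs a lower bound for diameters of dyadic cubes, and hence ADR. The threshold for
  \<open>M0\<close> stands apart from the others because \<open>M0\<close> depends on
  \<open>b2\<close>, hence on the P-UR constants, whereas the remaining smallness conditions involve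
  only the dimension, ADR and the constants of the cubes.\<close>

definition half_kernel :: "(real \<times> 'a::real_normed_vector \<Rightarrow> real) \<Rightarrow> real \<times> 'a \<Rightarrow> real \<Rightarrow> real" where
  "half_kernel f z u = (f (fst z + u, snd z) - f z) / \<bar>u\<bar> powr (3/2)"

lemma half_trunc_eq:
  "half_trunc f z (\<epsilon>, R) =
     (\<integral>u. indicator {u. \<epsilon> < \<bar>u\<bar> \<and> \<bar>u\<bar> < R} u * half_kernel f z u \<partial>lborel)"
  unfolding half_trunc_def split_conv set_lebesgue_integral_def half_kernel_def
  by (subst lborel_integral_real_affine[where c = 1 and t = "fst z"])
     (auto intro!: Bochner_Integration.integral_cong simp: indicator_def)

lemma integrable_half_kernel_annulus:
  assumes "continuous_on UNIV f" and "0 < \<epsilon>"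
  shows "integrable lborel (\<lambda>u. indicator {u. \<epsilon> < \<bar>u\<bar> \<and> \<bar>u\<bar> < R} u * half_kernel f z u)"
proof -
  let ?S = "{-R..R} - {-\<epsilon><..<\<epsilon>}"
  have "compact ?S"
    by (intro compact_diff) auto
  moreover have "continuous_on ?S (half_kernel f z)"
    unfolding half_kernel_def
    using assms(2)
    by (intro continuous_intros continuous_on_compose2[OF assms(1)]) auto
  ultimately have "set_integrable lborel ?S (half_kernel f z)"
    unfolding set_integrable_def by (rule borel_integrable_compact)
  then have "set_integrable lborel {u. \<epsilon> < \<bar>u\<bar> \<and> \<bar>u\<bar> < R} (half_kernel f z)"
    by (rule set_integrable_subset) auto
  then show ?thesis by (simp add: set_integrable_def)
qed

lemma borel_measurable_half_trunc:
  fixes f :: "real \<times> 'a::euclidean_space \<Rightarrow> real"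
  assumes "continuous_on UNIV f"
  shows "(\<lambda>z. half_trunc f z (\<epsilon>, R)) \<in> borel_measurable borel"
proof -
  have sets: "sets (borel \<Otimes>\<^sub>M lborel) = sets (borel :: ((real \<times> 'a) \<times> real) measure)"
    by (metis borel_prod sets_lborel sets_pair_measure_cong)
  have "(\<lambda>p::(real \<times> 'a) \<times> real. f (fst (fst p) + snd p, snd (fst p))) \<in> borel_measurable borel"
    by (intro borel_measurable_continuous_onI continuous_on_compose2[OF assms] continuous_intros) auto
  then have [measurable]: "(\<lambda>p::(real \<times> 'a) \<times> real. f (fst (fst p) + snd p, snd (fst p)))
      \<in> borel_measurable (borel \<Otimes>\<^sub>M lborel)"
    by (simp only: measurable_cong_sets[OF sets refl])
  have [measurable]: "f \<in> borel_measurable borel"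
    by (rule borel_measurable_continuous_onI[OF assms])
  have "(\<lambda>p::(real \<times> 'a) \<times> real. indicator {u. \<epsilon> < \<bar>u\<bar> \<and> \<bar>u\<bar> < R} (snd p) * half_kernel f (fst p) (snd p))
     \<in> borel_measurable (borel \<Otimes>\<^sub>M lborel)"
    unfolding half_kernel_def
    by measurable
  then show ?thesis
    unfolding half_trunc_eq
    by (intro lborel.borel_measurable_lebesgue_integral) (simp add: case_prod_beta')
qed

text \<open>Cut-offs approaching from inside keep every annulus within the limit annulus, so the
  limit integrand dominates, and membership of each point is eventually constant. This direction of
  approach is the one needed to pass from rational to real cut-offs.\<close>

lemma half_trunc_tendsto_inner:
  assumes f: "continuous_on UNIV f" and "0 < \<epsilon>"
    and a: "a \<longlonglongrightarrow> \<epsilon>" "\<And>n. \<epsilon> < a n" and b: "b \<longlonglongrightarrow> R" "\<And>n. b n < R"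
  shows "(\<lambda>n. half_trunc f z (a n, b n)) \<longlonglongrightarrow> half_trunc f z (\<epsilon>, R)"
  unfolding half_trunc_eq
proof (rule integral_dominated_convergence)
  let ?w = "\<lambda>u. indicator {u. \<epsilon> < \<bar>u\<bar> \<and> \<bar>u\<bar> < R} u * half_kernel f z u"
  show int: "integrable lborel (\<lambda>u. \<bar>?w u\<bar>)"
    using integrable_half_kernel_annulus[OF f \<open>0 < \<epsilon>\<close>] by auto
  show "?w \<in> borel_measurable lborel"
    using integrable_half_kernel_annulus[OF f \<open>0 < \<epsilon>\<close>] by auto
  show "(\<lambda>u. indicator {u. a n < \<bar>u\<bar> \<and> \<bar>u\<bar> < b n} u * half_kernel f z u) \<in> borel_measurable lborel" for n
    using integrable_half_kernel_annulus[OF f, of "a n"] a(2)[of n] \<open>0 < \<epsilon>\<close> by auto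
  show "AE u in lborel. (\<lambda>n. indicator {u. a n < \<bar>u\<bar> \<and> \<bar>u\<bar> < b n} u * half_kernel f z u) \<longlonglongrightarrow> ?w u"
  proof (rule AE_I2, rule tendsto_mult_right, rule tendsto_eventually)
    fix u :: real
    show "\<forall>\<^sub>F n in sequentially. indicator {u. a n < \<bar>u\<bar> \<and> \<bar>u\<bar> < b n} u =
        (indicator {u. \<epsilon> < \<bar>u\<bar> \<and> \<bar>u\<bar> < R} u :: real)"
    proof (cases "\<epsilon> < \<bar>u\<bar> \<and> \<bar>u\<bar> < R")
      case True
      have "\<forall>\<^sub>F n in sequentially. a n < \<bar>u\<bar>" "\<forall>\<^sub>F n in sequentially. \<bar>u\<bar> < b n"
        using order_tendstoD(2)[OF a(1)] order_tendstoD(1)[OF b(1)] True by auto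
      then show ?thesis
        by eventually_elim (use True in \<open>auto simp: indicator_def\<close>)
    next
      case False
      then have "\<not> (a n < \<bar>u\<bar> \<and> \<bar>u\<bar> < b n)" for n
        using a(2)[of n] b(2)[of n] by auto
      then show ?thesis using False by (auto simp: indicator_def)
    qed
  qed
  fix n
  show "AE u in lborel. norm (indicator {u. a n < \<bar>u\<bar> \<and> \<bar>u\<bar> < b n} u * half_kernel f z u) \<le> \<bar>?w u\<bar>"
    using a(2)[of n] b(2)[of n] by (intro AE_I2) (auto simp: indicator_def)
qed

lemma pv_filter_nontrivial [simp]: "pv_filter \<noteq> bot"
  by (simp add: pv_filter_def prod_filter_eq_bot trivial_limit_at_right_real)

text \<open>A single integer bounds both cut-offs, so the tails of the product filter have a
  countable base; quantifying over tails then preserves measurability.\<close>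

lemma eventually_pv_filter:
  "eventually P pv_filter \<longleftrightarrow>
     (\<exists>N::nat. \<forall>\<epsilon> R. 0 < \<epsilon> \<and> \<epsilon> < 1 / real (Suc N) \<and> real (Suc N) < R \<longrightarrow> P (\<epsilon>, R))"
proof
  assume "eventually P pv_filter"
  then obtain Pf Pg where P: "eventually Pf (at_right 0)" "eventually Pg at_top"
    "\<And>x y. Pf x \<Longrightarrow> Pg y \<Longrightarrow> P (x, y)"
    unfolding pv_filter_def eventually_prod_filter by auto
  obtain b :: real where b: "b > 0" "\<And>y. 0 < y \<Longrightarrow> y < b \<Longrightarrow> Pf y"
    using P(1) unfolding eventually_at_right_field by auto
  obtain c :: real where c: "\<And>y. c \<le> y \<Longrightarrow> Pg y"
    using P(2) unfolding eventually_at_top_linorder by auto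
  obtain N :: nat where N: "max c (1 / b) < real N"
    using reals_Archimedean2 by blast
  have "1 / real (Suc N) < b"
    using N b(1) by (auto simp: field_simps)
  then have "P (\<epsilon>, R)" if "0 < \<epsilon>" "\<epsilon> < 1 / real (Suc N)" "real (Suc N) < R" for \<epsilon> R
    using that N by (intro P(3) b(2) c) auto
  then show "\<exists>N::nat. \<forall>\<epsilon> R. 0 < \<epsilon> \<and> \<epsilon> < 1 / real (Suc N) \<and> real (Suc N) < R \<longrightarrow> P (\<epsilon>, R)"
    by blast
next
  assume "\<exists>N::nat. \<forall>\<epsilon> R. 0 < \<epsilon> \<and> \<epsilon> < 1 / real (Suc N) \<and> real (Suc N) < R \<longrightarrow> P (\<epsilon>, R)"
  then obtain N :: nat where N: "\<And>\<epsilon> R. 0 < \<epsilon> \<and> \<epsilon> < 1 / real (Suc N) \<and> real (Suc N) < R \<Longrightarrow> P (\<epsilon>, R)"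
    by blast
  have "\<forall>\<^sub>F \<epsilon> in at_right (0::real). 0 < \<epsilon> \<and> \<epsilon> < 1 / real (Suc N)"
    unfolding eventually_at_right_field by (intro exI[of _ "1 / real (Suc N)"]) auto
  moreover have "\<forall>\<^sub>F R in at_top. real (Suc N) < R"
    by (rule eventually_gt_at_top)
  ultimately show "eventually P pv_filter"
    unfolding pv_filter_def eventually_prod_filter using N by blast
qed

text \<open>Continuity of the truncations in the cut-offs reduces the Cauchy criterion to rational ones.\<close>

lemma half_deriv_exists_iff_Cauchy:
  assumes f: "continuous_on UNIV f"
  shows "half_deriv_exists f z \<longleftrightarrow>
    (\<forall>k::nat. \<exists>N::nat. \<forall>a b c d::rat.
       0 < a \<and> of_rat a < 1 / real (Suc N) \<and> real (Suc N) < of_rat b \<and>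
       0 < c \<and> of_rat c < 1 / real (Suc N) \<and> real (Suc N) < of_rat d \<longrightarrow>
       \<bar>half_trunc f z (of_rat a, of_rat b) - half_trunc f z (of_rat c, of_rat d)\<bar> \<le> 1 / real (Suc k))"
    (is "_ \<longleftrightarrow> (\<forall>k. \<exists>N. ?C k N)")
proof
  assume "half_deriv_exists f z"
  then obtain l where l: "(half_trunc f z \<longlongrightarrow> l) pv_filter"
    by (auto simp: half_deriv_exists_def)
  show "\<forall>k. \<exists>N. ?C k N"
  proof
    fix k :: nat
    have "\<forall>\<^sub>F x in pv_filter. dist (half_trunc f z x) l < 1 / (2 * real (Suc k))"
      using l by (rule tendstoD) auto
    then obtain N where N: "\<And>\<epsilon> R. 0 < \<epsilon> \<and> \<epsilon> < 1 / real (Suc N) \<and> real (Suc N) < R \<Longrightarrow>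
        dist (half_trunc f z (\<epsilon>, R)) l < 1 / (2 * real (Suc k))"
      unfolding eventually_pv_filter by blast
    have "?C k N"
    proof (intro allI impI)
      fix a b c d :: rat
      assume *: "0 < a \<and> of_rat a < 1 / real (Suc N) \<and> real (Suc N) < of_rat b \<and>
       0 < c \<and> of_rat c < 1 / real (Suc N) \<and> real (Suc N) < of_rat d"
      have "1 / (2 * real (Suc k)) + 1 / (2 * real (Suc k)) = 1 / real (Suc k)"
        by (simp add: field_simps)
      moreover have "dist (half_trunc f z (of_rat a, of_rat b)) l < 1 / (2 * real (Suc k))"
        using * by (intro N) auto
      moreover have "dist (half_trunc f z (of_rat c, of_rat d)) l < 1 / (2 * real (Suc k))"
        using * by (intro N) auto
      ultimately show "\<bar>half_trunc f z (of_rat a, of_rat b) - half_trunc f z (of_rat c, of_rat d)\<bar> \<le> 1 / real (Suc k)"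
        unfolding dist_real_def by (smt (verit))
    qed
    then show "\<exists>N. ?C k N" ..
  qed
next
  assume *: "\<forall>k. \<exists>N. ?C k N"
  \<comment> \<open>Rational cut-offs tend to \<epsilon> from above and to R from below without
    leaving the tail region, so the rational Cauchy bound passes to the limit.\<close>
  have seq: "\<exists>q p. (\<lambda>n. of_rat (q n)) \<longlonglongrightarrow> \<epsilon> \<and> (\<forall>n. \<epsilon> < of_rat (q n) \<and> of_rat (q n) < e1) \<and>
                   (\<lambda>n. of_rat (p n)) \<longlonglongrightarrow> R \<and> (\<forall>n. of_rat (p n) < R \<and> r1 < of_rat (p n))"
    if "\<epsilon> < e1" "r1 < R" for \<epsilon> e1 r1 R :: real
  proof -
    have "\<forall>n. \<exists>q. \<epsilon> < of_rat q \<and> of_rat q < min e1 (\<epsilon> + 1 / real (Suc n))"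
      using that by (intro allI of_rat_dense) auto
    then obtain q where q: "\<And>n. \<epsilon> < of_rat (q n) \<and> of_rat (q n) < min e1 (\<epsilon> + 1 / real (Suc n))"
      by metis
    have "\<forall>n. \<exists>q. max r1 (R - 1 / real (Suc n)) < of_rat q \<and> of_rat q < R"
      using that by (intro allI of_rat_dense) auto
    then obtain p where p: "\<And>n. max r1 (R - 1 / real (Suc n)) < of_rat (p n) \<and> of_rat (p n) < R"
      by metis
    have lim: "(\<lambda>n. x + 1 / real (Suc n)) \<longlonglongrightarrow> x" "(\<lambda>n. x - 1 / real (Suc n)) \<longlonglongrightarrow> x" for x :: real
      using tendsto_add[OF tendsto_const LIMSEQ_inverse_real_of_nat, of x]
        tendsto_diff[OF tendsto_const LIMSEQ_inverse_real_of_nat, of x]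
      by (auto simp: inverse_eq_divide)
    have "(\<lambda>n. of_rat (q n)) \<longlonglongrightarrow> \<epsilon>"
      by (rule tendsto_sandwich[OF _ _ tendsto_const lim(1)[of \<epsilon>]])
         (use q in \<open>auto intro!: always_eventually less_imp_le\<close>)
    moreover have "(\<lambda>n. of_rat (p n)) \<longlonglongrightarrow> R"
      by (rule tendsto_sandwich[OF _ _ lim(2)[of R] tendsto_const])
         (use p in \<open>auto intro!: always_eventually less_imp_le\<close>)
    ultimately show ?thesis using q p by (intro exI[of _ q] exI[of _ p]) auto
  qed
  have real_Cauchy: "\<exists>N::nat. \<forall>a b c d::real.
       0 < a \<and> a < 1 / real (Suc N) \<and> real (Suc N) < b \<and>
       0 < c \<and> c < 1 / real (Suc N) \<and> real (Suc N) < d \<longrightarrow>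
       \<bar>half_trunc f z (a, b) - half_trunc f z (c, d)\<bar> \<le> 1 / real (Suc k)" for k
  proof -
    obtain N where N: "?C k N" using * by blast
    have "\<bar>half_trunc f z (a, b) - half_trunc f z (c, d)\<bar> \<le> 1 / real (Suc k)"
      if h: "0 < a" "a < 1 / real (Suc N)" "real (Suc N) < b" "0 < c" "c < 1 / real (Suc N)" "real (Suc N) < d"
      for a b c d :: real
    proof -
      obtain q p where qp: "(\<lambda>n. of_rat (q n)) \<longlonglongrightarrow> a" "\<And>n. a < of_rat (q n)" "\<And>n. of_rat (q n) < 1 / real (Suc N)"
        "(\<lambda>n. of_rat (p n)) \<longlonglongrightarrow> b" "\<And>n. of_rat (p n) < b" "\<And>n. real (Suc N) < of_rat (p n)"
        using seq[OF h(2,3)] by blast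
      obtain q' p' where qp': "(\<lambda>n. of_rat (q' n)) \<longlonglongrightarrow> c" "\<And>n. c < of_rat (q' n)" "\<And>n. of_rat (q' n) < 1 / real (Suc N)"
        "(\<lambda>n. of_rat (p' n)) \<longlonglongrightarrow> d" "\<And>n. of_rat (p' n) < d" "\<And>n. real (Suc N) < of_rat (p' n)"
        using seq[OF h(5,6)] by blast
      have pos: "0 < q n" "0 < q' n" for n
        using qp(2)[of n] qp'(2)[of n] h(1,4)
        by (metis less_trans of_rat_less of_rat_0)+
      have "(\<lambda>n. \<bar>half_trunc f z (of_rat (q n), of_rat (p n)) - half_trunc f z (of_rat (q' n), of_rat (p' n))\<bar>)
        \<longlonglongrightarrow> \<bar>half_trunc f z (a, b) - half_trunc f z (c, d)\<bar>"
        using half_trunc_tendsto_inner[OF f h(1) qp(1,2,4,5)] half_trunc_tendsto_inner[OF f h(4) qp'(1,2,4,5)]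
        by (intro tendsto_intros)
      then show ?thesis
        by (rule LIMSEQ_le_const2)
           (use N qp qp' pos in \<open>auto simp del: of_nat_Suc\<close>)
    qed
    then show ?thesis by blast
  qed
  \<comment> \<open>A diagonal sequence supplies the candidate limit. The shift by 2 makes the
    cut-offs of every index n \<ge> N satisfy the strict bounds 1 / (N + 1) and N + 1.\<close>
  define X where "X n = half_trunc f z (1 / (real n + 2), real n + 2)" for n :: nat
  have X: "\<bar>X n - half_trunc f z (c, d)\<bar> \<le> 1 / real (Suc k)"
    if "\<forall>a b c d::real. 0 < a \<and> a < 1 / real (Suc N) \<and> real (Suc N) < b \<and>
       0 < c \<and> c < 1 / real (Suc N) \<and> real (Suc N) < d \<longrightarrow>
       \<bar>half_trunc f z (a, b) - half_trunc f z (c, d)\<bar> \<le> 1 / real (Suc k)" "n \<ge> N"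
       "0 < c" "c < 1 / real (Suc N)" "real (Suc N) < d" for N k n c d
    unfolding X_def using that(2-) by (intro that(1)[rule_format]) (auto simp: frac_less2)
  have "Cauchy X"
  proof (rule metric_CauchyI)
    fix e :: real assume "0 < e"
    then obtain k where k: "1 / real (Suc k) < e"
      using reals_Archimedean by (auto simp: inverse_eq_divide)
    obtain N where N: "\<forall>a b c d::real. 0 < a \<and> a < 1 / real (Suc N) \<and> real (Suc N) < b \<and>
       0 < c \<and> c < 1 / real (Suc N) \<and> real (Suc N) < d \<longrightarrow>
       \<bar>half_trunc f z (a, b) - half_trunc f z (c, d)\<bar> \<le> 1 / real (Suc k)"
      using real_Cauchy[of k] by blast
    have "dist (X m) (X n) < e" if "m \<ge> N" "n \<ge> N" for m n
    proof -
      have "\<bar>X m - X n\<bar> \<le> 1 / real (Suc k)"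
        unfolding X_def[of n] using that by (intro X[OF N that(1)]) (auto simp: frac_less2)
      then show ?thesis using k by (simp add: dist_real_def)
    qed
    then show "\<exists>M. \<forall>m\<ge>M. \<forall>n\<ge>M. dist (X m) (X n) < e" by blast
  qed
  then obtain l where l: "X \<longlonglongrightarrow> l"
    using Cauchy_convergent convergent_def by blast
  have "(half_trunc f z \<longlongrightarrow> l) pv_filter"
  proof (rule tendstoI)
    fix e :: real assume "0 < e"
    then obtain k where k: "1 / real (Suc k) < e"
      using reals_Archimedean by (auto simp: inverse_eq_divide)
    obtain N where N: "\<forall>a b c d::real. 0 < a \<and> a < 1 / real (Suc N) \<and> real (Suc N) < b \<and>
       0 < c \<and> c < 1 / real (Suc N) \<and> real (Suc N) < d \<longrightarrow>
       \<bar>half_trunc f z (a, b) - half_trunc f z (c, d)\<bar> \<le> 1 / real (Suc k)"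
      using real_Cauchy[of k] by blast
    have "dist (half_trunc f z (c, d)) l < e" if "0 < c" "c < 1 / real (Suc N)" "real (Suc N) < d" for c d
    proof -
      have "(\<lambda>n. \<bar>X n - half_trunc f z (c, d)\<bar>) \<longlonglongrightarrow> \<bar>l - half_trunc f z (c, d)\<bar>"
        by (intro tendsto_intros l)
      then have "\<bar>l - half_trunc f z (c, d)\<bar> \<le> 1 / real (Suc k)"
        by (rule LIMSEQ_le_const2) (use X[OF N] that in blast)
      then show ?thesis using k by (simp add: dist_real_def abs_minus_commute)
    qed
    then show "\<forall>\<^sub>F x in pv_filter. dist (half_trunc f z x) l < e"
      unfolding eventually_pv_filter by blast
  qed
  then show "half_deriv_exists f z" by (auto simp: half_deriv_exists_def)
qed

lemma half_deriv_eqI: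
  "(half_trunc f z \<longlongrightarrow> l) pv_filter \<Longrightarrow> half_deriv f z = - 1 / (2 * sqrt (2 * pi)) * l"
  by (simp add: half_deriv_def tendsto_Lim)

text \<open>\<open>pbmo_norm\<close> is finite only if \<open>half_deriv\<close> is integrable on
  balls, which demands measurability also across points where the principal value fails. The
  convergence points form a Borel set, and on it one sequence of cut-offs computes the
  limit.\<close>

lemma borel_measurable_half_deriv:
  fixes f :: "real \<times> 'a::euclidean_space \<Rightarrow> real"
  assumes f: "continuous_on UNIV f"
  shows "half_deriv f \<in> borel_measurable borel"
proof -
  note [measurable] = borel_measurable_half_trunc[OF f]
  have [measurable]: "Measurable.pred borel (half_deriv_exists f)"
    unfolding half_deriv_exists_iff_Cauchy[OF f] by measurable
  define X where "X z n = half_trunc f z (1 / real (n + 2), real (n + 2))" for z and n :: nat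
  have [measurable]: "(\<lambda>z. X z n) \<in> borel_measurable borel" for n
    unfolding X_def by measurable
  \<comment> \<open>At a point of divergence \<open>Lim\<close> is a definite description of the
    empty predicate, hence the same unspecified number at all such points.\<close>
  have "Lim pv_filter (half_trunc f z) = (if half_deriv_exists f z then lim (X z) else (THE l. False))" for z
  proof (cases "half_deriv_exists f z")
    case True
    then obtain l where l: "(half_trunc f z \<longlongrightarrow> l) pv_filter"
      by (auto simp: half_deriv_exists_def)
    have "filterlim (\<lambda>n. (1 / real (n + 2), real (n + 2))) pv_filter sequentially"
      unfolding filterlim_iff eventually_pv_filter
    proof safe
      fix P :: "real \<times> real \<Rightarrow> bool" and N :: nat
      assume N: "\<forall>\<epsilon> R. 0 < \<epsilon> \<and> \<epsilon> < 1 / real (Suc N) \<and> real (Suc N) < R \<longrightarrow> P (\<epsilon>, R)"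
      show "\<forall>\<^sub>F n in sequentially. P (1 / real (n + 2), real (n + 2))"
        using eventually_ge_at_top[of N]
        by eventually_elim (intro N[rule_format], auto simp: frac_less2)
    qed
    then have "X z \<longlonglongrightarrow> l"
      unfolding X_def by (rule filterlim_compose[OF l])
    with l True show ?thesis by (simp add: tendsto_Lim limI)
  next
    case False
    then have "(\<lambda>l. (half_trunc f z \<longlongrightarrow> l) pv_filter) = (\<lambda>l. False)"
      by (auto simp: half_deriv_exists_def)
    with False show ?thesis by (simp add: t2_space_class.Lim_def)
  qed
  then have "half_deriv f = (\<lambda>z. - 1 / (2 * sqrt (2 * pi)) * (if half_deriv_exists f z then lim (X z) else (THE l. False)))"
    by (intro ext) (simp add: half_deriv_def)
  also have "\<dots> \<in> borel_measurable borel" by measurable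
  finally show ?thesis .
qed

section \<open>Kernel integrals and principal values\<close>

lemma continuous_on_pdist:
  "continuous_on UNIV (\<lambda>w. pdist z (w :: real \<times> 'a::real_normed_vector))"
  unfolding pdist_def by (intro continuous_intros)

lemma open_pball: "open (pball z r)"
  unfolding pball_def by (intro open_Collect_less continuous_on_pdist continuous_on_const)

lemma pball_borel [measurable]: "pball z r \<in> sets borel"
  by (simp add: open_pball)

lemma pball_subset_box: "pball z r \<subseteq> {fst z - r\<^sup>2..fst z + r\<^sup>2} \<times> ball (snd z) r"
proof safe
  fix t x assume "(t, x) \<in> pball z r"
  then have *: "norm (snd z - x) + sqrt \<bar>fst z - t\<bar> < r" by (simp add: pball_def pdist_def)
  then have "sqrt \<bar>fst z - t\<bar> \<le> r" by (smt (verit) norm_ge_zero)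
  then have "\<bar>fst z - t\<bar> \<le> r\<^sup>2" by (simp add: sqrt_le_D)
  then show "t \<in> {fst z - r\<^sup>2..fst z + r\<^sup>2}" by auto
  show "x \<in> ball (snd z) r" using * by (auto simp: dist_norm) (smt (verit) real_sqrt_ge_zero)
qed

lemma lip_half_one_continuous:
  assumes "lip_half_one b f"
  shows "continuous_on UNIV f"
proof -
  have "(f \<longlongrightarrow> f z) (at z)" for z
  proof (rule LIM_zero_cancel, rule Lim_null_comparison)
    show "\<forall>\<^sub>F w in at z. norm (f w - f z) \<le> b * pdist z w"
    proof (intro always_eventually allI)
      fix w show "norm (f w - f z) \<le> b * pdist z w"
        using assms[unfolded lip_half_one_def, rule_format, of z w] by (simp add: abs_minus_commute)
    qed
    have "((\<lambda>w. b * pdist z w) \<longlongrightarrow> b * pdist z z) (at z)"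
      using continuous_on_pdist[of z] by (intro tendsto_intros) (metis UNIV_I continuous_on_def)
    then show "((\<lambda>w. b * pdist z w) \<longlongrightarrow> 0) (at z)" by (simp add: pdist_def)
  qed
  then show ?thesis by (simp add: continuous_on_def)
qed

text \<open>Scaling explains why the bound is free of m. The minimum changes branch at |u| = m^2: on
  each half-line the inner part u^(-1/2) / m and the outer part m u^(-3/2) contribute 2
  each.\<close>

lemma nn_integral_split_kernel:
  assumes "0 \<le> (m::real)"
  shows "(\<integral>\<^sup>+u. ennreal (min (\<bar>u\<bar> / m) m / \<bar>u\<bar> powr (3/2)) \<partial>lborel) \<le> 8"
\<comment> \<open>For m = 0 the integrand vanishes, since division by zero gives 0.\<close>
proof (cases "m = 0")
  case False
  with assms have m: "0 < m" by simp
  define k where "k v = ennreal (v powr (-1/2) / m) * indicator {0..m\<^sup>2} v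
      + ennreal (m * v powr (-3/2)) * indicator {m\<^sup>2..} v" for v :: real
  have [measurable]: "k \<in> borel_measurable borel"
    unfolding k_def by measurable
  have "((\<lambda>v. v powr (-1/2)) has_integral ((m\<^sup>2) powr (-1/2+1) / (-1/2+1))) {0..m\<^sup>2}"
    by (intro has_integral_powr_from_0) auto
  from has_integral_divide[OF this, of m]
  have 1: "((\<lambda>v. v powr (-1/2) / m) has_integral 2) {0..m\<^sup>2}"
    using m by (simp add: powr_half_sqrt)
  have "((\<lambda>v. v powr (-3/2)) has_integral (- ((m\<^sup>2) powr (-3/2+1)) / (-3/2+1))) {m\<^sup>2..}"
    using m by (intro has_integral_powr_to_inf) auto
  moreover have "m * (- ((m\<^sup>2) powr (-3/2+1)) / (-3/2+1)) = 2"
    using m powr_minus[of "m\<^sup>2" "1/2"] by (simp add: powr_half_sqrt)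
  ultimately have 2: "((\<lambda>v. m * v powr (-3/2)) has_integral 2) {m\<^sup>2..}"
    using has_integral_mult_right[of "\<lambda>v. v powr (-3/2)" _ "{m\<^sup>2..}" m] by metis
  have k4: "(\<integral>\<^sup>+v. k v \<partial>lborel) = 4"
  proof -
    have "(\<integral>\<^sup>+v. k v \<partial>lborel) = (\<integral>\<^sup>+v. ennreal (v powr (-1/2) / m) * indicator {0..m\<^sup>2} v \<partial>lborel)
        + (\<integral>\<^sup>+v. ennreal (m * v powr (-3/2)) * indicator {m\<^sup>2..} v \<partial>lborel)"
      unfolding k_def by (intro nn_integral_add) measurable
    also have "(\<integral>\<^sup>+v. ennreal (v powr (-1/2) / m) * indicator {0..m\<^sup>2} v \<partial>lborel) = ennreal 2"
      by (rule nn_integral_has_integral_lebesgue'[OF _ 1]) (use m in simp)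
    also have "(\<integral>\<^sup>+v. ennreal (m * v powr (-3/2)) * indicator {m\<^sup>2..} v \<partial>lborel) = ennreal 2"
      by (rule nn_integral_has_integral_lebesgue'[OF _ 2]) (use m in simp)
    finally show ?thesis by simp
  qed
  have k4': "(\<integral>\<^sup>+v. k (- v) \<partial>lborel) = 4"
    using nn_integral_real_affine[of k "-1" 0] k4 by simp
  have le: "ennreal (min (v / m) m / v powr (3/2)) \<le> k v" if "0 \<le> v" for v
  proof (cases "v \<le> m\<^sup>2")
    case True
    have "min (v / m) m / v powr (3/2) \<le> (v / m) / v powr (3/2)"
      using that by (intro divide_right_mono) auto
    also have "\<dots> = v powr (-1/2) / m"
    proof (cases "v = 0")
      case False
      then have "v / v powr (3/2) = v powr (1 - 3/2)"
        using that by (subst powr_diff) auto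
      moreover have "v / m / v powr (3/2) = v / v powr (3/2) / m"
        by (simp add: mult.commute)
      ultimately show ?thesis by simp
    qed auto
    finally show ?thesis
      using True that unfolding k_def by (auto intro!: add_increasing2 ennreal_leI)
  next
    case False
    have "min (v / m) m / v powr (3/2) \<le> m / v powr (3/2)"
      by (intro divide_right_mono) auto
    also have "\<dots> = m * v powr (-3/2)"
      using powr_minus[of v "3/2"] by (simp add: field_simps)
    finally show ?thesis
      using False that unfolding k_def by (auto intro!: ennreal_leI)
  qed
  have "(\<integral>\<^sup>+u. ennreal (min (\<bar>u\<bar> / m) m / \<bar>u\<bar> powr (3/2)) \<partial>lborel) \<le> (\<integral>\<^sup>+u. k u + k (- u) \<partial>lborel)"
  proof (rule nn_integral_mono)
    fix u :: real
    show "ennreal (min (\<bar>u\<bar> / m) m / \<bar>u\<bar> powr (3/2)) \<le> k u + k (- u)"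
      using le[of u] le[of "-u"] by (cases "u \<ge> 0") (auto intro: add_increasing2 add_increasing)
  qed
  also have "\<dots> = 4 + 4"
    by (subst nn_integral_add) (auto simp: k4 k4')
  finally show ?thesis by simp
qed auto

lemma has_bochner_integral_tail_kernel:
  assumes "0 < \<rho>"
  shows "has_bochner_integral lborel (\<lambda>u. indicator {u. \<rho> \<le> \<bar>u\<bar>} u / \<bar>u\<bar> powr (3/2)) (4 / sqrt \<rho>)"
proof -
  define k where "k v = ennreal (v powr (-3/2)) * indicator {\<rho>..} v" for v :: real
  have [measurable]: "k \<in> borel_measurable borel"
    unfolding k_def by measurable
  have "((\<lambda>v. v powr (-3/2)) has_integral (- (\<rho> powr (-3/2+1)) / (-3/2+1))) {\<rho>..}"
    using assms by (intro has_integral_powr_to_inf) auto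
  then have "((\<lambda>v. v powr (-3/2)) has_integral (2 / sqrt \<rho>)) {\<rho>..}"
    using assms powr_minus[of \<rho> "1/2"] by (simp add: powr_half_sqrt field_simps)
  then have k: "(\<integral>\<^sup>+v. k v \<partial>lborel) = ennreal (2 / sqrt \<rho>)"
    unfolding k_def by (intro nn_integral_has_integral_lebesgue') auto
  then have k': "(\<integral>\<^sup>+v. k (- v) \<partial>lborel) = ennreal (2 / sqrt \<rho>)"
    using nn_integral_real_affine[of k "-1" 0] by simp
  have "(\<integral>\<^sup>+u. ennreal (indicator {u. \<rho> \<le> \<bar>u\<bar>} u / \<bar>u\<bar> powr (3/2)) \<partial>lborel) =
      (\<integral>\<^sup>+u. k u + k (- u) \<partial>lborel)"
  proof (rule nn_integral_cong)
    fix u :: real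
    have "\<bar>u\<bar> powr (-3/2) = 1 / \<bar>u\<bar> powr (3/2)"
      using powr_minus[of "\<bar>u\<bar>" "3/2"] by (simp add: field_simps)
    then show "ennreal (indicator {u. \<rho> \<le> \<bar>u\<bar>} u / \<bar>u\<bar> powr (3/2)) = k u + k (- u)"
      using assms by (auto simp: k_def indicator_def abs_if split: if_splits)
  qed
  also have "\<dots> = ennreal (2 / sqrt \<rho>) + ennreal (2 / sqrt \<rho>)"
    by (subst nn_integral_add) (auto simp: k k')
  also have "\<dots> = ennreal (4 / sqrt \<rho>)"
    using assms by (simp flip: ennreal_plus)
  finally show ?thesis
    using assms by (intro has_bochner_integral_nn_integral) auto
qed

text \<open>Writing the annulus as a large interval minus a small one separates the cut-offs: each
  integral depends on one coordinate of the product filter, and dominated convergence applies to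
  each.\<close>

lemma half_trunc_tendsto_integral:
  assumes f: "continuous_on UNIV f" and int: "integrable lborel (half_kernel f z)"
  shows "(half_trunc f z \<longlongrightarrow> (\<integral>u. half_kernel f z u \<partial>lborel)) pv_filter"
proof -
  let ?F = "half_kernel f z"
  note [measurable] = borel_measurable_integrable[OF int]
  have a: "((\<lambda>R. \<integral>u. indicator {u. \<bar>u\<bar> < R} u * ?F u \<partial>lborel) \<longlongrightarrow> (\<integral>u. ?F u \<partial>lborel)) at_top"
  proof (rule integral_dominated_convergence_at_top[where w = "\<lambda>u. norm (?F u)"])
    show "AE u in lborel. ((\<lambda>R. indicator {u. \<bar>u\<bar> < R} u * ?F u) \<longlongrightarrow> ?F u) at_top"
    proof (rule AE_I2, rule tendsto_eventually)
      fix u :: real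
      show "\<forall>\<^sub>F R in at_top. indicator {u. \<bar>u\<bar> < R} u * ?F u = ?F u"
        using eventually_gt_at_top[of "\<bar>u\<bar>"] by eventually_elim auto
    qed
  qed (use int in \<open>auto simp: indicator_def intro!: always_eventually\<close>)
  have b: "((\<lambda>\<epsilon>. \<integral>u. indicator {u. \<bar>u\<bar> \<le> \<epsilon>} u * ?F u \<partial>lborel) \<longlongrightarrow> 0) (at_right 0)"
    unfolding filterlim_at_right_to_top
  proof -
    have "((\<lambda>R. \<integral>u. indicator {u. \<bar>u\<bar> \<le> inverse R} u * ?F u \<partial>lborel) \<longlongrightarrow> integral\<^sup>L lborel (\<lambda>u::real. 0::real)) at_top"
    proof (rule integral_dominated_convergence_at_top[where f = "\<lambda>_. 0" and w = "\<lambda>u. norm (?F u)"])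
      have "AE u in lborel. u \<noteq> (0::real)"
        using AE_lborel_singleton[of 0] by simp
      then show "AE u in lborel. ((\<lambda>R. indicator {u. \<bar>u\<bar> \<le> inverse R} u * ?F u) \<longlongrightarrow> 0) at_top"
      proof eventually_elim
        case (elim u)
        have "\<forall>\<^sub>F R in at_top. inverse R < \<bar>u\<bar>"
          using elim tendsto_inverse_0_at_top[OF filterlim_ident]
          by (intro order_tendstoD(2)[where y = 0]) auto
        then show ?case
          by (intro tendsto_eventually) (elim eventually_mono, auto simp: indicator_def)
      qed
    qed (use int in \<open>auto simp: indicator_def intro!: always_eventually\<close>)
    then show "((\<lambda>R. \<integral>u. indicator {u. \<bar>u\<bar> \<le> inverse R} u * ?F u \<partial>lborel) \<longlongrightarrow> 0) at_top"
      by simp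
  qed
  have "((\<lambda>x. (\<integral>u. indicator {u. \<bar>u\<bar> < snd x} u * ?F u \<partial>lborel) - (\<integral>u. indicator {u. \<bar>u\<bar> \<le> fst x} u * ?F u \<partial>lborel))
     \<longlongrightarrow> (\<integral>u. ?F u \<partial>lborel) - 0) pv_filter"
    unfolding pv_filter_def
    by (intro tendsto_diff filterlim_compose[OF a filterlim_snd] filterlim_compose[OF b filterlim_fst])
  moreover have "\<forall>\<^sub>F x in pv_filter. (\<integral>u. indicator {u. \<bar>u\<bar> < snd x} u * ?F u \<partial>lborel) -
      (\<integral>u. indicator {u. \<bar>u\<bar> \<le> fst x} u * ?F u \<partial>lborel) = half_trunc f z x"
    unfolding eventually_pv_filter
  proof (intro exI[of _ 0] allI impI)
    fix \<epsilon> R :: real assume "0 < \<epsilon> \<and> \<epsilon> < 1 / real (Suc 0) \<and> real (Suc 0) < R"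
    then have eR: "\<epsilon> < R" by simp
    have i: "integrable lborel (\<lambda>u. indicator {u. \<bar>u\<bar> < R} u * ?F u)"
      "integrable lborel (\<lambda>u. indicator {u. \<bar>u\<bar> \<le> \<epsilon>} u * ?F u)"
      by (rule Bochner_Integration.integrable_bound[OF int]; auto simp: indicator_def)+
    show "(\<integral>u. indicator {u. \<bar>u\<bar> < snd (\<epsilon>, R)} u * ?F u \<partial>lborel) -
      (\<integral>u. indicator {u. \<bar>u\<bar> \<le> fst (\<epsilon>, R)} u * ?F u \<partial>lborel) = half_trunc f z (\<epsilon>, R)"
      unfolding half_trunc_eq fst_conv snd_conv
      by (subst Bochner_Integration.integral_diff[OF i, symmetric], rule Bochner_Integration.integral_cong)
         (use eR in \<open>auto simp: indicator_def\<close>)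
  qed
  ultimately show ?thesis
    by (subst (asm) filterlim_cong[OF refl refl]) auto
qed

lemma half_trunc_add_scaled:
  assumes "continuous_on UNIV f" "continuous_on UNIV g" "0 < \<epsilon>"
  shows "half_trunc (\<lambda>z. f z + c * g z) z (\<epsilon>, R) = half_trunc f z (\<epsilon>, R) + c * half_trunc g z (\<epsilon>, R)"
proof -
  have "(\<lambda>u. indicator {u. \<epsilon> < \<bar>u\<bar> \<and> \<bar>u\<bar> < R} u * half_kernel (\<lambda>z. f z + c * g z) z u) =
     (\<lambda>u. indicator {u. \<epsilon> < \<bar>u\<bar> \<and> \<bar>u\<bar> < R} u * half_kernel f z u +
        c * (indicator {u. \<epsilon> < \<bar>u\<bar> \<and> \<bar>u\<bar> < R} u * half_kernel g z u))"
    by (auto simp: half_kernel_def indicator_def add_divide_distrib diff_divide_distrib algebra_simps)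
  then show ?thesis
    using integrable_half_kernel_annulus[OF assms(1,3), of R z] integrable_half_kernel_annulus[OF assms(2,3), of R z]
    unfolding half_trunc_eq by simp
qed

lemma half_deriv_add_scaled:
  assumes c: "continuous_on UNIV f" "continuous_on UNIV g" and "half_deriv_exists f z" "half_deriv_exists g z"
  shows "half_deriv_exists (\<lambda>z. f z + c * g z) z"
    and "half_deriv (\<lambda>z. f z + c * g z) z = half_deriv f z + c * half_deriv g z"
proof -
  obtain l m where l: "(half_trunc f z \<longlongrightarrow> l) pv_filter" and m: "(half_trunc g z \<longlongrightarrow> m) pv_filter"
    using assms by (auto simp: half_deriv_exists_def)
  have "((\<lambda>x. half_trunc f z x + c * half_trunc g z x) \<longlongrightarrow> l + c * m) pv_filter"
    by (intro tendsto_intros l m)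
  moreover have "\<forall>\<^sub>F x in pv_filter. half_trunc f z x + c * half_trunc g z x = half_trunc (\<lambda>z. f z + c * g z) z x"
    unfolding eventually_pv_filter by (auto simp: half_trunc_add_scaled[OF c])
  ultimately have *: "(half_trunc (\<lambda>z. f z + c * g z) z \<longlongrightarrow> l + c * m) pv_filter"
    by (subst (asm) filterlim_cong[OF refl refl]) auto
  then show "half_deriv_exists (\<lambda>z. f z + c * g z) z"
    by (auto simp: half_deriv_exists_def)
  show "half_deriv (\<lambda>z. f z + c * g z) z = half_deriv f z + c * half_deriv g z"
    unfolding half_deriv_eqI[OF *] half_deriv_eqI[OF l] half_deriv_eqI[OF m]
    by (simp add: algebra_simps add_divide_distrib)
qed

section \<open>Functions whose square is Lipschitz in time\<close>

text \<open>The conditions serve different ranges of time increments: \<open>g_sq\<close> controls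
  those inside a ball, \<open>g_lip\<close> the change of the long ones from point to point, and the
  bound \<open>B\<close> makes the integral over long increments converge.\<close>

locale time_regular =
  fixes g :: "real \<times> 'a::euclidean_space \<Rightarrow> real" and B :: real
  assumes g_nonneg: "0 \<le> g z" and g_le: "g z \<le> B"
    and g_lip: "lip_half_one 1 g"
    and g_sq: "\<bar>(g (s, x))\<^sup>2 - (g (t, x))\<^sup>2\<bar> \<le> \<bar>s - t\<bar>"
begin

lemma g_continuous: "continuous_on UNIV g"
  by (rule lip_half_one_continuous[OF g_lip])

lemma g_borel [measurable]: "g \<in> borel_measurable borel"
  by (rule borel_measurable_continuous_onI[OF g_continuous])

lemma g_slice_borel [measurable]: "(\<lambda>t. g (t, x)) \<in> borel_measurable borel"
  by (intro borel_measurable_continuous_onI continuous_on_compose2[OF g_continuous] continuous_intros) auto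

text \<open>If M is the larger and m the smaller value, then (M - m) M \<le> M^2 - m^2 \<le> |u|,
  and also M - m \<le> M. The sum over both endpoints is used because either may carry the larger
  value, and because each summand involves g at one point only, so that each can be integrated in
  its own variables.\<close>

lemma increment_le:
  "\<bar>g (t + u, x) - g (t, x)\<bar> \<le> min (\<bar>u\<bar> / g (t, x)) (g (t, x)) + min (\<bar>u\<bar> / g (t + u, x)) (g (t + u, x))"
proof -
  have main: "M - m \<le> min (\<bar>u\<bar> / M) M" if "0 \<le> m" "m \<le> M" "M\<^sup>2 - m\<^sup>2 \<le> \<bar>u\<bar>" for m M :: real
  proof (cases "M = 0")
    case False
    have "(M - m) * M \<le> (M - m) * (M + m)" using that by (intro mult_left_mono) auto
    also have "\<dots> \<le> \<bar>u\<bar>" using that by (simp add: power2_eq_square algebra_simps)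
    finally show ?thesis using False that by (simp add: field_simps)
  qed (use that in auto)
  have nn: "0 \<le> min (\<bar>u\<bar> / m) m" if "0 \<le> m" for m :: real using that by simp
  have sq: "\<bar>(g (t + u, x))\<^sup>2 - (g (t, x))\<^sup>2\<bar> \<le> \<bar>u\<bar>"
    using g_sq[of "t + u" x t] by simp
  show ?thesis
  proof (cases "g (t, x) \<le> g (t + u, x)")
    case True
    then show ?thesis
      using main[of "g (t, x)" "g (t + u, x)"] sq nn[of "g (t, x)"] g_nonneg[of "(t, x)"] by linarith
  next
    case False
    then show ?thesis
      using main[of "g (t + u, x)" "g (t, x)"] sq nn[of "g (t + u, x)"] g_nonneg[of "(t + u, x)"] by linarith
  qed
qed

lemma abs_half_kernel_le:
  "ennreal \<bar>half_kernel g (t, x) u\<bar> \<le>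
     ennreal (min (\<bar>u\<bar> / g (t, x)) (g (t, x)) / \<bar>u\<bar> powr (3/2)) +
     ennreal (min (\<bar>u\<bar> / g (t + u, x)) (g (t + u, x)) / \<bar>u\<bar> powr (3/2))"
proof -
  have "\<bar>half_kernel g (t, x) u\<bar> = \<bar>g (t + u, x) - g (t, x)\<bar> / \<bar>u\<bar> powr (3/2)"
    by (simp add: half_kernel_def)
  also have "\<dots> \<le> (min (\<bar>u\<bar> / g (t, x)) (g (t, x)) + min (\<bar>u\<bar> / g (t + u, x)) (g (t + u, x))) / \<bar>u\<bar> powr (3/2)"
    by (intro divide_right_mono increment_le) auto
  finally show ?thesis
    using g_nonneg[of "(t, x)"] g_nonneg[of "(t + u, x)"]
    by (simp add: ennreal_leI add_divide_distrib flip: ennreal_plus)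
qed

lemma half_kernel_pair_borel [measurable]:
  "(\<lambda>p. half_kernel g (fst p) (snd p)) \<in> borel_measurable (lborel \<Otimes>\<^sub>M lborel)"
proof -
  have "(\<lambda>p::(real \<times> 'a) \<times> real. g (fst (fst p) + snd p, snd (fst p))) \<in> borel_measurable borel"
    by (intro borel_measurable_continuous_onI continuous_on_compose2[OF g_continuous] continuous_intros) auto
  then have [measurable]: "(\<lambda>p::(real \<times> 'a) \<times> real. g (fst (fst p) + snd p, snd (fst p)))
      \<in> borel_measurable (lborel \<Otimes>\<^sub>M lborel)"
    by (simp add: lborel_prod)
  show ?thesis unfolding half_kernel_def by measurable
qed

text \<open>Extended-valued, because absolute convergence may fail at individual points; finiteness
  almost everywhere is a consequence of the integral bound over balls.\<close>

definition near :: "real \<Rightarrow> real \<times> 'a \<Rightarrow> ennreal" where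
  "near \<rho> z = (\<integral>\<^sup>+u. ennreal \<bar>half_kernel g z u\<bar> * indicator {u. \<bar>u\<bar> < \<rho>} u \<partial>lborel)"

lemma near_borel [measurable]: "near \<rho> \<in> borel_measurable borel"
proof -
  have "(\<lambda>z. \<integral>\<^sup>+u. ennreal \<bar>half_kernel g z u\<bar> * indicator {u. \<bar>u\<bar> < \<rho>} u \<partial>lborel) \<in> borel_measurable lborel"
    by (rule lborel.borel_measurable_nn_integral) (simp add: case_prod_beta')
  then show ?thesis by (simp add: near_def[abs_def])
qed

lemma half_kernel_borel [measurable]: "half_kernel g z \<in> borel_measurable borel"
proof -
  have "(\<lambda>u. g (fst z + u, snd z)) \<in> borel_measurable borel"
    by (intro borel_measurable_continuous_onI continuous_on_compose2[OF g_continuous] continuous_intros) auto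
  then show ?thesis unfolding half_kernel_def by measurable
qed

text \<open>Integrating in u first costs 8 per unit of time. The summand at t costs 8 * 2 \<rho>;
  the summand at t + u is translated, which for |u| < \<rho> enlarges the time interval to length 4
  \<rho> and costs 8 * 4 \<rho>.\<close>

lemma nn_integral_near_slice:
  assumes "0 < \<rho>"
  shows "(\<integral>\<^sup>+t. near \<rho> (t, x) * indicator {a - \<rho>..a + \<rho>} t \<partial>lborel) \<le> ennreal (48 * \<rho>)"
proof -
  define \<phi> where "\<phi> t u = ennreal (min (\<bar>u\<bar> / g (t, x)) (g (t, x)) / \<bar>u\<bar> powr (3/2))" for t u
  have [measurable]: "case_prod \<phi> \<in> borel_measurable (lborel \<Otimes>\<^sub>M lborel)"
    unfolding \<phi>_def case_prod_beta' by measurable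
  have \<phi>t [measurable]: "(\<lambda>t. \<phi> t u) \<in> borel_measurable borel" for u
    unfolding \<phi>_def by measurable
  have \<phi>u [measurable]: "\<phi> t \<in> borel_measurable borel" for t
    unfolding \<phi>_def by measurable
  have \<phi>8: "(\<integral>\<^sup>+u. \<phi> t u \<partial>lborel) \<le> 8" for t
    unfolding \<phi>_def by (rule nn_integral_split_kernel[OF g_nonneg])
  have meas2: "(\<lambda>(t, u). \<phi> (t + u) u * indicator {u. \<bar>u\<bar> < \<rho>} u * indicator {a - \<rho>..a + \<rho>} t) \<in> borel_measurable (lborel \<Otimes>\<^sub>M lborel)"
  proof -
    have "(\<lambda>p::real \<times> real. g (fst p + snd p, x)) \<in> borel_measurable borel"
      by (intro borel_measurable_continuous_onI continuous_on_compose2[OF g_continuous] continuous_intros) auto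
    then have [measurable]: "(\<lambda>p::real \<times> real. g (fst p + snd p, x)) \<in> borel_measurable (lborel \<Otimes>\<^sub>M lborel)"
      by (simp add: lborel_prod)
    show ?thesis unfolding \<phi>_def case_prod_beta' by measurable
  qed
  have "(\<integral>\<^sup>+t. near \<rho> (t, x) * indicator {a - \<rho>..a + \<rho>} t \<partial>lborel)
     \<le> (\<integral>\<^sup>+t. (\<integral>\<^sup>+u. \<phi> t u \<partial>lborel) * indicator {a - \<rho>..a + \<rho>} t
           + (\<integral>\<^sup>+u. \<phi> (t + u) u * indicator {u. \<bar>u\<bar> < \<rho>} u * indicator {a - \<rho>..a + \<rho>} t \<partial>lborel) \<partial>lborel)"
  proof (rule nn_integral_mono)
    fix t
    have [measurable]: "(\<lambda>u. \<phi> (t + u) u) \<in> borel_measurable borel"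
    proof -
      have [measurable]: "(\<lambda>u. g (t + u, x)) \<in> borel_measurable borel"
        by (intro borel_measurable_continuous_onI continuous_on_compose2[OF g_continuous] continuous_intros) auto
      show ?thesis unfolding \<phi>_def by measurable
    qed
    have "near \<rho> (t, x) \<le> (\<integral>\<^sup>+u. \<phi> t u + \<phi> (t + u) u * indicator {u. \<bar>u\<bar> < \<rho>} u \<partial>lborel)"
      unfolding near_def
    proof (rule nn_integral_mono)
      fix u show "ennreal \<bar>half_kernel g (t, x) u\<bar> * indicator {u. \<bar>u\<bar> < \<rho>} u
          \<le> \<phi> t u + \<phi> (t + u) u * indicator {u. \<bar>u\<bar> < \<rho>} u"
        using abs_half_kernel_le[of t x u] by (auto simp: \<phi>_def indicator_def)
    qed
    also have "\<dots> = (\<integral>\<^sup>+u. \<phi> t u \<partial>lborel) + (\<integral>\<^sup>+u. \<phi> (t + u) u * indicator {u. \<bar>u\<bar> < \<rho>} u \<partial>lborel)"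
      by (intro nn_integral_add) measurable
    finally show "near \<rho> (t, x) * indicator {a - \<rho>..a + \<rho>} t
       \<le> (\<integral>\<^sup>+u. \<phi> t u \<partial>lborel) * indicator {a - \<rho>..a + \<rho>} t
           + (\<integral>\<^sup>+u. \<phi> (t + u) u * indicator {u. \<bar>u\<bar> < \<rho>} u * indicator {a - \<rho>..a + \<rho>} t \<partial>lborel)"
      by (auto simp: indicator_def split: if_splits)
  qed
  also have "\<dots> = (\<integral>\<^sup>+t. (\<integral>\<^sup>+u. \<phi> t u \<partial>lborel) * indicator {a - \<rho>..a + \<rho>} t \<partial>lborel)
     + (\<integral>\<^sup>+t. \<integral>\<^sup>+u. \<phi> (t + u) u * indicator {u. \<bar>u\<bar> < \<rho>} u * indicator {a - \<rho>..a + \<rho>} t \<partial>lborel \<partial>lborel)"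
    by (intro nn_integral_add lborel.borel_measurable_nn_integral meas2) measurable
  also have "(\<integral>\<^sup>+t. (\<integral>\<^sup>+u. \<phi> t u \<partial>lborel) * indicator {a - \<rho>..a + \<rho>} t \<partial>lborel)
      \<le> (\<integral>\<^sup>+t. 8 * indicator {a - \<rho>..a + \<rho>} t \<partial>lborel)"
    by (intro nn_integral_mono mult_right_mono \<phi>8) auto
  also have "(\<integral>\<^sup>+t. 8 * indicator {a - \<rho>..a + \<rho>} t \<partial>lborel) = 8 * ennreal (2 * \<rho>)"
    using assms by (subst nn_integral_cmult_indicator) auto
  also have "(\<integral>\<^sup>+t. \<integral>\<^sup>+u. \<phi> (t + u) u * indicator {u. \<bar>u\<bar> < \<rho>} u * indicator {a - \<rho>..a + \<rho>} t \<partial>lborel \<partial>lborel)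
     = (\<integral>\<^sup>+u. \<integral>\<^sup>+t. \<phi> (t + u) u * indicator {u. \<bar>u\<bar> < \<rho>} u * indicator {a - \<rho>..a + \<rho>} t \<partial>lborel \<partial>lborel)"
    using lborel_pair.Fubini'[OF meas2] by simp
  also have "\<dots> \<le> (\<integral>\<^sup>+u. \<integral>\<^sup>+t. \<phi> t u * indicator {a - 2 * \<rho>..a + 2 * \<rho>} t \<partial>lborel \<partial>lborel)"
  proof (rule nn_integral_mono)
    fix u
    have "(\<integral>\<^sup>+t. \<phi> (t + u) u * indicator {u. \<bar>u\<bar> < \<rho>} u * indicator {a - \<rho>..a + \<rho>} t \<partial>lborel)
       \<le> (\<integral>\<^sup>+t. \<phi> (u + 1 * t) u * indicator {a - 2 * \<rho>..a + 2 * \<rho>} (u + 1 * t) \<partial>lborel)"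
      by (intro nn_integral_mono) (auto simp: indicator_def add.commute)
    also have "\<dots> = (\<integral>\<^sup>+t. \<phi> t u * indicator {a - 2 * \<rho>..a + 2 * \<rho>} t \<partial>lborel)"
      using nn_integral_real_affine[of "\<lambda>t. \<phi> t u * indicator {a - 2 * \<rho>..a + 2 * \<rho>} t" 1 u] by simp
    finally show "(\<integral>\<^sup>+t. \<phi> (t + u) u * indicator {u. \<bar>u\<bar> < \<rho>} u * indicator {a - \<rho>..a + \<rho>} t \<partial>lborel)
       \<le> (\<integral>\<^sup>+t. \<phi> t u * indicator {a - 2 * \<rho>..a + 2 * \<rho>} t \<partial>lborel)" .
  qed
  also have "\<dots> = (\<integral>\<^sup>+t. \<integral>\<^sup>+u. \<phi> t u * indicator {a - 2 * \<rho>..a + 2 * \<rho>} t \<partial>lborel \<partial>lborel)"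
    by (rule lborel_pair.Fubini') measurable
  also have "\<dots> = (\<integral>\<^sup>+t. (\<integral>\<^sup>+u. \<phi> t u \<partial>lborel) * indicator {a - 2 * \<rho>..a + 2 * \<rho>} t \<partial>lborel)"
    by (intro nn_integral_cong nn_integral_multc) measurable
  also have "\<dots> \<le> (\<integral>\<^sup>+t. 8 * indicator {a - 2 * \<rho>..a + 2 * \<rho>} t \<partial>lborel)"
    by (intro nn_integral_mono mult_right_mono \<phi>8) auto
  also have "\<dots> = 8 * ennreal (4 * \<rho>)"
    using assms by (subst nn_integral_cmult_indicator) auto
  also have "8 * ennreal (2 * \<rho>) + 8 * ennreal (4 * \<rho>) = ennreal (48 * \<rho>)"
    using assms by (simp flip: ennreal_numeral ennreal_mult ennreal_plus)
  finally show ?thesis by (simp add: add_mono)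
qed

lemma nn_integral_near_pball:
  assumes "0 < r"
  shows "(\<integral>\<^sup>+z. near (r\<^sup>2) z * indicator (pball z0 r) z \<partial>lborel)
     \<le> ennreal (48 * r\<^sup>2 * measure lborel (ball (snd z0) r))"
proof -
  have "(\<integral>\<^sup>+z. near (r\<^sup>2) z * indicator (pball z0 r) z \<partial>lborel)
     \<le> (\<integral>\<^sup>+z. near (r\<^sup>2) z * indicator ({fst z0 - r\<^sup>2..fst z0 + r\<^sup>2} \<times> ball (snd z0) r) z \<partial>lborel)"
    using pball_subset_box[of z0 r] by (intro nn_integral_mono) (auto simp: indicator_def)
  also have "\<dots> = (\<integral>\<^sup>+z. near (r\<^sup>2) z * indicator ({fst z0 - r\<^sup>2..fst z0 + r\<^sup>2} \<times> ball (snd z0) r) z \<partial>(lborel \<Otimes>\<^sub>M lborel))"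
    by (simp add: lborel_prod)
  also have "\<dots> = (\<integral>\<^sup>+x. \<integral>\<^sup>+t. near (r\<^sup>2) (t, x) * indicator ({fst z0 - r\<^sup>2..fst z0 + r\<^sup>2} \<times> ball (snd z0) r) (t, x) \<partial>lborel \<partial>lborel)"
  proof (rule lborel_pair.nn_integral_snd[symmetric])
    have "{fst z0 - r\<^sup>2..fst z0 + r\<^sup>2} \<times> ball (snd z0) r \<in> sets (borel :: (real \<times> 'a) measure)"
      by (intro borel_Times) auto
    then show "(\<lambda>z. near (r\<^sup>2) z * indicator ({fst z0 - r\<^sup>2..fst z0 + r\<^sup>2} \<times> ball (snd z0) r) z)
       \<in> borel_measurable (lborel \<Otimes>\<^sub>M lborel)"
      by (simp add: lborel_prod)
  qed
  also have "\<dots> = (\<integral>\<^sup>+x. (\<integral>\<^sup>+t. near (r\<^sup>2) (t, x) * indicator {fst z0 - r\<^sup>2..fst z0 + r\<^sup>2} t \<partial>lborel) * indicator (ball (snd z0) r) x \<partial>lborel)"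
    by (intro nn_integral_cong) (auto simp: indicator_def intro!: nn_integral_cong)
  also have "\<dots> \<le> (\<integral>\<^sup>+x. ennreal (48 * r\<^sup>2) * indicator (ball (snd z0) r) x \<partial>lborel)"
    using assms by (intro nn_integral_mono mult_right_mono nn_integral_near_slice) auto
  also have "\<dots> = ennreal (48 * r\<^sup>2) * emeasure lborel (ball (snd z0) r)"
    by (rule nn_integral_cmult_indicator) auto
  also have "\<dots> = ennreal (48 * r\<^sup>2 * measure lborel (ball (snd z0) r))"
    using emeasure_bounded_finite[OF bounded_ball, of "snd z0" r]
    by (simp add: emeasure_eq_ennreal_measure ennreal_mult)
  finally show ?thesis .
qed

lemma far_integrable:
  assumes "0 < \<rho>"
  shows "integrable lborel (\<lambda>u. half_kernel g z u * indicator {u. \<rho> \<le> \<bar>u\<bar>} u)"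
proof -
  have "integrable lborel (\<lambda>u. B * (indicator {u. \<rho> \<le> \<bar>u\<bar>} u / \<bar>u\<bar> powr (3/2)))"
    using has_bochner_integral_tail_kernel[OF assms]
    by (intro integrable_mult_right) (simp add: has_bochner_integral_iff)
  then show ?thesis
  proof (rule Bochner_Integration.integrable_bound)
    show "AE u in lborel. norm (half_kernel g z u * indicator {u. \<rho> \<le> \<bar>u\<bar>} u)
        \<le> norm (B * (indicator {u. \<rho> \<le> \<bar>u\<bar>} u / \<bar>u\<bar> powr (3/2)))"
    proof (rule AE_I2)
      fix u
      have "\<bar>g (fst z + u, snd z) - g z\<bar> \<le> \<bar>B\<bar>"
        using g_nonneg[of z] g_nonneg[of "(fst z + u, snd z)"] g_le[of z] g_le[of "(fst z + u, snd z)"]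
        by linarith
      then show "norm (half_kernel g z u * indicator {u. \<rho> \<le> \<bar>u\<bar>} u)
        \<le> norm (B * (indicator {u. \<rho> \<le> \<bar>u\<bar>} u / \<bar>u\<bar> powr (3/2)))"
        by (auto simp: half_kernel_def indicator_def abs_mult intro!: divide_right_mono)
    qed
  qed measurable
qed

text \<open>Long increments are always integrable, so a finite near part at one radius already makes
  the principal value absolutely convergent; the near part then bounds the error of dropping the
  short increments.\<close>

lemma integrable_half_kernelI:
  assumes "near \<rho> z < \<infinity>" "0 < \<rho>"
  shows "integrable lborel (half_kernel g z)"
    and "\<bar>(\<integral>u. half_kernel g z u \<partial>lborel) - (\<integral>u. half_kernel g z u * indicator {u. \<rho> \<le> \<bar>u\<bar>} u \<partial>lborel)\<bar>
      \<le> enn2real (near \<rho> z)"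
proof -
  have n: "near \<rho> z = (\<integral>\<^sup>+u. ennreal (norm (half_kernel g z u * indicator {u. \<bar>u\<bar> < \<rho>} u)) \<partial>lborel)"
    unfolding near_def by (intro nn_integral_cong) (auto simp: indicator_def)
  have 1: "integrable lborel (\<lambda>u. half_kernel g z u * indicator {u. \<bar>u\<bar> < \<rho>} u)"
    using assms(1) unfolding n by (intro integrableI_bounded) auto
  have eq: "half_kernel g z = (\<lambda>u. half_kernel g z u * indicator {u. \<bar>u\<bar> < \<rho>} u + half_kernel g z u * indicator {u. \<rho> \<le> \<bar>u\<bar>} u)"
    by (auto simp: indicator_def)
  show "integrable lborel (half_kernel g z)"
    by (subst eq) (intro Bochner_Integration.integrable_add 1 far_integrable assms)
  have "(\<integral>u. half_kernel g z u \<partial>lborel) = (\<integral>u. half_kernel g z u * indicator {u. \<bar>u\<bar> < \<rho>} u \<partial>lborel)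
      + (\<integral>u. half_kernel g z u * indicator {u. \<rho> \<le> \<bar>u\<bar>} u \<partial>lborel)"
    by (subst eq) (intro Bochner_Integration.integral_add 1 far_integrable assms)
  moreover have "\<bar>\<integral>u. half_kernel g z u * indicator {u. \<bar>u\<bar> < \<rho>} u \<partial>lborel\<bar> \<le> enn2real (near \<rho> z)"
    unfolding n using integral_norm_bound[of lborel "\<lambda>u. half_kernel g z u * indicator {u. \<bar>u\<bar> < \<rho>} u"]
    by (subst integral_eq_nn_integral[symmetric]) auto
  ultimately show "\<bar>(\<integral>u. half_kernel g z u \<partial>lborel) - (\<integral>u. half_kernel g z u * indicator {u. \<rho> \<le> \<bar>u\<bar>} u \<partial>lborel)\<bar>
      \<le> enn2real (near \<rho> z)" by simp
qed

lemma AE_near_finite: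
  assumes "0 < r"
  shows "AE z in lborel. z \<in> pball z0 r \<longrightarrow> near (r\<^sup>2) z < \<infinity>"
proof -
  have "AE z in lborel. near (r\<^sup>2) z * indicator (pball z0 r) z \<noteq> \<infinity>"
    using nn_integral_near_pball[OF assms, of z0]
    by (intro nn_integral_noteq_infinite) (auto simp: top_unique)
  then show ?thesis
    by eventually_elim (auto simp: indicator_def less_top)
qed

text \<open>Balls around the origin exhaust the space, and outside a countable union of null sets
  the kernel is absolutely integrable.\<close>

lemma AE_half_deriv_exists: "AE z in lborel. half_deriv_exists g z"
proof -
  have "AE z in lborel. \<forall>n::nat. z \<in> pball 0 (real (Suc n)) \<longrightarrow> near ((real (Suc n))\<^sup>2) z < \<infinity>"
    by (subst AE_all_countable) (intro allI AE_near_finite, simp)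
  then show ?thesis
  proof eventually_elim
    case (elim z)
    obtain n :: nat where "pdist 0 z < real n" using reals_Archimedean2 by blast
    then have "z \<in> pball 0 (real (Suc n))" by (simp add: pball_def)
    with elim have "near ((real (Suc n))\<^sup>2) z < \<infinity>" by blast
    then have "integrable lborel (half_kernel g z)"
      by (rule integrable_half_kernelI) simp
    from half_trunc_tendsto_integral[OF g_continuous this] show ?case
      by (auto simp: half_deriv_exists_def)
  qed
qed

text \<open>Translating in time by \<open>u\<close> moves both endpoints of the increment, so far increments at
  two nearby points differ only by the parabolic distance of these points.\<close>

lemma far_oscillation:
  assumes "0 < r" "z \<in> pball z0 r"
  shows "\<bar>(\<integral>u. half_kernel g z u * indicator {u. r\<^sup>2 \<le> \<bar>u\<bar>} u \<partial>lborel)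
      - (\<integral>u. half_kernel g z0 u * indicator {u. r\<^sup>2 \<le> \<bar>u\<bar>} u \<partial>lborel)\<bar> \<le> 8"
proof -
  let ?I = "\<lambda>u. indicator {u. r\<^sup>2 \<le> \<bar>u\<bar>} u :: real"
  have r2: "0 < r\<^sup>2" using assms by simp
  have tail: "has_bochner_integral lborel (\<lambda>u. ?I u / \<bar>u\<bar> powr (3/2)) (4 / r)"
    using has_bochner_integral_tail_kernel[OF r2] assms by simp
  have "\<bar>half_kernel g z u * ?I u - half_kernel g z0 u * ?I u\<bar> \<le> 2 * r * (?I u / \<bar>u\<bar> powr (3/2))" for u
  proof -
    have p: "pdist z0 z < r" using assms by (simp add: pball_def)
    have "\<bar>g z0 - g z\<bar> \<le> pdist z0 z"
      using g_lip unfolding lip_half_one_def by (metis mult_1)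
    moreover have "\<bar>g (fst z0 + u, snd z0) - g (fst z + u, snd z)\<bar> \<le> pdist (fst z0 + u, snd z0) (fst z + u, snd z)"
      using g_lip unfolding lip_half_one_def by (metis mult_1)
    moreover have "pdist (fst z0 + u, snd z0) (fst z + u, snd z) = pdist z0 z"
      by (simp add: pdist_def)
    ultimately have "\<bar>(g (fst z + u, snd z) - g z) - (g (fst z0 + u, snd z0) - g z0)\<bar> \<le> 2 * r"
      using p by linarith
    then have "\<bar>(g (fst z + u, snd z) - g z) - (g (fst z0 + u, snd z0) - g z0)\<bar> / \<bar>u\<bar> powr (3/2) \<le> 2 * r / \<bar>u\<bar> powr (3/2)"
      by (intro divide_right_mono) auto
    then show ?thesis
      by (auto simp: half_kernel_def indicator_def diff_divide_distrib[symmetric])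
  qed
  then have "\<bar>\<integral>u. half_kernel g z u * ?I u - half_kernel g z0 u * ?I u \<partial>lborel\<bar>
      \<le> (\<integral>u. 2 * r * (?I u / \<bar>u\<bar> powr (3/2)) \<partial>lborel)"
    using tail far_integrable[OF r2]
    by (intro integral_abs_bound_integral Bochner_Integration.integrable_diff integrable_mult_right)
       (simp_all only: has_bochner_integral_iff)
  \<comment> \<open>The factor 2 r comes from one Lipschitz bound at each endpoint; the kernel
    beyond r^2 has mass 4 / r, so the product does not depend on the radius.\<close>
  also have "\<dots> = 2 * r * (4 / r)"
    using tail by (simp only: has_bochner_integral_iff integral_mult_right_zero)
  also have "\<dots> = 8" using assms by simp
  finally show ?thesis
    using far_integrable[OF r2] by simp
qed

end

section \<open>Mean oscillation on sets of finite measure\<close>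

lemma mean_oscillation_le:
  fixes f :: "real \<times> 'a::euclidean_space \<Rightarrow> real"
  assumes [measurable]: "A \<in> sets borel" "f \<in> borel_measurable borel"
    and A: "0 < measure lborel A" "emeasure lborel A < \<infinity>"
    and C: "0 \<le> C" "(\<integral>\<^sup>+w. ennreal \<bar>f w - c\<bar> * indicator A w \<partial>lborel) \<le> ennreal (C * measure lborel A)"
  shows "set_integrable lborel A f" and "pavg A (\<lambda>w. \<bar>f w - pavg A f\<bar>) \<le> 2 * C"
proof -
  let ?m = "measure lborel A"
  have norm: "(\<integral>\<^sup>+w. ennreal (norm (indicator A w *\<^sub>R (f w - c))) \<partial>lborel) = (\<integral>\<^sup>+w. ennreal \<bar>f w - c\<bar> * indicator A w \<partial>lborel)"
    by (intro nn_integral_cong) (auto simp: indicator_def)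
  have h: "set_integrable lborel A (\<lambda>w. f w - c)"
    unfolding set_integrable_def
    by (rule integrableI_bounded) (use C(2) in \<open>simp_all only: norm, auto intro: le_less_trans\<close>)
  have const: "set_integrable lborel A (\<lambda>w. k)" for k :: real
    using A(2) by (simp add: set_integrable_def)
  have lconst: "(LINT w:A|lborel. k) = k * ?m" for k :: real
    by (simp add: set_lebesgue_integral_def)
  from set_integral_add(1)[OF h const[of c]] show f: "set_integrable lborel A f" by simp
  have int_f: "(LINT w:A|lborel. f w) = (LINT w:A|lborel. f w - c) + c * ?m"
    using set_integral_add(2)[OF h const[of c]] by (simp add: lconst)
  have abs_h: "set_integrable lborel A (\<lambda>w. \<bar>f w - c\<bar>)"
    using set_integrable_abs[OF h] .
  have "(LINT w:A|lborel. \<bar>f w - c\<bar>) = (\<integral>w. norm (indicator A w *\<^sub>R (f w - c)) \<partial>lborel)"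
    unfolding set_lebesgue_integral_def by (intro Bochner_Integration.integral_cong) (auto simp: indicator_def)
  also have "\<dots> = enn2real (\<integral>\<^sup>+w. ennreal (norm (indicator A w *\<^sub>R (f w - c))) \<partial>lborel)"
    by (rule integral_eq_nn_integral) auto
  also have "\<dots> \<le> C * ?m"
    unfolding norm using C by (intro enn2real_leI) auto
  finally have L1: "(LINT w:A|lborel. \<bar>f w - c\<bar>) \<le> C * ?m" .
  have "\<bar>LINT w:A|lborel. f w - c\<bar> \<le> (LINT w:A|lborel. \<bar>f w - c\<bar>)"
    using set_integral_norm_bound[OF h] by simp
  then have abs_le: "\<bar>LINT w:A|lborel. f w - c\<bar> \<le> C * ?m" using L1 by simp
  have "pavg A f - c = (LINT w:A|lborel. f w - c) / ?m"
    unfolding pavg_def int_f using A by (simp add: field_simps)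
  \<comment> \<open>The average itself differs from c by at most C, so passing from an arbitrary
    centre c to the average doubles the constant.\<close>
  then have diff: "\<bar>c - pavg A f\<bar> \<le> C"
    using abs_le A by (subst abs_minus_commute) (simp add: pos_divide_le_eq)
  have "(LINT w:A|lborel. \<bar>f w - pavg A f\<bar>) \<le> (LINT w:A|lborel. \<bar>f w - c\<bar> + C)"
  proof (rule set_integral_mono)
    show "set_integrable lborel A (\<lambda>w. \<bar>f w - pavg A f\<bar>)"
      using set_integrable_abs[OF set_integral_diff(1)[OF f const]] .
    show "set_integrable lborel A (\<lambda>w. \<bar>f w - c\<bar> + C)"
      by (rule set_integral_add(1)[OF abs_h const])
    show "\<bar>f w - pavg A f\<bar> \<le> \<bar>f w - c\<bar> + C" for w using diff by linarith
  qed
  also have "\<dots> = (LINT w:A|lborel. \<bar>f w - c\<bar>) + C * ?m"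
    using set_integral_add(2)[OF abs_h const] by (simp add: lconst)
  finally have "(LINT w:A|lborel. \<bar>f w - pavg A f\<bar>) \<le> 2 * C * ?m" using L1 by simp
  then show "pavg A (\<lambda>w. \<bar>f w - pavg A f\<bar>) \<le> 2 * C"
    unfolding pavg_def[of A "\<lambda>w. \<bar>f w - pavg A f\<bar>"] using A by (simp add: field_simps)
qed

text \<open>The half-order derivative is known to be additive only where both principal values
  exist, so the sum formula is available almost everywhere; measurability of f is therefore a
  separate hypothesis.\<close>

lemma mean_oscillation_add:
  fixes f :: "real \<times> 'a::euclidean_space \<Rightarrow> real"
  assumes [measurable]: "A \<in> sets borel" "f \<in> borel_measurable borel"
    and A: "emeasure lborel A < \<infinity>"
    and u: "set_integrable lborel A u" and v: "set_integrable lborel A v"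
    and f: "AE w in lborel. f w = u w + c * v w"
  shows "set_integrable lborel A f"
    and "pavg A (\<lambda>w. \<bar>f w - pavg A f\<bar>) \<le> pavg A (\<lambda>w. \<bar>u w - pavg A u\<bar>) + \<bar>c\<bar> * pavg A (\<lambda>w. \<bar>v w - pavg A v\<bar>)"
proof -
  let ?m = "measure lborel A"
  have cv: "set_integrable lborel A (\<lambda>w. c * v w)"
    using v by simp
  have const: "set_integrable lborel A (\<lambda>w. k)" for k :: real
    using A by (simp add: set_integrable_def)
  have uv: "set_integrable lborel A (\<lambda>w. u w + c * v w)"
    by (rule set_integral_add(1)[OF u cv])
  have m [measurable]: "(\<lambda>w. indicator A w *\<^sub>R (u w + c * v w)) \<in> borel_measurable lborel"
    using uv unfolding set_integrable_def by (rule borel_measurable_integrable)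
  have m': "(\<lambda>w. indicator A w *\<^sub>R f w) \<in> borel_measurable lborel" by measurable
  have ae: "AE w in lborel. indicator A w *\<^sub>R f w = indicator A w *\<^sub>R (u w + c * v w)"
    using f by eventually_elim simp
  show fi: "set_integrable lborel A f"
    using uv unfolding set_integrable_def by (subst integrable_cong_AE[OF m' m ae])
  have "(LINT w:A|lborel. f w) = (LINT w:A|lborel. u w + c * v w)"
    unfolding set_lebesgue_integral_def by (rule integral_cong_AE[OF m' m ae])
  also have "\<dots> = (LINT w:A|lborel. u w) + c * (LINT w:A|lborel. v w)"
    using set_integral_add(2)[OF u cv] by simp
  finally have avg: "pavg A f = pavg A u + c * pavg A v"
    by (simp add: pavg_def add_divide_distrib)
  have au: "set_integrable lborel A (\<lambda>w. \<bar>u w - pavg A u\<bar>)"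
    by (rule set_integrable_abs[OF set_integral_diff(1)[OF u const]])
  have av: "set_integrable lborel A (\<lambda>w. \<bar>v w - pavg A v\<bar>)"
    by (rule set_integrable_abs[OF set_integral_diff(1)[OF v const]])
  then have cav: "set_integrable lborel A (\<lambda>w. \<bar>c\<bar> * \<bar>v w - pavg A v\<bar>)" by simp
  have af: "set_integrable lborel A (\<lambda>w. \<bar>f w - pavg A f\<bar>)"
    by (rule set_integrable_abs[OF set_integral_diff(1)[OF fi const]])
  have "(LINT w:A|lborel. \<bar>f w - pavg A f\<bar>) \<le> (LINT w:A|lborel. \<bar>u w - pavg A u\<bar> + \<bar>c\<bar> * \<bar>v w - pavg A v\<bar>)"
    unfolding set_lebesgue_integral_def
  proof (rule integral_mono_AE)
    show "integrable lborel (\<lambda>w. indicator A w *\<^sub>R \<bar>f w - pavg A f\<bar>)"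
      using af by (simp add: set_integrable_def)
    show "integrable lborel (\<lambda>w. indicator A w *\<^sub>R (\<bar>u w - pavg A u\<bar> + \<bar>c\<bar> * \<bar>v w - pavg A v\<bar>))"
      using set_integral_add(1)[OF au cav] by (simp add: set_integrable_def)
    show "AE w in lborel. indicator A w *\<^sub>R \<bar>f w - pavg A f\<bar>
        \<le> indicator A w *\<^sub>R (\<bar>u w - pavg A u\<bar> + \<bar>c\<bar> * \<bar>v w - pavg A v\<bar>)"
      using f
    proof eventually_elim
      case (elim w)
      have "f w - pavg A f = (u w - pavg A u) + c * (v w - pavg A v)"
        by (simp add: elim avg algebra_simps)
      then have "\<bar>f w - pavg A f\<bar> \<le> \<bar>u w - pavg A u\<bar> + \<bar>c\<bar> * \<bar>v w - pavg A v\<bar>"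
        by (metis abs_mult abs_triangle_ineq)
      then show ?case by (auto simp: indicator_def)
    qed
  qed
  also have "\<dots> = (LINT w:A|lborel. \<bar>u w - pavg A u\<bar>) + \<bar>c\<bar> * (LINT w:A|lborel. \<bar>v w - pavg A v\<bar>)"
    using set_integral_add(2)[OF au cav] by simp
  finally have "(LINT w:A|lborel. \<bar>f w - pavg A f\<bar>) / ?m
      \<le> ((LINT w:A|lborel. \<bar>u w - pavg A u\<bar>) + \<bar>c\<bar> * (LINT w:A|lborel. \<bar>v w - pavg A v\<bar>)) / ?m"
    by (intro divide_right_mono) auto
  then show "pavg A (\<lambda>w. \<bar>f w - pavg A f\<bar>) \<le> pavg A (\<lambda>w. \<bar>u w - pavg A u\<bar>) + \<bar>c\<bar> * pavg A (\<lambda>w. \<bar>v w - pavg A v\<bar>)"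
    unfolding pavg_def[of A "\<lambda>w. \<bar>f w - pavg A f\<bar>"] pavg_def[of A "\<lambda>w. \<bar>u w - pavg A u\<bar>"]
      pavg_def[of A "\<lambda>w. \<bar>v w - pavg A v\<bar>"]
    by (simp add: add_divide_distrib)
qed

section \<open>Volume of parabolic balls\<close>

lemma emeasure_pball_finite: "emeasure lborel (pball z r :: (real \<times> 'a::euclidean_space) set) < \<infinity>"
  by (intro emeasure_bounded_finite bounded_subset[OF _ pball_subset_box] bounded_Times) auto

text \<open>A cylinder of spatial radius r / 2 and time half-length r^2 / 4 fits inside the
  parabolic ball, because both summands of the metric are then below r / 2. Its volume is r^2 / 2
  times that of the half-sized ball, which gives the constant.\<close>

lemma measure_pball_ge:
  fixes z :: "real \<times> 'a::euclidean_space"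
  assumes "0 < r"
  shows "r\<^sup>2 * measure lborel (ball (snd z) r) \<le> 2 * 2 ^ DIM('a) * measure lborel (pball z r)"
proof -
  let ?I = "{fst z - r\<^sup>2 / 4<..<fst z + r\<^sup>2 / 4}"
  have "?I \<times> ball (snd z) (r / 2) \<subseteq> pball z r"
  proof safe
    fix t x assume t: "t \<in> ?I" and x: "x \<in> ball (snd z) (r / 2)"
    have "\<bar>fst z - t\<bar> < (r / 2)\<^sup>2" using t unfolding power_divide by (auto simp: abs_if)
    then have "sqrt \<bar>fst z - t\<bar> < sqrt ((r / 2)\<^sup>2)" by (rule real_sqrt_less_mono)
    then have "sqrt \<bar>fst z - t\<bar> < r / 2" using assms by simp
    then show "(t, x) \<in> pball z r" using x by (simp add: pball_def pdist_def dist_norm)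
  qed
  then have "measure lborel (?I \<times> ball (snd z) (r / 2)) \<le> measure lborel (pball z r)"
    using emeasure_pball_finite[of z r]
    by (intro measure_mono_fmeasurable) (auto simp: fmeasurable_def intro!: borel_Times)
  moreover have "measure lborel (?I \<times> ball (snd z) (r / 2)) = r\<^sup>2 / 2 * measure lborel (ball (snd z) (r / 2))"
  proof -
    have "emeasure lborel (?I \<times> ball (snd z) (r / 2)) = emeasure lborel ?I * emeasure lborel (ball (snd z) (r / 2))"
      by (subst lborel_prod[symmetric], rule lborel.emeasure_pair_measure_Times) auto
    then show ?thesis by (simp add: measure_def enn2real_mult)
  qed
  moreover have "measure lborel (ball (snd z) (r / 2)) = measure lborel (ball (snd z) r) / 2 ^ DIM('a)"
    using content_ball_conv_unit_ball[of r "snd z"] content_ball_conv_unit_ball[of "r / 2" "snd z"] assms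
    by (simp add: power_divide)
  ultimately have "r\<^sup>2 / 2 * (measure lborel (ball (snd z) r) / 2 ^ DIM('a)) \<le> measure lborel (pball z r)"
    by simp
  then show ?thesis by (simp add: field_simps)
qed

lemma measure_pball_pos:
  fixes z :: "real \<times> 'a::euclidean_space"
  assumes "0 < r"
  shows "0 < measure lborel (pball z r)"
proof -
  have "0 < r\<^sup>2 * measure lborel (ball (snd z) r)"
    using assms by (intro mult_pos_pos) auto
  also have "\<dots> \<le> 2 * 2 ^ DIM('a) * measure lborel (pball z r)"
    by (rule measure_pball_ge[OF assms])
  finally show ?thesis by (simp add: zero_less_mult_iff)
qed

section \<open>The BMO bound for the half-order derivative\<close>

context time_regular
begin

text \<open>The comparison constant is the normalised integral over long increments at the centre of
  the ball. Per unit volume short increments contribute at most 48 * 2 * 2 ^ DIM('a) and long ones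
  8; the leading 2 is the cost of replacing the constant by the average.\<close>

lemma half_deriv_mean_oscillation:
  assumes "0 < r"
  shows "set_integrable lborel (pball z0 r) (half_deriv g)"
    and "pavg (pball z0 r) (\<lambda>w. \<bar>half_deriv g w - pavg (pball z0 r) (half_deriv g)\<bar>) \<le> 2 * (96 * 2 ^ DIM('a) + 8)"
proof -
  let ?A = "pball z0 r" and ?k = "- 1 / (2 * sqrt (2 * pi))"
  let ?far = "\<lambda>z. \<integral>u. half_kernel g z u * indicator {u. r\<^sup>2 \<le> \<bar>u\<bar>} u \<partial>lborel"
  note [measurable] = borel_measurable_half_deriv[OF g_continuous]
  have "1 \<le> sqrt (2 * pi)" using pi_gt3 by simp
  then have "1 \<le> 2 * sqrt (2 * pi)" by linarith
  then have k: "\<bar>?k\<bar> \<le> 1" by simp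
  have tri: "\<bar>p - s\<bar> \<le> e + 8" if "\<bar>p - q\<bar> \<le> e" "\<bar>q - s\<bar> \<le> 8" for p q s e :: real
    using that by linarith
  have "AE z in lborel. ennreal \<bar>half_deriv g z - ?k * ?far z0\<bar> * indicator ?A z \<le> near (r\<^sup>2) z * indicator ?A z + 8 * indicator ?A z"
    using AE_near_finite[OF assms, of z0]
  proof eventually_elim
    case (elim z)
    show ?case
    proof (cases "z \<in> ?A")
      case True
      with elim have fin: "near (r\<^sup>2) z < \<infinity>" by blast
      have r2: "0 < r\<^sup>2" using assms by simp
      have "half_deriv g z = ?k * (\<integral>u. half_kernel g z u \<partial>lborel)"
        by (rule half_deriv_eqI[OF half_trunc_tendsto_integral[OF g_continuous integrable_half_kernelI(1)[OF fin r2]]])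
      then have "\<bar>half_deriv g z - ?k * ?far z0\<bar> = \<bar>?k\<bar> * \<bar>(\<integral>u. half_kernel g z u \<partial>lborel) - ?far z0\<bar>"
        by (simp only: right_diff_distrib[symmetric] abs_mult)
      also have "\<dots> \<le> 1 * \<bar>(\<integral>u. half_kernel g z u \<partial>lborel) - ?far z0\<bar>"
        by (intro mult_right_mono k) auto
      also have "\<dots> \<le> enn2real (near (r\<^sup>2) z) + 8"
        unfolding mult_1 using integrable_half_kernelI(2)[OF fin r2] far_oscillation[OF assms True] by (rule tri)
      finally have "ennreal \<bar>half_deriv g z - ?k * ?far z0\<bar> \<le> ennreal (enn2real (near (r\<^sup>2) z) + 8)"
        by (rule ennreal_leI)
      also have "\<dots> = near (r\<^sup>2) z + 8"
        using fin by (subst ennreal_plus) (auto simp: ennreal_enn2real_if)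
      finally show ?thesis using True by simp
    qed simp
  qed
  then have "(\<integral>\<^sup>+z. ennreal \<bar>half_deriv g z - ?k * ?far z0\<bar> * indicator ?A z \<partial>lborel)
     \<le> (\<integral>\<^sup>+z. near (r\<^sup>2) z * indicator ?A z + 8 * indicator ?A z \<partial>lborel)"
    by (rule nn_integral_mono_AE)
  also have "\<dots> = (\<integral>\<^sup>+z. near (r\<^sup>2) z * indicator ?A z \<partial>lborel) + 8 * emeasure lborel ?A"
    by (subst nn_integral_add) (auto simp: nn_integral_cmult_indicator)
  also have "\<dots> \<le> ennreal (48 * r\<^sup>2 * measure lborel (ball (snd z0) r)) + ennreal (8 * measure lborel ?A)"
    using emeasure_pball_finite[of z0 r] nn_integral_near_pball[OF assms, of z0]
    by (intro add_mono) (auto simp: emeasure_eq_ennreal_measure ennreal_mult)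
  also have "\<dots> = ennreal (48 * (r\<^sup>2 * measure lborel (ball (snd z0) r)) + 8 * measure lborel ?A)"
    by (simp flip: ennreal_plus)
  also have "\<dots> \<le> ennreal ((96 * 2 ^ DIM('a) + 8) * measure lborel ?A)"
    using measure_pball_ge[OF assms, of z0] by (intro ennreal_leI) (simp add: algebra_simps)
  finally have *: "(\<integral>\<^sup>+z. ennreal \<bar>half_deriv g z - ?k * ?far z0\<bar> * indicator ?A z \<partial>lborel)
     \<le> ennreal ((96 * 2 ^ DIM('a) + 8) * measure lborel ?A)" .
  show "set_integrable lborel ?A (half_deriv g)"
    by (rule mean_oscillation_le(1)[OF _ _ measure_pball_pos[OF assms] emeasure_pball_finite _ *]) auto
  show "pavg ?A (\<lambda>w. \<bar>half_deriv g w - pavg ?A (half_deriv g)\<bar>) \<le> 2 * (96 * 2 ^ DIM('a) + 8)"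
    by (rule mean_oscillation_le(2)[OF _ _ measure_pball_pos[OF assms] emeasure_pball_finite _ *]) auto
qed

text \<open>Both constants of regularity grow linearly in |c|. With |c| small against a dimensional
  constant the oscillation grows by at most 1, which is the origin of the bound 1 +
  \<open>b2\<close>.\<close>

lemma regular_fun_add_scaled:
  assumes "regular_fun b1 b2 \<psi>" "0 \<le> b2"
  shows "regular_fun (b1 + \<bar>c\<bar>) (b2 + \<bar>c\<bar> * (2 * (96 * 2 ^ DIM('a) + 8))) (\<lambda>z. \<psi> z + c * g z)"
proof -
  have lip: "lip_half_one b1 \<psi>" and ex: "AE z in lborel. half_deriv_exists \<psi> z"
    and bmo: "pbmo_norm (half_deriv \<psi>) \<le> ennreal b2"
    using assms by (auto simp: regular_fun_def)
  let ?f = "\<lambda>z. \<psi> z + c * g z"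
  let ?b = "b2 + \<bar>c\<bar> * (2 * (96 * 2 ^ DIM('a) + 8))"
  have lipf: "lip_half_one (b1 + \<bar>c\<bar>) ?f"
    unfolding lip_half_one_def
  proof (intro allI)
    fix z w
    have "\<bar>c * g z - c * g w\<bar> = \<bar>c\<bar> * \<bar>g z - g w\<bar>" by (metis abs_mult right_diff_distrib)
    also have "\<dots> \<le> \<bar>c\<bar> * (1 * pdist z w)"
      by (intro mult_left_mono g_lip[unfolded lip_half_one_def, rule_format]) auto
    finally have "\<bar>c * g z - c * g w\<bar> \<le> \<bar>c\<bar> * pdist z w" by simp
    moreover have "\<bar>\<psi> z - \<psi> w\<bar> \<le> b1 * pdist z w"
      by (rule lip[unfolded lip_half_one_def, rule_format])
    ultimately have "\<bar>?f z - ?f w\<bar> \<le> b1 * pdist z w + \<bar>c\<bar> * pdist z w" by linarith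
    then show "\<bar>?f z - ?f w\<bar> \<le> (b1 + \<bar>c\<bar>) * pdist z w" by (simp add: algebra_simps)
  qed
  have cont: "continuous_on UNIV \<psi>" by (rule lip_half_one_continuous[OF lip])
  note [measurable] = borel_measurable_half_deriv[OF lip_half_one_continuous[OF lipf]]
  have both: "AE z in lborel. half_deriv_exists ?f z \<and> half_deriv ?f z = half_deriv \<psi> z + c * half_deriv g z"
    using ex AE_half_deriv_exists
    by eventually_elim (use half_deriv_add_scaled[OF cont g_continuous] in auto)
  have int: "set_integrable lborel (pball z r) (half_deriv \<psi>)" for z r
  proof -
    \<comment> \<open>The infinite default value of \<open>pbmo_norm\<close> encodes failure of
      integrability, so a finite bound gives integrability on balls back.\<close>
    have "pbmo_norm (half_deriv \<psi>) \<noteq> \<infinity>" using bmo by (auto simp: top_unique)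
    then show ?thesis unfolding pbmo_norm_def by meson
  qed
  have osc: "pavg (pball z r) (\<lambda>w. \<bar>half_deriv \<psi> w - pavg (pball z r) (half_deriv \<psi>)\<bar>) \<le> b2" if "0 < r" for z r
  proof -
    have "ennreal (pavg (pball z r) (\<lambda>w. \<bar>half_deriv \<psi> w - pavg (pball z r) (half_deriv \<psi>)\<bar>)) \<le> pbmo_norm (half_deriv \<psi>)"
      unfolding pbmo_norm_def using int that by (auto intro!: SUP_upper2[of z] SUP_upper2[of r])
    also note bmo
    finally show ?thesis using assms(2) by (simp add: ennreal_le_iff)
  qed
  have intg: "set_integrable lborel (pball z r) (half_deriv g)" for z r
  proof (cases "0 < r")
    case False
    then have "pball z r = {}" by (auto simp: pball_def pdist_def not_less) (smt (verit) norm_ge_zero real_sqrt_ge_zero)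
    then show ?thesis by (simp add: set_integrable_def)
  qed (rule half_deriv_mean_oscillation)
  have sum: "AE z in lborel. half_deriv ?f z = half_deriv \<psi> z + c * half_deriv g z"
    using both by auto
  note add = mean_oscillation_add[OF pball_borel borel_measurable_half_deriv[OF lip_half_one_continuous[OF lipf]]
     emeasure_pball_finite int intg sum]
  have "pavg (pball z r) (\<lambda>w. \<bar>half_deriv ?f w - pavg (pball z r) (half_deriv ?f)\<bar>) \<le> ?b" if "0 < r" for z r
    using add(2)[of z r] osc[OF that, of z]
      mult_left_mono[OF half_deriv_mean_oscillation(2)[OF that, of z], of "\<bar>c\<bar>"] by linarith
  then have "pbmo_norm (half_deriv ?f) \<le> ennreal ?b"
    unfolding pbmo_norm_def using add(1) by (auto intro!: SUP_least ennreal_leI)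
  then show ?thesis
    using lipf both unfolding regular_fun_def by auto
qed

end

section \<open>Regularised distance, plane coordinates, dyadic ancestors\<close>

lemma pdist_nonneg [simp]: "0 \<le> pdist z w"
  by (simp add: pdist_def)

lemma pdist_self [simp]: "pdist z z = 0"
  by (simp add: pdist_def)

lemma pdist_commute: "pdist z w = pdist w z"
  by (simp add: pdist_def norm_minus_commute abs_minus_commute)

lemma sqrt_abs_triangle: "sqrt \<bar>a - c\<bar> \<le> sqrt \<bar>a - b\<bar> + sqrt \<bar>b - (c::real)\<bar>"
proof -
  have "sqrt \<bar>a - c\<bar> \<le> sqrt (\<bar>a - b\<bar> + \<bar>b - c\<bar>)" by (intro real_sqrt_le_mono) auto
  also have "\<dots> \<le> sqrt \<bar>a - b\<bar> + sqrt \<bar>b - c\<bar>" by (rule sqrt_add_le_add_sqrt) auto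
  finally show ?thesis .
qed

lemma pdist_triangle: "pdist x z \<le> pdist x y + pdist y z"
proof -
  have "norm (snd x - snd z) \<le> norm (snd x - snd y) + norm (snd y - snd z)"
    using norm_triangle_ineq[of "snd x - snd y" "snd y - snd z"] by simp
  then show ?thesis
    using sqrt_abs_triangle[of "fst x" "fst z" "fst y"] unfolding pdist_def by linarith
qed

lemma pdist_pt_le: "w \<in> B \<Longrightarrow> pdist_pt z B \<le> ennreal (pdist z w)"
  unfolding pdist_pt_def pdist_set_def by (auto intro: INF_lower)

lemma pdist_pt_geI: "(\<And>w. w \<in> B \<Longrightarrow> c \<le> ennreal (pdist z w)) \<Longrightarrow> c \<le> pdist_pt z B"
  unfolding pdist_pt_def pdist_set_def by (auto intro: INF_greatest)

lemma pdist_pt_lessE: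
  assumes "pdist_pt z B < ennreal c"
  obtains w where "w \<in> B" "pdist z w < c"
  using assms unfolding pdist_pt_def pdist_set_def by (auto simp: INF_less_iff ennreal_less_iff)

lemma pdist_set_le: "z \<in> A \<Longrightarrow> w \<in> B \<Longrightarrow> pdist_set A B \<le> ennreal (pdist z w)"
  unfolding pdist_set_def by (rule INF_lower2[of z]) (auto intro: INF_lower)

lemma pdist_set_lessE:
  assumes "pdist_set A B < ennreal c"
  obtains z w where "z \<in> A" "w \<in> B" "pdist z w < c"
  using assms unfolding pdist_set_def by (auto simp: INF_less_iff ennreal_less_iff)

lemma pdist_le_pdiam: "z \<in> A \<Longrightarrow> w \<in> A \<Longrightarrow> ennreal (pdist z w) \<le> pdiam A"
  unfolding pdiam_def by (intro SUP_upper2[of z] SUP_upper2[of w]) auto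

lemma pdist_le_rdiam:
  assumes "pdiam A < \<infinity>" "z \<in> A" "w \<in> A"
  shows "pdist z w \<le> rdiam A"
  using enn2real_mono[OF pdist_le_pdiam[OF assms(2,3)]] assms(1) by (simp add: rdiam_def)

lemma pdiam_mono: "A \<subseteq> B \<Longrightarrow> pdiam A \<le> pdiam B"
  unfolding pdiam_def by (intro SUP_subset_mono) auto

text \<open>A pair (d, w) in \<open>A\<close> stands for the diameter of a cube and the projection
  of one of its points. Up to the cap c this is comparable with the infimum of d + pdist p w, but
  the square of that sum contains cross terms with the root of the time difference, which are not
  Lipschitz in time. Adding time linearly under a single root avoids them.\<close>

definition reg_dist :: "real \<Rightarrow> (real \<times> real \<times> 'a::real_normed_vector) set \<Rightarrow> real \<times> 'a \<Rightarrow> real" where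
  "reg_dist c A p = sqrt (Inf (insert (c\<^sup>2)
     ((\<lambda>(d, w). d\<^sup>2 + (norm (snd p - snd w))\<^sup>2 + \<bar>fst p - fst w\<bar>) ` A)))"

context
  fixes c :: real and A :: "(real \<times> real \<times> 'a::real_normed_vector) set"
  assumes c: "0 \<le> c"
begin

abbreviation (input) cost :: "real \<times> 'a \<Rightarrow> real \<times> real \<times> 'a \<Rightarrow> real" where
  "cost p a \<equiv> (case a of (d, w) \<Rightarrow> d\<^sup>2 + (norm (snd p - snd w))\<^sup>2 + \<bar>fst p - fst w\<bar>)"

lemma cost_bdd: "bdd_below (insert (c\<^sup>2) (cost p ` A))"
  by (rule bdd_belowI[of _ 0]) auto

lemma reg_dist_nonneg: "0 \<le> reg_dist c A p"
  unfolding reg_dist_def by (intro real_sqrt_ge_zero cInf_greatest) auto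

lemma reg_dist_le_cost: "(d, w) \<in> A \<Longrightarrow> reg_dist c A p \<le> sqrt (cost p (d, w))"
  unfolding reg_dist_def by (intro real_sqrt_le_mono cInf_lower[OF _ cost_bdd]) auto

lemma reg_dist_le_cap: "reg_dist c A p \<le> c"
proof -
  have "reg_dist c A p \<le> sqrt (c\<^sup>2)"
    unfolding reg_dist_def by (intro real_sqrt_le_mono cInf_lower[OF _ cost_bdd]) auto
  then show ?thesis using c by simp
qed

lemma reg_dist_lessE:
  assumes "reg_dist c A p < \<epsilon>"
  obtains "c < \<epsilon>" | d w where "(d, w) \<in> A" "sqrt (cost p (d, w)) < \<epsilon>"
proof -
  have "Inf (insert (c\<^sup>2) (cost p ` A)) < \<epsilon>\<^sup>2"
    using assms reg_dist_nonneg[of p] unfolding reg_dist_def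
    by (smt (verit) real_sqrt_abs real_sqrt_less_iff abs_of_nonneg)
  then obtain v where v: "v \<in> insert (c\<^sup>2) (cost p ` A)" "v < \<epsilon>\<^sup>2"
    using cInf_lessD[of "insert (c\<^sup>2) (cost p ` A)"] by auto
  have "0 < \<epsilon>" using assms reg_dist_nonneg[of p] by simp
  have "sqrt v < \<epsilon>" using real_sqrt_less_mono[OF v(2)] \<open>0 < \<epsilon>\<close> by simp
  with v(1) c show ?thesis
    by (auto intro: that)
qed

lemma reg_dist_le: "(d, w) \<in> A \<Longrightarrow> 0 \<le> d \<Longrightarrow> reg_dist c A p \<le> d + pdist p w"
proof -
  assume h: "(d, w) \<in> A" "0 \<le> d"
  have "sqrt (d\<^sup>2 + (norm (snd p - snd w))\<^sup>2 + \<bar>fst p - fst w\<bar>)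
      \<le> sqrt (d\<^sup>2 + (norm (snd p - snd w))\<^sup>2) + sqrt \<bar>fst p - fst w\<bar>"
    by (rule sqrt_add_le_add_sqrt) auto
  also have "sqrt (d\<^sup>2 + (norm (snd p - snd w))\<^sup>2) \<le> d + norm (snd p - snd w)"
    using h sqrt_add_le_add_sqrt[of "d\<^sup>2" "(norm (snd p - snd w))\<^sup>2"] by simp
  finally show ?thesis
    using reg_dist_le_cost[OF h(1), of p] by (simp add: pdist_def)
qed

text \<open>With R the old root and a, b the two parts of the displacement, expansion gives at most
  R^2 + 2 a R + a^2 + b^2, because the spatial distance entering R is at most R. This is below (R +
  a + b)^2.\<close>

lemma sqrt_cost_lip: "sqrt (cost p (d, w)) \<le> sqrt (cost p' (d, w)) + pdist p p'"
proof -
  define R a b where "R = sqrt (cost p' (d, w))" and "a = norm (snd p - snd p')" and "b = sqrt \<bar>fst p - fst p'\<bar>"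
  have nn: "0 \<le> R" "0 \<le> a" "0 \<le> b" by (auto simp: R_def a_def b_def)
  have R2: "R\<^sup>2 = d\<^sup>2 + (norm (snd p' - snd w))\<^sup>2 + \<bar>fst p' - fst w\<bar>" by (simp add: R_def)
  have "norm (snd p' - snd w) \<le> R"
    unfolding R_def by (rule real_le_rsqrt) auto
  then have "a * norm (snd p' - snd w) \<le> a * R" using nn by (intro mult_left_mono)
  moreover have "norm (snd p - snd w) \<le> norm (snd p' - snd w) + a"
    using norm_triangle_ineq[of "snd p - snd p'" "snd p' - snd w"] by (simp add: a_def)
  then have "(norm (snd p - snd w))\<^sup>2 \<le> (norm (snd p' - snd w) + a)\<^sup>2" by (intro power_mono) auto
  moreover have "\<bar>fst p - fst w\<bar> \<le> \<bar>fst p' - fst w\<bar> + b\<^sup>2" by (simp add: b_def)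
  ultimately have "cost p (d, w) \<le> R\<^sup>2 + 2 * (a * R) + a\<^sup>2 + b\<^sup>2"
    by (simp add: R2 power2_sum mult.commute)
  also have "\<dots> \<le> (R + (a + b))\<^sup>2"
    using nn by (simp add: power2_eq_square algebra_simps)
  finally have "sqrt (cost p (d, w)) \<le> sqrt ((R + (a + b))\<^sup>2)" by (rule real_sqrt_le_mono)
  then show ?thesis using nn by (simp add: R_def a_def b_def pdist_def)
qed

lemma reg_dist_lip_le: "reg_dist c A p \<le> reg_dist c A p' + pdist p p'"
proof (rule ccontr)
  assume "\<not> ?thesis"
  then have "reg_dist c A p' < reg_dist c A p - pdist p p'" by simp
  then show False
  proof (cases rule: reg_dist_lessE)
    case 1
    then show False using reg_dist_le_cap[of p] pdist_nonneg[of p p'] by linarith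
  next
    case (2 d w)
    then show False
      using reg_dist_le_cost[OF 2(1), of p] sqrt_cost_lip[of p d w p'] by linarith
  qed
qed

lemma reg_dist_sq_le: "(reg_dist c A (s, x))\<^sup>2 \<le> (reg_dist c A (t, x))\<^sup>2 + \<bar>s - t\<bar>"
proof -
  have sq: "(reg_dist c A p)\<^sup>2 = Inf (insert (c\<^sup>2) (cost p ` A))" for p
    unfolding reg_dist_def by (intro real_sqrt_pow2 cInf_greatest) auto
  have "Inf (insert (c\<^sup>2) (cost (s, x) ` A)) - \<bar>s - t\<bar> \<le> Inf (insert (c\<^sup>2) (cost (t, x) ` A))"
  proof (rule cInf_greatest)
    fix v assume "v \<in> insert (c\<^sup>2) (cost (t, x) ` A)"
    then consider "v = c\<^sup>2" | d r y where "(d, r, y) \<in> A" "v = d\<^sup>2 + (norm (x - y))\<^sup>2 + \<bar>t - r\<bar>" by auto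
    then show "Inf (insert (c\<^sup>2) (cost (s, x) ` A)) - \<bar>s - t\<bar> \<le> v"
    proof cases
      case 1
      then show ?thesis using cInf_lower[OF _ cost_bdd, of v "(s, x)"] by auto
    next
      case (2 d r y)
      have "Inf (insert (c\<^sup>2) (cost (s, x) ` A)) \<le> d\<^sup>2 + (norm (x - y))\<^sup>2 + \<bar>s - r\<bar>"
        by (rule cInf_lower[OF _ cost_bdd]) (use 2(1) in \<open>force simp: image_iff\<close>)
      then show ?thesis using 2(2) by linarith
    qed
  qed auto
  then show ?thesis by (simp add: sq)
qed

end

lemma time_regular_reg_dist:
  fixes A :: "(real \<times> real \<times> 'a::euclidean_space) set"
  assumes "0 \<le> c"
  shows "time_regular (reg_dist c A) c"
proof
  show "lip_half_one 1 (reg_dist c A)"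
    unfolding lip_half_one_def
    using reg_dist_lip_le[OF assms, of A] pdist_commute by (smt (verit) mult_1)
  show "\<bar>(reg_dist c A (s, x))\<^sup>2 - (reg_dist c A (t, x))\<^sup>2\<bar> \<le> \<bar>s - t\<bar>" for s x t
    using reg_dist_sq_le[OF assms, of A s x t] reg_dist_sq_le[OF assms, of A t x s] by linarith
qed (use assms in \<open>auto simp: reg_dist_nonneg reg_dist_le_cap\<close>)

text \<open>\<open>L\<close> and \<nu> together form a linear isometry; equality of dimensions makes
  it onto, and the coordinates are its inverse. The Lipschitz bounds are those for the components of
  an isometry.\<close>

lemma plane_coords_inverse:
  fixes L :: "real^'m \<Rightarrow> real^'n"
  assumes "plane_coords P q L \<nu>" and card: "CARD('n) = CARD('m) + 1"
  obtains cx cy where "\<And>X. X = q + L (cx X) + cy X *\<^sub>R \<nu>"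
    and "\<And>x y. cx (q + L x + y *\<^sub>R \<nu>) = x" and "\<And>x y. cy (q + L x + y *\<^sub>R \<nu>) = y"
    and "\<And>X Y. norm (cx X - cx Y) \<le> norm (X - Y)" and "\<And>X Y. \<bar>cy X - cy Y\<bar> \<le> norm (X - Y)"
    and "\<And>X Y. norm (X - Y) \<le> norm (cx X - cx Y) + \<bar>cy X - cy Y\<bar>"
proof -
  have L: "linear L" "\<And>x. norm (L x) = norm x" "norm \<nu> = 1" "\<And>x. L x \<bullet> \<nu> = 0"
    using assms(1) by (auto simp: plane_coords_def)
  define T :: "(real^'m) \<times> real \<Rightarrow> real^'n" where "T v = L (fst v) + snd v *\<^sub>R \<nu>" for v
  have lin: "linear T"
    unfolding T_def
    by (intro linear_compose_add linear_compose[OF linear_fst L(1), unfolded o_def]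
        linear_compose[OF linear_snd linear_scaleR_left, unfolded o_def])
  have norm: "norm (T v) = norm v" for v
  proof -
    have "(norm (T v))\<^sup>2 = (norm (fst v))\<^sup>2 + (snd v)\<^sup>2"
      using L by (simp add: T_def norm_add_Pythagorean orthogonal_def)
    then have "(norm (T v))\<^sup>2 = (norm v)\<^sup>2"
      by (cases v) (simp add: norm_Pair)
    then show ?thesis by (simp add: power2_eq_iff_nonneg)
  qed
  have inj: "inj T"
    using norm by (metis lin linear_injective_0 norm_eq_zero)
  have "dim (range T) = dim (UNIV :: ((real^'m) \<times> real) set)"
    by (rule dim_image_eq[OF lin]) (use inj in \<open>simp add: inj_on_def\<close>)
  then have "dim (range T) = DIM(real^'n)" by (simp add: card)
  then have "span (range T) = UNIV" by (simp only: dim_eq_full)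
  then have surj: "surj T"
    using linear_subspace_image[OF lin subspace_UNIV] by (metis span_eq_iff)
  define V where "V X = inv T (X - q)" for X
  have TV: "T (V X) = X - q" for X unfolding V_def by (rule surj_f_inv_f[OF surj])
  have VT: "V (q + T v) = v" for v unfolding V_def by (simp add: inv_f_f[OF inj])
  have "norm (V X - V Y) = norm (X - Y)" for X Y
    using norm[of "V X - V Y"] TV[of X] TV[of Y] by (simp add: linear_diff[OF lin])
  then have dist: "norm (fst (V X) - fst (V Y), snd (V X) - snd (V Y)) = norm (X - Y)" for X Y
    by (simp add: minus_prod_def)
  show ?thesis
  proof (rule that[of "\<lambda>X. fst (V X)" "\<lambda>X. snd (V X)"])
    show "X = q + L (fst (V X)) + snd (V X) *\<^sub>R \<nu>" for X
      using TV[of X] by (simp add: T_def add.assoc)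
    show "fst (V (q + L x + y *\<^sub>R \<nu>)) = x" "snd (V (q + L x + y *\<^sub>R \<nu>)) = y" for x y
      using VT[of "(x, y)"] by (simp_all add: T_def add.assoc)
    fix X Y
    show "norm (fst (V X) - fst (V Y)) \<le> norm (X - Y)"
      using norm_fst_le[of "fst (V X) - fst (V Y)" "snd (V X) - snd (V Y)"] by (simp only: dist)
    show "\<bar>snd (V X) - snd (V Y)\<bar> \<le> norm (X - Y)"
      using norm_snd_le[of "snd (V X) - snd (V Y)" "fst (V X) - fst (V Y)"] by (simp only: dist real_norm_def)
    show "norm (X - Y) \<le> norm (fst (V X) - fst (V Y)) + \<bar>snd (V X) - snd (V Y)\<bar>"
      using norm_Pair_le[of "fst (V X) - fst (V Y)" "snd (V X) - snd (V Y)"] by (simp only: dist real_norm_def)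
  qed
qed

section \<open>Nesting, diameters and ancestors of dyadic cubes\<close>

lemma dyadic_systemD:
  assumes "dyadic_system E a0 \<gamma> cs D"
  shows dyadic_subset: "Q \<in> D k \<Longrightarrow> Q \<subseteq> E"
    and dyadic_nested: "k \<le> m \<Longrightarrow> Q \<in> D m \<Longrightarrow> Q' \<in> D k \<Longrightarrow> Q \<subseteq> Q' \<or> Q \<inter> Q' = {}"
    and dyadic_ancestor: "m < k \<Longrightarrow> Q \<in> D k \<Longrightarrow> \<exists>Q'\<in>D m. Q \<subseteq> Q'"
    and dyadic_diam: "Q \<in> D k \<Longrightarrow> pdiam Q \<le> ennreal (cs * 2 powr (- real_of_int k))"
    and dyadic_ball: "Q \<in> D k \<Longrightarrow> \<exists>z\<in>E. E \<inter> pball z (a0 * 2 powr (- real_of_int k)) \<subseteq> Q"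
proof -
  note d = assms[unfolded dyadic_system_def]
  show "Q \<in> D k \<Longrightarrow> Q \<subseteq> E"
    using d[THEN conjunct1] by blast
  show "k \<le> m \<Longrightarrow> Q \<in> D m \<Longrightarrow> Q' \<in> D k \<Longrightarrow> Q \<subseteq> Q' \<or> Q \<inter> Q' = {}"
    using d[THEN conjunct2, THEN conjunct2, THEN conjunct1] by blast
  show "m < k \<Longrightarrow> Q \<in> D k \<Longrightarrow> \<exists>Q'\<in>D m. Q \<subseteq> Q'"
    using d[THEN conjunct2, THEN conjunct2, THEN conjunct2, THEN conjunct1, rule_format] by (meson ex1_implies_ex)
  show "Q \<in> D k \<Longrightarrow> pdiam Q \<le> ennreal (cs * 2 powr (- real_of_int k))"
    using d[THEN conjunct2, THEN conjunct2, THEN conjunct2, THEN conjunct2, THEN conjunct1] by blast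
  show "Q \<in> D k \<Longrightarrow> \<exists>z\<in>E. E \<inter> pball z (a0 * 2 powr (- real_of_int k)) \<subseteq> Q"
    using d[THEN conjunct2, THEN conjunct2, THEN conjunct2, THEN conjunct2, THEN conjunct2, THEN conjunct1] by blast
qed

lemma sets_pH: "sets (pH :: 'n::finite stpt measure) = sets borel"
  using sets.sets_measure_of_eq[of "borel :: 'n stpt measure"] by (simp add: pH_def)

text \<open>A lower bound for diam(Q) in terms of the generation comes from ADR: the cube contains a
  surface ball of radius \<open>r\<close> and lies in one of radius \<open>2 * rdiam Q\<close>, and
  comparing masses bounds \<open>r\<close> by a multiple of diam(Q). The parent has diameter at most
  \<open>2 * cs / a0 * r\<close>.\<close>

lemma dyadic_parent_diam:
  fixes E :: "'n::finite stpt set"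
  assumes D: "dyadic_system E a0 \<gamma> cs D" and adr: "ADR C0 E" and a0: "0 < a0"
    and Q: "Q \<in> D k" and Q': "Q' \<in> D (k - 1)" and sub: "Q \<subseteq> Q'" and pos: "0 < rdiam Q"
  shows "rdiam Q' \<le> max 1 (8 * cs * (max 1 C0)\<^sup>2 / a0) * rdiam Q"
proof -
  define r where "r = a0 * 2 powr (- real_of_int k)"
  have r: "0 < r" using a0 by (simp add: r_def)
  obtain z where z: "z \<in> E" "E \<inter> pball z r \<subseteq> Q"
    using dyadic_ball[OF D Q] unfolding r_def by blast
  note diam = dyadic_diam[OF D] and QE = dyadic_subset[OF D]
  have fin: "pdiam Q < \<infinity>" using diam[OF Q] by (simp add: le_less_trans)
  have zQ: "z \<in> Q" using z r by (auto simp: pball_def)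
  let ?C = "max 1 C0" and ?N = "CARD('n) + 1"
  have cs: "0 < cs"
  proof (rule ccontr)
    assume "\<not> 0 < cs"
    then have "cs * 2 powr (- real_of_int k) \<le> 0" by (simp add: mult_nonpos_nonneg)
    then have "pdiam Q = 0" using diam[OF Q] by (simp add: ennreal_neg)
    then show False using pos by (simp add: rdiam_def)
  qed
  show ?thesis
  proof (cases "ennreal (r / 2) < pdiam E")
    case False
    \<comment> \<open>The ADR bounds are confined to radii below the diameter of \<open>E\<close>.
      Here the ball of radius \<open>r\<close> contains all of \<open>E\<close>, and the cube equals
      its parent.\<close>
    then have "pdiam E \<le> ennreal (r / 2)" by simp
    have "E \<subseteq> pball z r"
    proof
      fix w assume "w \<in> E"
      then have "ennreal (pdist z w) \<le> ennreal (r / 2)"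
        using pdist_le_pdiam[OF z(1), of w] \<open>pdiam E \<le> ennreal (r / 2)\<close> by (meson order_trans)
      then have "pdist z w \<le> r / 2" using r by (simp add: ennreal_le_iff)
      then show "w \<in> pball z r" using r by (simp add: pball_def)
    qed
    then have "Q' = Q" using z(2) sub QE[OF Q'] by blast
    then show ?thesis using pos by simp
  next
    case True
    have "r / 2 \<le> 2 * ?C\<^sup>2 * rdiam Q"
    proof (cases "ennreal (2 * rdiam Q) < pdiam E")
      case False
      then have "ennreal (r / 2) < ennreal (2 * rdiam Q)" using True by (simp add: less_le_trans)
      then have "r / 2 \<le> 2 * rdiam Q" using r by (simp add: ennreal_less_iff)
      moreover have "2 * rdiam Q * 1 \<le> 2 * rdiam Q * ?C\<^sup>2"
        using pos by (intro mult_left_mono) auto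
      ultimately show ?thesis by (simp add: mult.commute mult.left_commute)
    next
      case 2: True
      have C0: "0 < C0" using adr by (simp add: ADR_def)
      have bnd: "0 < s \<Longrightarrow> ennreal s < pdiam E \<Longrightarrow>
        ennreal (s ^ ?N / C0) \<le> emeasure pH (pball z s \<inter> E) \<and>
        emeasure pH (pball z s \<inter> E) \<le> ennreal (C0 * s ^ ?N)" for s
        using adr z(1) unfolding ADR_def by blast
      have "pball z (r / 2) \<inter> E \<subseteq> pball z (2 * rdiam Q) \<inter> E"
      proof
        fix w assume w: "w \<in> pball z (r / 2) \<inter> E"
        then have "w \<in> Q" using z(2) r by (auto simp: pball_def)
        then have "pdist z w \<le> rdiam Q" by (rule pdist_le_rdiam[OF fin zQ])
        then show "w \<in> pball z (2 * rdiam Q) \<inter> E" using pos w by (simp add: pball_def)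
      qed
      moreover have "pball z (2 * rdiam Q) \<inter> E \<in> sets pH"
        using adr by (auto simp: ADR_def sets_pH)
      ultimately have m: "emeasure pH (pball z (r / 2) \<inter> E) \<le> emeasure pH (pball z (2 * rdiam Q) \<inter> E)"
        by (rule emeasure_mono)
      have "ennreal ((r / 2) ^ ?N / C0) \<le> emeasure pH (pball z (r / 2) \<inter> E)"
        using bnd[of "r / 2"] r True by (meson half_gt_zero)
      also note m
      also have "emeasure pH (pball z (2 * rdiam Q) \<inter> E) \<le> ennreal (C0 * (2 * rdiam Q) ^ ?N)"
        using bnd[of "2 * rdiam Q"] pos 2 by simp
      finally have "(r / 2) ^ ?N / C0 \<le> C0 * (2 * rdiam Q) ^ ?N"
        using C0 pos by (simp add: ennreal_le_iff)
      then have "(r / 2) ^ ?N \<le> C0\<^sup>2 * (2 * rdiam Q) ^ ?N"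
        using C0 by (simp add: pos_divide_le_eq power2_eq_square mult_ac)
      \<comment> \<open>The constant is enlarged to an N-th power of a number at least 1, so that
        the N-th root of the inequality can be taken.\<close>
      also have "\<dots> \<le> (?C\<^sup>2) ^ ?N * (2 * rdiam Q) ^ ?N"
      proof (intro mult_right_mono)
        have "C0\<^sup>2 \<le> ?C\<^sup>2" using C0 by (intro power_mono) auto
        also have "\<dots> \<le> (?C\<^sup>2) ^ ?N" by (rule self_le_power) auto
        finally show "C0\<^sup>2 \<le> (?C\<^sup>2) ^ ?N" .
      qed (use pos in auto)
      also have "\<dots> = (?C\<^sup>2 * (2 * rdiam Q)) ^ ?N" by (simp only: power_mult_distrib)
      finally have "r / 2 \<le> ?C\<^sup>2 * (2 * rdiam Q)"
        using pos by (intro power_le_imp_le_base[of "r / 2" "CARD('n)"]) auto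
      then show ?thesis by simp
    qed
    then have "r \<le> 4 * ?C\<^sup>2 * rdiam Q" by simp
    have "rdiam Q' \<le> cs * 2 powr (- real_of_int (k - 1))"
      unfolding rdiam_def using cs diam[OF Q'] by (intro enn2real_leI) auto
    also have "2 powr (- real_of_int (k - 1)) = 2 * (r / a0)"
      using a0 powr_add[of 2 "- real_of_int k" 1] by (simp add: r_def)
    also have "cs * (2 * (r / a0)) = 2 * cs / a0 * r" by simp
    also have "\<dots> \<le> 2 * cs / a0 * (4 * ?C\<^sup>2 * rdiam Q)"
      using cs a0 \<open>r \<le> _\<close> by (intro mult_left_mono) auto
    also have "\<dots> = 8 * cs * ?C\<^sup>2 / a0 * rdiam Q" by simp
    also have "\<dots> \<le> max 1 (8 * cs * ?C\<^sup>2 / a0) * rdiam Q"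
      using pos by (intro mult_right_mono) auto
    finally show ?thesis .
  qed
qed

lemma top_cube_is_top: "coherent D S \<Longrightarrow> is_top S (top_cube S)"
  unfolding coherent_def top_cube_def by (elim conjE) (rule theI')

text \<open>Climb through the dyadic parents and stop at the first cube of diameter at least \<mu>.
  Its predecessor is smaller than \<mu>, so the last step overshoots by at most the parent-child
  ratio; the maximum covers the case that Q is large already. Coherence keeps the chain inside
  \<open>S\<close>, and the top cube stops it at the latest.\<close>

lemma coherent_ancestor:
  fixes E :: "'n::finite stpt set"
  assumes D: "dyadic_system E a0 \<gamma> cs D" and adr: "ADR C0 E" and a0: "0 < a0"
    and S: "coherent D S" and pos: "\<And>Q. Q \<in> S \<Longrightarrow> 0 < rdiam Q"
    and Q: "Q \<in> S" and \<mu>: "\<mu> \<le> rdiam (top_cube S)"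
  shows "\<exists>Q'\<in>S. Q \<subseteq> Q' \<and> \<mu> \<le> rdiam Q' \<and>
    rdiam Q' \<le> max (rdiam Q) (max 1 (8 * cs * (max 1 C0)\<^sup>2 / a0) * \<mu>)"
proof -
  let ?C = "max 1 (8 * cs * (max 1 C0)\<^sup>2 / a0)"
  have top: "top_cube S \<in> S" "\<And>Q. Q \<in> S \<Longrightarrow> Q \<subseteq> top_cube S"
    using top_cube_is_top[OF S] by (auto simp: is_top_def)
  have cubes: "S \<subseteq> cubes D" using S by (simp add: coherent_def)
  note nest = dyadic_nested[OF D]
  obtain kS where kS: "top_cube S \<in> D kS" using top(1) cubes by (auto simp: cubes_def)
  have ne: "R \<noteq> {}" if "R \<in> S" for R
    using pos[OF that] by (auto simp: rdiam_def pdiam_def bot_ennreal)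
  have "\<exists>Q'\<in>S. Q \<subseteq> Q' \<and> \<mu> \<le> rdiam Q' \<and> rdiam Q' \<le> max (rdiam Q) (?C * \<mu>)"
    if "Q \<in> S" "Q \<in> D k" "nat (k - kS) = n" for n k Q
    using that
  proof (induction n arbitrary: k Q)
    case 0
    \<comment> \<open>A cube may belong to several generations, and the truncated difference is also
      0 for k < \<open>kS\<close>; nesting identifies Q with the top cube in either case.\<close>
    then have "top_cube S \<subseteq> Q"
      using nest[of k kS "top_cube S" Q] kS top(2)[of Q] ne[of Q] by auto
    then have "Q = top_cube S" using top(2) 0 by blast
    then show ?case using 0 \<mu> by auto
  next
    case (Suc n)
    show ?case
    proof (cases "\<mu> \<le> rdiam Q")
      case True
      then show ?thesis using Suc.prems by auto
    next
      case False
      obtain R where R: "R \<in> D (k - 1)" "Q \<subseteq> R"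
        using dyadic_ancestor[OF D _ Suc.prems(2), of "k - 1"] by auto
      have "kS \<le> k - 1" using Suc.prems(3) by simp
      then have "R \<subseteq> top_cube S"
        using nest[OF _ R(1) kS] R(2) top(2)[OF Suc.prems(1)] ne[OF Suc.prems(1)] by blast
      then have RS: "R \<in> S"
        using S Suc.prems(1) R unfolding coherent_def cubes_def by blast
      have "nat (k - 1 - kS) = n" using Suc.prems(3) by linarith
      from Suc.IH[OF RS R(1) this] obtain Q' where Q': "Q' \<in> S" "R \<subseteq> Q'" "\<mu> \<le> rdiam Q'"
        "rdiam Q' \<le> max (rdiam R) (?C * \<mu>)" by blast
      have "rdiam R \<le> ?C * rdiam Q"
        by (rule dyadic_parent_diam[OF D adr a0 Suc.prems(2) R pos[OF Suc.prems(1)]])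
      also have "\<dots> \<le> ?C * \<mu>" using False by (intro mult_left_mono) auto
      finally show ?thesis using Q' R(2) by (intro bexI[of _ Q']) auto
    qed
  qed
  moreover obtain k where "Q \<in> D k" using Q cubes by (auto simp: cubes_def)
  ultimately show ?thesis using Q by blast
qed

section \<open>Position of the set relative to the shifted graphs\<close>

lemma reg_dist_nearE:
  fixes A :: "(real \<times> real \<times> 'a::real_normed_vector) set"
  assumes "0 \<le> c" "reg_dist c A p < \<epsilon>"
  obtains "c < \<epsilon>" | d w where "(d, w) \<in> A" "d < \<epsilon>" "pdist p w < 2 * \<epsilon>"
  using assms
proof (cases rule: reg_dist_lessE)
  case 1
  then show ?thesis by (rule that(1))
next
  case (2 d w)
  let ?n = "norm (snd p - snd w)" and ?a = "\<bar>fst p - fst w\<bar>"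
  have *: "d \<le> sqrt (d\<^sup>2 + ?n\<^sup>2 + ?a)" "?n \<le> sqrt (d\<^sup>2 + ?n\<^sup>2 + ?a)" "sqrt ?a \<le> sqrt (d\<^sup>2 + ?n\<^sup>2 + ?a)"
    by (auto intro!: real_le_rsqrt)
  have "sqrt (d\<^sup>2 + ?n\<^sup>2 + ?a) < \<epsilon>" using 2(2) by simp
  then have "d < \<epsilon>" "?n + sqrt ?a < 2 * \<epsilon>" using * by linarith+
  then show ?thesis using 2(1) by (intro that(2)[of d w]) (auto simp: pdist_def)
qed

text \<open>The infimum defining g need not be attained, so an estimate is first proved for every
  \<epsilon> above it and then passed to the limit.\<close>

lemma le_mult_limit:
  fixes a b x :: real
  assumes "0 < a" "\<And>\<epsilon>. b < \<epsilon> \<Longrightarrow> x \<le> a * \<epsilon>"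
  shows "x \<le> a * b"
proof -
  have "x / a \<le> b"
    by (rule dense_ge) (use assms in \<open>simp add: field_simps\<close>)
  then show ?thesis using assms(1) by (simp add: field_simps)
qed

text \<open>Here \<open>\<theta> = \<eta>^(1/16)\<close>, which makes all powers of \<open>\<eta>\<close> and \<open>K\<close> in the proof integral; \<open>pr\<close> is the
  projection to the plane, \<open>hz\<close> the normal coordinate, \<open>lift\<close> the inverse of \<open>(pr, hz)\<close>, and \<open>Phi\<close> the
  height above the corona graph.\<close>

locale corona_graph =
  fixes E :: "'n::finite stpt set" and S :: "'n cube set" and QS :: "'n cube" and zS :: "'n stpt"
    and \<theta> Cr :: real and \<psi> :: "'m::finite stpt \<Rightarrow> real"
    and pr :: "'n stpt \<Rightarrow> 'm stpt" and hz :: "'n stpt \<Rightarrow> real" and lift :: "'m stpt \<Rightarrow> real \<Rightarrow> 'n stpt"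
  assumes \<theta>: "0 < \<theta>" "\<theta> \<le> 1 / 100" and Cr: "0 \<le> Cr" "Cr * \<theta> \<le> 1 / 100"
    and QS: "QS \<in> S" "zS \<in> QS"
    and cube: "\<And>Q. Q \<in> S \<Longrightarrow> Q \<subseteq> E" "\<And>Q. Q \<in> S \<Longrightarrow> Q \<subseteq> QS" "\<And>Q. Q \<in> S \<Longrightarrow> 0 < rdiam Q"
    and diam: "\<And>Q z w. Q \<in> S \<Longrightarrow> z \<in> Q \<Longrightarrow> w \<in> Q \<Longrightarrow> pdist z w \<le> rdiam Q"
    and psi: "lip_half_one (\<theta> ^ 16) \<psi>"
    and pr: "\<And>z w. pdist (pr z) (pr w) \<le> pdist z w"
    and hz: "\<And>z w. \<bar>hz z - hz w\<bar> \<le> pdist z w"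
    and pr_hz: "\<And>z w. pdist z w \<le> pdist (pr z) (pr w) + \<bar>hz z - hz w\<bar>"
    and lift: "\<And>p y. pr (lift p y) = p" "\<And>p y. hz (lift p y) = y"
    and near_graph: "\<And>Q e w. Q \<in> S \<Longrightarrow> e \<in> E \<Longrightarrow> w \<in> Q \<Longrightarrow> pdist e w < (1 / \<theta> ^ 16 - 1) * rdiam Q \<Longrightarrow>
        \<bar>hz e - \<psi> (pr e)\<bar> \<le> 2 * \<theta> ^ 16 * rdiam Q"
    and near_E: "\<And>Q p w. Q \<in> S \<Longrightarrow> w \<in> Q \<Longrightarrow> hz p = \<psi> (pr p) \<Longrightarrow> pdist p w < (1 / \<theta> ^ 16 - 1) * rdiam Q \<Longrightarrow>
        \<exists>e\<in>E. pdist p e < \<theta> ^ 16 * rdiam Q"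
    and ancestor_ex: "\<And>Q l. Q \<in> S \<Longrightarrow> l \<le> rdiam QS \<Longrightarrow>
        \<exists>Q'\<in>S. Q \<subseteq> Q' \<and> l \<le> rdiam Q' \<and> rdiam Q' \<le> max (rdiam Q) (Cr * l)"
begin

definition "eta = \<theta> ^ 16"
definition "kap = \<theta> ^ 15"
definition "K = 1 / eta"
definition "dS = rdiam QS"
definition "g = reg_dist dS {(rdiam Q, pr w) | Q w. Q \<in> S \<and> w \<in> Q}"
definition "Phi z = hz z - \<psi> (pr z)"

lemma lip: "lip_half_one eta \<psi>"
  using psi by (simp add: eta_def)

lemma E_near_graph:
  "Q \<in> S \<Longrightarrow> e \<in> E \<Longrightarrow> w \<in> Q \<Longrightarrow> pdist e w < (K - 1) * rdiam Q \<Longrightarrow> \<bar>Phi e\<bar> \<le> 2 * eta * rdiam Q"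
  using near_graph by (simp add: Phi_def K_def eta_def)

lemma graph_near_E:
  "Q \<in> S \<Longrightarrow> w \<in> Q \<Longrightarrow> Phi p = 0 \<Longrightarrow> pdist p w < (K - 1) * rdiam Q \<Longrightarrow> \<exists>e\<in>E. pdist p e < eta * rdiam Q"
  using near_E by (simp add: Phi_def K_def eta_def)

lemma ancestor:
  "Q \<in> S \<Longrightarrow> l \<le> dS \<Longrightarrow> \<exists>Q'\<in>S. Q \<subseteq> Q' \<and> l \<le> rdiam Q' \<and> rdiam Q' \<le> max (rdiam Q) (Cr * l)"
  using ancestor_ex by (simp add: dS_def)

lemma eta_pos: "0 < eta" and kap_pos: "0 < kap"
  using \<theta> by (auto simp: eta_def kap_def)

lemma power_theta_le: "1 \<le> n \<Longrightarrow> \<theta> ^ n \<le> 1 / 100"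
  using power_decreasing[of 1 n \<theta>] \<theta> by simp

lemma kap_le: "kap \<le> 1 / 100"
  by (simp add: kap_def power_theta_le del: le_divide_eq_numeral1)

lemma eta_eq: "eta = \<theta> * kap"
  by (simp add: eta_def kap_def flip: power_Suc)

lemma eta_le: "eta \<le> kap / 100"
  using mult_right_mono[OF \<theta>(2), of kap] kap_pos by (simp add: eta_eq)

lemma Cr_eta: "Cr * eta \<le> 1 / 100"
proof -
  have "Cr * eta = Cr * \<theta> * kap" by (simp add: eta_eq)
  also have "\<dots> \<le> 1 / 100 * 1" using Cr kap_pos kap_le \<theta> by (intro mult_mono) auto
  finally show ?thesis by simp
qed

lemma eta_le': "eta \<le> 1 / 100" using eta_le kap_le by linarith

lemma K_ge: "100 \<le> K"
  using eta_le' eta_pos by (simp add: K_def field_simps)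

lemma eta_K: "eta * K = 1" using eta_pos by (simp add: K_def)

lemma dS_pos: "0 < dS" using cube(3)[OF QS(1)] by (simp add: dS_def)

text \<open>The dilate \<open>KQ\<close> reaches only (K - 1) diam(Q) away from Q; distances up to
  half of K diam(Q) stay inside since K \<ge> 100.\<close>

lemma K_bound: "pdist z w \<le> c * K * rdiam Q \<Longrightarrow> c \<le> 1/2 \<Longrightarrow> 0 < rdiam Q \<Longrightarrow> pdist z w < (K - 1) * rdiam Q"
proof -
  assume h: "pdist z w \<le> c * K * rdiam Q" "c \<le> 1/2" "0 < rdiam Q"
  have "c * K \<le> 1 / 2 * K" using h(2) K_ge by (intro mult_right_mono) auto
  then have "c * K < K - 1" using K_ge by linarith
  then have "c * K * rdiam Q < (K - 1) * rdiam Q" using h(3) by (intro mult_strict_right_mono)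
  with h(1) show ?thesis by linarith
qed

lemma zS_E: "zS \<in> E" using QS cube(1) by blast

lemma g_nonneg: "0 \<le> g p"
  unfolding g_def using dS_pos by (intro reg_dist_nonneg) auto

lemma g_le_dS: "g p \<le> dS"
  unfolding g_def using dS_pos by (intro reg_dist_le_cap) auto

lemma g_lip: "\<bar>g (pr z) - g (pr w)\<bar> \<le> pdist z w"
proof -
  have "g p \<le> g p' + pdist p p'" for p p'
    unfolding g_def using dS_pos by (intro reg_dist_lip_le) auto
  from this[of "pr z" "pr w"] this[of "pr w" "pr z"] show ?thesis
    using pr[of z w] pdist_commute[of "pr z" "pr w"] by linarith
qed

lemma g_le: "Q \<in> S \<Longrightarrow> w \<in> Q \<Longrightarrow> g (pr z) \<le> rdiam Q + pdist z w"
proof -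
  assume h: "Q \<in> S" "w \<in> Q"
  have "g (pr z) \<le> rdiam Q + pdist (pr z) (pr w)"
    unfolding g_def
  proof (rule reg_dist_le)
    show "(rdiam Q, pr w) \<in> {(rdiam Q, pr w) |Q w. Q \<in> S \<and> w \<in> Q}" using h by blast
  qed (use dS_pos cube(3)[OF h(1)] in auto)
  then show ?thesis using pr[of z w] by linarith
qed

lemma g_nearE:
  assumes "g p < \<epsilon>"
  obtains "dS < \<epsilon>" | Q w where "Q \<in> S" "w \<in> Q" "rdiam Q < \<epsilon>" "pdist p (pr w) < 2 * \<epsilon>"
proof -
  have "0 \<le> dS" using dS_pos by simp
  from this assms[unfolded g_def] show ?thesis
    by (cases rule: reg_dist_nearE) (auto intro: that)
qed

lemma psi_lip: "\<bar>\<psi> (pr z) - \<psi> (pr w)\<bar> \<le> eta * pdist (pr z) (pr w)"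
  by (rule lip[unfolded lip_half_one_def, rule_format])

lemma Phi_lip: "\<bar>Phi z - Phi w\<bar> \<le> 2 * pdist z w"
proof -
  have "eta * pdist (pr z) (pr w) \<le> 1 * pdist z w"
    using pr[of z w] eta_le' eta_pos by (intro mult_mono) auto
  then show ?thesis unfolding Phi_def using psi_lip[of z w] hz[of z w] by linarith
qed

lemma vertical_dist: "pdist z (lift (pr z) y) \<le> \<bar>hz z - y\<bar>"
  using pr_hz[of z "lift (pr z) y"] by (simp add: lift)

text \<open>If \<open>e\<close> is far from the cube \<open>Q\<close> realising \<open>g (pr e)\<close>, then both \<open>e\<close> and \<open>Q\<close> are seen by an
  ancestor of \<open>Q\<close>, hence lie along the almost horizontal graph; so their distance is horizontal,
  that is, of order \<open>g (pr e)\<close>.\<close>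

lemma Phi_on_E:
  assumes e: "e \<in> E" "pdist e zS \<le> K / 8 * dS"
  shows "\<bar>Phi e\<bar> \<le> 2 * eta * g (pr e)"
proof (rule le_mult_limit)
  show "0 < 2 * eta" using eta_pos by simp
  fix \<epsilon> assume "g (pr e) < \<epsilon>"
  then show "\<bar>Phi e\<bar> \<le> 2 * eta * \<epsilon>"
  proof (cases rule: g_nearE)
    case 1
    \<comment> \<open>At the cap the top cube itself sees e.\<close>
    have "pdist e zS < (K - 1) * rdiam QS"
      using e(2) dS_pos by (intro K_bound[of _ _ "1/8"]) (auto simp: dS_def)
    then have "\<bar>Phi e\<bar> \<le> 2 * eta * dS" unfolding dS_def by (rule E_near_graph[OF QS(1) e(1) QS(2)])
    also have "\<dots> \<le> 2 * eta * \<epsilon>" using 1 eta_pos by (intro mult_left_mono) auto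
    finally show ?thesis .
  next
    case (2 Q w)
    let ?\<rho> = "pdist e w"
    have "pdist zS w \<le> dS" unfolding dS_def using diam[OF QS] 2 cube(2) by blast
    then have "?\<rho> \<le> K / 8 * dS + dS" using e(2) pdist_triangle[of e w zS] by linarith
    moreover have "1 * dS \<le> K / 8 * dS" using K_ge dS_pos by (intro mult_right_mono) auto
    ultimately have "?\<rho> \<le> K / 4 * dS" by linarith
    then have "2 * eta * ?\<rho> \<le> 2 * eta * (K / 4 * dS)" using eta_pos by (intro mult_left_mono) auto
    also have "\<dots> = eta * K * dS / 2" by simp
    finally have "2 * eta * ?\<rho> \<le> dS" using eta_K dS_pos by simp
    \<comment> \<open>An ancestor of diameter at least \<open>2 * eta * ?\<rho>\<close> has e within
      half of its K-dilate, while the upper bound keeps it below \<open>?\<rho> / 50\<close> unless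
      it is no larger than Q.\<close>
    from ancestor[OF 2(1) this] obtain Q' where Q': "Q' \<in> S" "Q \<subseteq> Q'" "2 * eta * ?\<rho> \<le> rdiam Q'"
      "rdiam Q' \<le> max (rdiam Q) (Cr * (2 * eta * ?\<rho>))" by blast
    have wQ': "w \<in> Q'" using Q'(2) 2(2) by blast
    have pos: "0 < rdiam Q'" by (rule cube(3)[OF Q'(1)])
    have "K / 2 * (2 * eta * ?\<rho>) \<le> K / 2 * rdiam Q'" using Q'(3) K_ge by (intro mult_left_mono) auto
    moreover have "K / 2 * (2 * eta * ?\<rho>) = (eta * K) * ?\<rho>" by simp
    ultimately have "?\<rho> \<le> 1 / 2 * K * rdiam Q'" unfolding eta_K by linarith
    then have "?\<rho> < (K - 1) * rdiam Q'" by (rule K_bound) (use pos in auto)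
    then have Pe: "\<bar>Phi e\<bar> \<le> 2 * eta * rdiam Q'" by (rule E_near_graph[OF Q'(1) e(1) wQ'])
    have "pdist w w < (K - 1) * rdiam Q'" using pos K_ge by simp
    then have Pw: "\<bar>Phi w\<bar> \<le> 2 * eta * rdiam Q'"
      using wQ' cube(1)[OF Q'(1)] by (intro E_near_graph[OF Q'(1) _ wQ']) auto
    \<comment> \<open>Suppose the ancestor is larger than \<epsilon>, hence at most 1/50 of the
      distance from e to w. Both points have height of order eta diam(Q') over a nearly flat graph,
      and their projections are within 2 \<epsilon>; so their distance barely exceeds 2 \<epsilon>,
      up to a small fraction of diam(Q'), and the ancestor was not that large.\<close>
    have "rdiam Q' \<le> \<epsilon>"
    proof (rule ccontr)
      assume n: "\<not> rdiam Q' \<le> \<epsilon>"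
      then have "rdiam Q' \<le> Cr * (2 * eta * ?\<rho>)" using Q'(4) 2(3) by linarith
      also have "\<dots> = 2 * (Cr * eta) * ?\<rho>" by simp
      also have "\<dots> \<le> 2 * (1 / 100) * ?\<rho>" using Cr_eta by (intro mult_right_mono) auto
      finally have small: "rdiam Q' \<le> ?\<rho> / 50" by simp
      have "eta * pdist (pr e) (pr w) \<le> 1 / 100 * (2 * \<epsilon>)"
        using 2(4) eta_le' eta_pos by (intro mult_mono) auto
      moreover have "eta * rdiam Q' \<le> 1 / 100 * rdiam Q'"
        using eta_le' pos by (intro mult_right_mono) auto
      ultimately have "?\<rho> \<le> 2 * \<epsilon> + \<epsilon> / 50 + rdiam Q' / 25"
        using pr_hz[of e w] 2(4) Pe Pw psi_lip[of e w] unfolding Phi_def by linarith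
      then show False using small n cube(3)[OF 2(1)] 2(3) by linarith
    qed
    then have "2 * eta * rdiam Q' \<le> 2 * eta * \<epsilon>" using eta_pos by (intro mult_left_mono) auto
    then show ?thesis using Pe by linarith
  qed
qed

lemma Phi_on_E_le: 
  assumes "e \<in> E" "pdist e zS \<le> K / 8 * dS"
  shows "\<bar>Phi e\<bar> \<le> kap * g (pr e)"
proof -
  have "2 * eta * g (pr e) \<le> kap * g (pr e)"
    using eta_le kap_pos g_nonneg by (intro mult_right_mono) auto
  then show ?thesis using Phi_on_E[OF assms] by linarith
qed

text \<open>The vertical foot of z on the corona graph is within |Phi z|, and the bilateral
  approximation puts \<open>E\<close> within eta diam(Q) of that foot. The radius
  \<open>3 / \<theta> ^ 4\<close> is the reach of the cubes in \<open>W_Q\<close>, as 1 / \<theta>^4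
  is K^(1/4).\<close>

lemma E_near_vertical:
  assumes "Q \<in> S" "w \<in> Q" "pdist z w \<le> 3 / \<theta> ^ 4 * rdiam Q" "\<bar>Phi z\<bar> \<le> rdiam Q"
  obtains e where "e \<in> E" "pdist z e < \<bar>Phi z\<bar> + eta * rdiam Q"
proof -
  let ?p = "lift (pr z) (\<psi> (pr z))"
  have zp: "pdist z ?p \<le> \<bar>Phi z\<bar>"
    using vertical_dist[of z "\<psi> (pr z)"] by (simp add: Phi_def)
  have pos: "0 < rdiam Q" by (rule cube(3)[OF assms(1)])
  have 1: "1 + 3 / \<theta> ^ 4 \<le> 1 / 2 * K"
  proof -
    have "\<theta> ^ 16 + 3 * \<theta> ^ 12 \<le> 1 / 2" using power_theta_le[of 12] power_theta_le[of 16] by simp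
    moreover have "\<theta> ^ 16 * (1 + 3 / \<theta> ^ 4) = \<theta> ^ 16 + 3 * \<theta> ^ 12"
      using \<theta> by (simp add: field_simps flip: power_add)
    ultimately have "eta * (1 + 3 / \<theta> ^ 4) \<le> 1 / 2" by (simp add: eta_def)
    then have "K * (eta * (1 + 3 / \<theta> ^ 4)) \<le> K * (1 / 2)" using K_ge by (intro mult_left_mono) auto
    moreover have "K * (eta * (1 + 3 / \<theta> ^ 4)) = eta * K * (1 + 3 / \<theta> ^ 4)" by (simp only: mult_ac)
    ultimately show ?thesis by (simp add: eta_K)
  qed
  have "pdist ?p w \<le> (1 + 3 / \<theta> ^ 4) * rdiam Q"
    using pdist_triangle[of ?p w z] zp assms(3,4) pdist_commute[of ?p z] by (simp add: algebra_simps)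
  also have "\<dots> \<le> 1 / 2 * K * rdiam Q" using 1 pos by (intro mult_right_mono) auto
  finally have "pdist ?p w < (K - 1) * rdiam Q" by (rule K_bound) (use pos in auto)
  moreover have "Phi ?p = 0" by (simp add: Phi_def lift)
  ultimately obtain e where e: "e \<in> E" "pdist ?p e < eta * rdiam Q"
    using graph_near_E[OF assms(1,2)] by blast
  show ?thesis
    using e zp pdist_triangle[of z e ?p] by (intro that[of e]) auto
qed

text \<open>At such points g is of order \<theta>^(-4) diam(Q), so the shift is of order
  \<theta>^(15 - 4) diam(Q), far below the clearance \<theta>^4 diam(Q) of the Whitney
  cubes.\<close>

lemma kap_g_le:
  assumes "Q \<in> S" "w \<in> Q" "pdist z w \<le> 3 / \<theta> ^ 4 * rdiam Q"
  shows "kap * g (pr z) \<le> \<theta> ^ 4 / 10 * rdiam Q"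
proof -
  have pos: "0 < rdiam Q" by (rule cube(3)[OF assms(1)])
  have "g (pr z) \<le> (1 + 3 / \<theta> ^ 4) * rdiam Q"
    using g_le[OF assms(1,2), of z] assms(3) by (simp add: algebra_simps)
  then have "kap * g (pr z) \<le> kap * ((1 + 3 / \<theta> ^ 4) * rdiam Q)"
    using kap_pos by (intro mult_left_mono) auto
  also have "\<dots> = \<theta> ^ 4 * (\<theta> ^ 11 + 3 * \<theta> ^ 7) * rdiam Q"
    using \<theta> by (simp add: kap_def field_simps flip: power_add)
  also have "\<dots> \<le> \<theta> ^ 4 * (1 / 10) * rdiam Q"
  proof (intro mult_right_mono mult_left_mono)
    show "\<theta> ^ 11 + 3 * \<theta> ^ 7 \<le> 1 / 10" using power_theta_le[of 11] power_theta_le[of 7] by simp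
  qed (use \<theta> pos in auto)
  finally show ?thesis by simp
qed

lemma theta_powers: "\<theta> ^ 4 \<le> 1 / 100" "eta \<le> \<theta> ^ 4 / 100"
proof -
  show "\<theta> ^ 4 \<le> 1 / 100" by (rule power_theta_le) simp
  have "kap \<le> \<theta> ^ 4" unfolding kap_def using \<theta> by (intro power_decreasing) auto
  then show "eta \<le> \<theta> ^ 4 / 100" using eta_le by linarith
qed

lemma eta_diam_le: "Q \<in> S \<Longrightarrow> eta * rdiam Q \<le> \<theta> ^ 4 / 100 * rdiam Q"
  using theta_powers(2) cube(3)[of Q] by (intro mult_right_mono) auto

lemma theta_diam_le: "Q \<in> S \<Longrightarrow> \<theta> ^ 4 * rdiam Q \<le> rdiam Q"
  using theta_powers(1) cube(3)[of Q] by simp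

text \<open>A point of small height would have a point of \<open>E\<close> close to its vertical
  foot, nearer than its clearance from \<open>E\<close> allows.\<close>

lemma Phi_large:
  assumes "Q \<in> S" "w \<in> Q" "pdist z w \<le> 3 / \<theta> ^ 4 * rdiam Q"
    and far: "\<And>e. e \<in> E \<Longrightarrow> \<theta> ^ 4 * rdiam Q \<le> pdist z e"
  shows "\<theta> ^ 4 / 2 * rdiam Q < \<bar>Phi z\<bar>"
proof (rule ccontr)
  assume n: "\<not> ?thesis"
  have pos: "0 < rdiam Q" by (rule cube(3)[OF assms(1)])
  have "\<bar>Phi z\<bar> \<le> rdiam Q" using n theta_diam_le[OF assms(1)] pos by linarith
  then obtain e where "e \<in> E" "pdist z e < \<bar>Phi z\<bar> + eta * rdiam Q"
    using E_near_vertical[OF assms(1-3)] by blast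
  moreover have "0 < \<theta> ^ 4 * rdiam Q" using \<theta> pos by simp
  ultimately show False using far[of e] n eta_diam_le[OF assms(1)] by linarith
qed

lemma Phi_gt_kap_g:
  assumes "Q \<in> S" "w \<in> Q" "pdist z w \<le> 3 / \<theta> ^ 4 * rdiam Q"
    and "\<And>e. e \<in> E \<Longrightarrow> \<theta> ^ 4 * rdiam Q \<le> pdist z e"
  shows "kap * g (pr z) < \<bar>Phi z\<bar>"
proof -
  have "0 < \<theta> ^ 4 * rdiam Q" using \<theta> cube(3)[OF assms(1)] by simp
  then show ?thesis using Phi_large[OF assms] kap_g_le[OF assms(1-3)] by linarith
qed

text \<open>The vertical foot on the shifted graph is the competitor. The height of z is bounded
  through the small height of w and the Lipschitz constant 2 of \<open>Phi\<close>; the constant 11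
  collects the terms after estimating 1 by 1 / \<theta>^4.\<close>

lemma graph_dist_le:
  assumes "Q \<in> S" "w \<in> Q" "pdist z w \<le> 3 / \<theta> ^ 4 * rdiam Q" and s: "s \<in> {1, -1}"
  shows "pdist z (lift (pr z) (\<psi> (pr z) + s * kap * g (pr z))) \<le> 11 / \<theta> ^ 4 * rdiam Q"
proof -
  have pos: "0 < rdiam Q" by (rule cube(3)[OF assms(1)])
  have "pdist w w < (K - 1) * rdiam Q" using pos K_ge by simp
  then have "\<bar>Phi w\<bar> \<le> 2 * eta * rdiam Q"
    using assms(2) cube(1)[OF assms(1)] by (intro E_near_graph[OF assms(1) _ assms(2)]) auto
  moreover have "eta * rdiam Q \<le> 1 * rdiam Q" using eta_le' pos by (intro mult_right_mono) auto
  ultimately have P: "\<bar>Phi z\<bar> \<le> 2 * rdiam Q + 2 * (3 / \<theta> ^ 4 * rdiam Q)"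
    using Phi_lip[of z w] assms(3) by linarith
  have "pdist z (lift (pr z) (\<psi> (pr z) + s * kap * g (pr z))) \<le> \<bar>Phi z - s * (kap * g (pr z))\<bar>"
    using vertical_dist[of z "\<psi> (pr z) + s * kap * g (pr z)"] by (simp add: Phi_def algebra_simps)
  also have "\<dots> \<le> \<bar>Phi z\<bar> + kap * g (pr z)"
    using s mult_nonneg_nonneg[OF less_imp_le[OF kap_pos] g_nonneg[of "pr z"]] by auto
  also have "\<dots> \<le> 3 * rdiam Q + 6 / \<theta> ^ 4 * rdiam Q"
  proof -
    have "2 * (3 / \<theta> ^ 4 * rdiam Q) = 6 / \<theta> ^ 4 * rdiam Q" by simp
    then show ?thesis
      using P kap_g_le[OF assms(1-3)] theta_diam_le[OF assms(1)] pos by linarith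
  qed
  also have "\<dots> \<le> 5 * (1 / \<theta> ^ 4 * rdiam Q) + 6 / \<theta> ^ 4 * rdiam Q"
  proof -
    have "1 * rdiam Q \<le> 1 / \<theta> ^ 4 * rdiam Q"
      using pos \<theta> theta_powers(1) by (intro mult_right_mono) auto
    then show ?thesis using pos by linarith
  qed
  also have "\<dots> = 11 / \<theta> ^ 4 * rdiam Q" by (simp add: field_simps)
  finally show ?thesis .
qed

text \<open>On the shifted graph the height equals the shift, whereas at z it exceeds the shift by
  more than (1/2 - 1/10) \<theta>^4 diam(Q). Height minus shift has Lipschitz constant at most 3,
  and 0.4 / 3 is larger than 1/8.\<close>

lemma graph_dist_ge:
  assumes "Q \<in> S" "w \<in> Q" "pdist z w \<le> 3 / \<theta> ^ 4 * rdiam Q"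
    and "\<And>e. e \<in> E \<Longrightarrow> \<theta> ^ 4 * rdiam Q \<le> pdist z e" and s: "s \<in> {1, -1}"
    and p: "hz p = \<psi> (pr p) + s * kap * g (pr p)"
  shows "\<theta> ^ 4 / 8 * rdiam Q \<le> pdist z p"
proof -
  have pos: "0 < \<theta> ^ 4 * rdiam Q" using \<theta> cube(3)[OF assms(1)] by simp
  have "\<bar>Phi p\<bar> = kap * g (pr p)"
    using p s kap_pos g_nonneg[of "pr p"] by (auto simp: Phi_def abs_mult)
  also have "\<dots> \<le> kap * (g (pr z) + pdist z p)"
    using g_lip[of z p] kap_pos by (intro mult_left_mono) auto
  also have "\<dots> \<le> kap * g (pr z) + pdist z p"
    using mult_right_mono[of kap 1 "pdist z p"] kap_le by (simp add: distrib_left)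
  finally have "\<bar>Phi z\<bar> \<le> kap * g (pr z) + 3 * pdist z p"
    using Phi_lip[of z p] by linarith
  then show ?thesis
    using Phi_large[OF assms(1-4)] kap_g_le[OF assms(1-3)] pos by linarith
qed

text \<open>Along the straight segment from z to a point of \<open>E\<close> the signed height minus
  the shift drops from positive to nonpositive, so the segment meets the shifted graph. The crossing
  is no farther than the endpoint, since both spatial and temporal displacement are scaled by a
  factor at most 1.\<close>

lemma graph_separates_E:
  assumes z: "pdist z zS < K / 32 * dS" and s: "s \<in> {1, -1}" and above: "kap * g (pr z) < s * Phi z"
    and e: "e \<in> E"
  obtains p where "hz p = \<psi> (pr p) + s * kap * g (pr p)" "pdist z p \<le> pdist z e"
proof -
  have KdS: "0 < K * dS" using K_ge dS_pos by simp
  obtain e' where e': "e' \<in> E" "pdist z e' \<le> pdist z e" "pdist e' zS \<le> K / 8 * dS"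
  proof (cases "pdist z e < K / 32 * dS")
    case True
    then have "pdist e zS \<le> K / 8 * dS"
      using z pdist_triangle[of e zS z] pdist_commute[of e z] KdS by linarith
    then show ?thesis using e by (intro that[of e]) auto
  next
    case False
    \<comment> \<open>A point e possibly too far away for the height bound on \<open>E\<close> is
      replaced by \<open>zS\<close>, which lies in \<open>E\<close> and is closer to z.\<close>
    then show ?thesis using z zS_E KdS by (intro that[of zS]) auto
  qed
  define F where "F v = s * Phi v - kap * g (pr v)" for v
  have "lip_half_one (2 + kap) F"
    unfolding lip_half_one_def
  proof (intro allI)
    fix v w
    have "\<bar>s * Phi v - s * Phi w\<bar> = \<bar>Phi v - Phi w\<bar>" using s by auto
    moreover have "\<bar>kap * g (pr v) - kap * g (pr w)\<bar> \<le> kap * pdist v w"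
      using g_lip[of v w] kap_pos mult_left_mono[of "\<bar>g (pr v) - g (pr w)\<bar>" "pdist v w" kap]
      by (simp add: abs_mult flip: right_diff_distrib)
    ultimately have "\<bar>F v - F w\<bar> \<le> 2 * pdist v w + kap * pdist v w"
      using Phi_lip[of v w] unfolding F_def by linarith
    then show "\<bar>F v - F w\<bar> \<le> (2 + kap) * pdist v w" by (simp add: algebra_simps)
  qed
  then have cont: "continuous_on UNIV F" by (rule lip_half_one_continuous)
  have "\<bar>s * Phi e'\<bar> \<le> kap * g (pr e')" using Phi_on_E_le[OF e'(1,3)] s by auto
  then have F1: "F e' \<le> 0" unfolding F_def by linarith
  have F0: "0 \<le> F z" using above by (simp add: F_def)
  have "\<exists>x. 0 \<le> x \<and> x \<le> 1 \<and> F (z + x *\<^sub>R (e' - z)) = 0"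
    by (rule IVT2') (use F0 F1 in \<open>auto intro!: continuous_on_compose2[OF cont] continuous_intros\<close>)
  then obtain x where x: "0 \<le> x" "x \<le> 1" "F (z + x *\<^sub>R (e' - z)) = 0" by blast
  let ?p = "z + x *\<^sub>R (e' - z)"
  have "s * (s * Phi ?p) = s * (kap * g (pr ?p))" using x(3) by (simp add: F_def)
  then have "Phi ?p = s * kap * g (pr ?p)" using s by auto
  moreover have "pdist z ?p \<le> pdist z e'"
  proof -
    have "norm (snd z - snd ?p) = x * norm (snd z - snd e')"
      using x(1) by (simp add: norm_minus_commute)
    moreover have "x * norm (snd z - snd e') \<le> norm (snd z - snd e')"
      using x(1,2) by (simp add: mult_left_le_one_le)
    moreover have "\<bar>fst z - fst ?p\<bar> = x * \<bar>fst z - fst e'\<bar>"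
      using x(1) by (simp add: abs_mult abs_minus_commute)
    moreover have "x * \<bar>fst z - fst e'\<bar> \<le> \<bar>fst z - fst e'\<bar>"
      using x(1,2) by (simp add: mult_left_le_one_le)
    ultimately show ?thesis unfolding pdist_def by (intro add_mono real_sqrt_le_mono) simp_all
  qed
  ultimately show ?thesis using e'(2) by (intro that[of ?p]) (auto simp: Phi_def)
qed

lemma above_graph_off_E:
  assumes z: "pdist z zS < K / 32 * dS" and s: "s \<in> {1, -1}" and above: "kap * g (pr z) < s * Phi z"
  shows "z \<notin> E"
proof
  assume "z \<in> E"
  have KdS: "0 < K * dS" using K_ge dS_pos by simp
  then have "\<bar>Phi z\<bar> \<le> kap * g (pr z)" using z \<open>z \<in> E\<close> by (intro Phi_on_E_le) auto
  then show False using above s by auto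
qed

text \<open>This places a Whitney cube at distance l from \<open>E\<close> in the starred family of
  some cube of \<open>S\<close>. Lying above the shifted graph forces the height to exceed
  \<open>kap\<close> g, while a point of \<open>E\<close> at distance 3 l keeps the height of order
  l; so g is at most of order l / \<open>kap\<close>, and a cube of that size lies nearby.\<close>

lemma cube_seeing_above_graph:
  assumes z: "pdist z zS < K / 32 * dS" and s: "s \<in> {1, -1}" and above: "kap * g (pr z) < s * Phi z"
    and l: "0 < l" "\<And>e. e \<in> E \<Longrightarrow> l \<le> pdist z e" and e: "e \<in> E" "pdist z e \<le> 3 * l"
  obtains Q w where "Q \<in> S" "w \<in> Q" "eta ^ 4 * rdiam Q \<le> l" "pdist z w \<le> K * rdiam Q"
proof -
  let ?G = "g (pr z)" and ?\<tau> = "pdist z e"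
  \<comment> \<open>The height of z is at most twice the distance 3 l up to terms with eta, so
    \<open>kap\<close> g stays below 7 l; the 13 leaves slack.\<close>
  define \<epsilon> where "\<epsilon> = 13 * l / kap"
  have KdS: "0 < K * dS" using K_ge dS_pos by simp
  have kap\<epsilon>: "kap * \<epsilon> = 13 * l" using kap_pos by (simp add: \<epsilon>_def)
  have \<epsilon>: "0 < \<epsilon>" using l kap_pos by (simp add: \<epsilon>_def)
  have l\<epsilon>: "100 * l \<le> \<epsilon>"
    using kap\<epsilon> mult_right_mono[OF kap_le, of \<epsilon>] \<epsilon> l(1) by linarith
  have lz: "l < K / 32 * dS" using l(2)[OF zS_E] z by linarith
  have ez: "pdist e zS \<le> K / 8 * dS"
    using pdist_triangle[of e zS z] pdist_commute[of e z] e(2) z lz by linarith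
  have ge: "g (pr e) \<le> ?G + ?\<tau>" using g_lip[of z e] by linarith
  have "eta * g (pr e) \<le> eta * (?G + ?\<tau>)" using ge eta_pos by (intro mult_left_mono) auto
  then have Pz: "\<bar>Phi z\<bar> \<le> 2 * (eta * ?G) + 2 * (eta * ?\<tau>) + 2 * ?\<tau>"
    using Phi_on_E[OF e(1) ez] Phi_lip[of z e] by (simp add: algebra_simps)
  have eG: "eta * ?G \<le> kap * ?G / 100" using mult_right_mono[OF eta_le g_nonneg, of "pr z"] by simp
  have et: "eta * ?\<tau> \<le> ?\<tau> / 100" using mult_right_mono[OF eta_le', of ?\<tau>] by simp
  have abs: "kap * ?G < \<bar>Phi z\<bar>" using above s by auto
  have "kap * ?G < kap * \<epsilon>" using abs Pz eG et e(2) l(1) kap\<epsilon> by linarith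
  then have G: "?G < \<epsilon>" using kap_pos by simp
  \<comment> \<open>Every cube of diameter at most \<epsilon> passes the lower test of the starred
    family, because eta^4 is far below \<open>kap\<close>.\<close>
  have eta4: "eta ^ 4 * d \<le> l" if "0 < d" "d \<le> \<epsilon>" for d
  proof -
    have "eta ^ 4 \<le> eta ^ 1" using eta_pos eta_le' by (intro power_decreasing) auto
    then have "eta ^ 4 \<le> kap / 100" using eta_le by simp
    then have "eta ^ 4 * d \<le> kap / 100 * \<epsilon>" using that kap_pos by (intro mult_mono) auto
    then show ?thesis using kap\<epsilon> l(1) by simp
  qed
  from G show ?thesis
  proof (cases rule: g_nearE)
    case 1
    have "pdist z zS \<le> K * rdiam QS" using z KdS by (simp add: dS_def)
    then show ?thesis using 1 eta4[of "rdiam QS"] dS_pos QS by (intro that[of QS zS]) (auto simp: dS_def)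
  next
    case (2 Q w)
    let ?\<rho> = "pdist z w"
    have pos: "0 < rdiam Q" by (rule cube(3)[OF 2(1)])
    have "pdist w w < (K - 1) * rdiam Q" using pos K_ge by simp
    then have "\<bar>Phi w\<bar> \<le> 2 * eta * rdiam Q"
      using 2(2) cube(1)[OF 2(1)] by (intro E_near_graph[OF 2(1) _ 2(2)]) auto
    moreover have "eta * rdiam Q \<le> 1 / 100 * \<epsilon>" using 2(3) eta_le' eta_pos pos by (intro mult_mono) auto
    ultimately have Pw: "\<bar>Phi w\<bar> \<le> \<epsilon> / 50" by simp
    have "eta * ?G \<le> 1 / 100 * \<epsilon>" using G eta_le' eta_pos g_nonneg by (intro mult_mono) auto
    then have Pz': "\<bar>Phi z\<bar> \<le> \<epsilon>" using Pz et e(2) l\<epsilon> by linarith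
    have "eta * pdist (pr z) (pr w) \<le> 1 / 100 * (2 * \<epsilon>)" using 2(4) eta_le' eta_pos by (intro mult_mono) auto
    then have \<rho>: "?\<rho> \<le> 5 * \<epsilon>"
      using pr_hz[of z w] 2(4) Pz' Pw psi_lip[of z w] \<epsilon> unfolding Phi_def by linarith
    have "pdist zS w \<le> dS" unfolding dS_def using diam[OF QS] 2 cube(2) by blast
    moreover have "1 * dS \<le> K / 2 * dS" using K_ge dS_pos by (intro mult_right_mono) auto
    ultimately have "?\<rho> \<le> K * dS" using z pdist_triangle[of z w zS] KdS by linarith
    then have "eta * ?\<rho> \<le> eta * (K * dS)" using eta_pos by (intro mult_left_mono) auto
    also have "\<dots> = dS" using eta_K by (simp flip: mult.assoc)
    \<comment> \<open>An ancestor at scale \<open>eta * ?\<rho>\<close> reaches z with its K-dilate;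
      as \<open>?\<rho>\<close> is at most 5 \<epsilon> and \<open>Cr * eta\<close> at most 1/100,
      it is still no larger than \<epsilon>.\<close>
    finally obtain Q' where Q': "Q' \<in> S" "Q \<subseteq> Q'" "eta * ?\<rho> \<le> rdiam Q'"
      "rdiam Q' \<le> max (rdiam Q) (Cr * (eta * ?\<rho>))" using ancestor[OF 2(1)] by blast
    have "Cr * (eta * ?\<rho>) = Cr * eta * ?\<rho>" by simp
    also have "\<dots> \<le> 1 / 100 * ?\<rho>" using Cr_eta by (intro mult_right_mono) auto
    finally have "rdiam Q' \<le> \<epsilon>" using Q'(4) 2(3) \<rho> \<epsilon> by linarith
    then have "eta ^ 4 * rdiam Q' \<le> l" using cube(3)[OF Q'(1)] by (intro eta4)
    moreover have "K * (eta * ?\<rho>) \<le> K * rdiam Q'" using Q'(3) K_ge by (intro mult_left_mono) auto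
    then have "eta * K * ?\<rho> \<le> K * rdiam Q'" by (simp add: mult_ac)
    then have "?\<rho> \<le> K * rdiam Q'" by (simp add: eta_K)
    ultimately show ?thesis using Q' 2(2) by (intro that[of Q' w]) auto
  qed
qed

text \<open>\<open>zS\<close> lies in \<open>E\<close>, so its height and the shift there are both
  at most \<open>dS\<close> / 100.\<close>

lemma center_near_graph:
  assumes s: "s \<in> {1, -1}"
  shows "pdist zS (lift (pr zS) (\<psi> (pr zS) + s * kap * g (pr zS))) \<le> dS"
proof -
  have nn: "0 \<le> kap * g (pr zS)" using kap_pos g_nonneg by simp
  have "pdist zS zS \<le> K / 8 * dS" using K_ge dS_pos by simp
  then have "\<bar>Phi zS\<bar> \<le> kap * g (pr zS)" by (rule Phi_on_E_le[OF zS_E])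
  moreover have "kap * g (pr zS) \<le> 1 / 100 * dS"
    using kap_le kap_pos g_le_dS g_nonneg by (intro mult_mono) auto
  moreover have "pdist zS (lift (pr zS) (\<psi> (pr zS) + s * kap * g (pr zS))) \<le> \<bar>Phi zS - s * (kap * g (pr zS))\<bar>"
    using vertical_dist[of zS "\<psi> (pr zS) + s * kap * g (pr zS)"] by (simp add: Phi_def algebra_simps)
  moreover have "\<bar>Phi zS - s * (kap * g (pr zS))\<bar> \<le> \<bar>Phi zS\<bar> + kap * g (pr zS)" using s nn by auto
  ultimately show ?thesis using dS_pos by linarith
qed

end

section \<open>Whitney cubes and their position relative to the set\<close>

lemma connected_pcube: "connected (pcube z l)"
proof -
  have "pcube z l = {fst z - l\<^sup>2 / 2..fst z + l\<^sup>2 / 2} \<times> cbox (\<chi> i. snd z $ i - l / 2) (\<chi> i. snd z $ i + l / 2)"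
    unfolding pcube_def abs_diff_le_iff by (auto simp: mem_box_cart)
  then show ?thesis
    by (simp add: convex_connected convex_Times)
qed

lemma pdist_set_finite: "A \<noteq> {} \<Longrightarrow> B \<noteq> {} \<Longrightarrow> pdist_set A B < \<infinity>"
proof -
  assume "A \<noteq> {}" "B \<noteq> {}"
  then obtain z w where "z \<in> A" "w \<in> B" by blast
  from le_less_trans[OF pdist_set_le[OF this] ennreal_less_top] show ?thesis by simp
qed

text \<open>The Whitney inequalities in real numbers: l / 4 bounds the distances inside I, and l is
  positive because dyadic cubes are nondegenerate. Connectedness later assigns each cube to one
  side.\<close>

lemma whitney_cubeE:
  fixes E :: "'n::finite stpt set"
  assumes "whitney E W" "I \<in> W" "E \<noteq> {}"
  obtains l where "0 < l" "pdist_set I E = ennreal l"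
    "\<And>z z'. z \<in> I \<Longrightarrow> z' \<in> I \<Longrightarrow> pdist z z' \<le> l / 4" "connected I" "I \<noteq> {}"
proof -
  have "\<exists>z r. dyadic_params z r \<and> I = pcube z r \<and>
        4 * pdiam I \<le> pdist_set (pcube z (4 * r)) E \<and>
        pdist_set (pcube z (4 * r)) E \<le> pdist_set I E \<and> pdist_set I E \<le> 100 * pdiam I"
    using assms(1)[unfolded whitney_def, THEN conjunct2, THEN conjunct2] assms(2) by (rule bspec)
  then obtain z r where I: "dyadic_params z r" "I = pcube z r" and
      "4 * pdiam I \<le> pdist_set (pcube z (4 * r)) E" "pdist_set (pcube z (4 * r)) E \<le> pdist_set I E"
    by blast
  then have le: "4 * pdiam I \<le> pdist_set I E" by (meson order_trans)
  have r: "0 < r" using I(1) by (auto simp: dyadic_params_def)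
  have z: "z \<in> I" "(fst z + r\<^sup>2 / 2, snd z) \<in> I" using I r by (auto simp: pcube_def)
  have "pdist z (fst z + r\<^sup>2 / 2, snd z) = sqrt (r\<^sup>2 / 2)" by (simp add: pdist_def)
  then have pos: "0 < pdist z (fst z + r\<^sup>2 / 2, snd z)" using r by simp
  have fin: "pdist_set I E < \<infinity>" using z assms(3) by (intro pdist_set_finite) auto
  define l where "l = enn2real (pdist_set I E)"
  have l: "pdist_set I E = ennreal l" using fin by (simp add: l_def)
  have d: "4 * pdist x y \<le> l" if "x \<in> I" "y \<in> I" for x y
  proof -
    have "4 * ennreal (pdist x y) \<le> 4 * pdiam I" by (intro mult_left_mono pdist_le_pdiam that) auto
    also note le
    finally have "ennreal (4 * pdist x y) \<le> ennreal l" by (simp add: ennreal_mult l)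
    then show ?thesis by (simp add: ennreal_le_iff l_def)
  qed
  show ?thesis
  proof (rule that[OF _ l])
    show "0 < l" using d[OF z] pos by linarith
    show "pdist x y \<le> l / 4" if "x \<in> I" "y \<in> I" for x y using d[OF that] by simp
    show "connected I" by (simp add: I(2) connected_pcube)
    show "I \<noteq> {}" using z by auto
  qed
qed

text \<open>Some points of I and Q are closer than 2 b diam(Q), the 2 allowing for an unattained
  infimum; the diameter of I adds at most b diam(Q) / 4, whence the factor 3.\<close>

lemma whitney_near_point:
  fixes E :: "'n::finite stpt set"
  assumes W: "whitney E W" and I: "I \<in> whitney_near E W a b Q" "z \<in> I"
    and Q: "Q \<subseteq> E" "0 < rdiam Q" and b: "0 < b"
  shows "\<exists>w\<in>Q. pdist z w \<le> 3 * b * rdiam Q" and "\<And>e. e \<in> E \<Longrightarrow> a * rdiam Q \<le> pdist z e"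
proof -
  have IW: "I \<in> W" "ennreal (a * rdiam Q) \<le> pdist_set I E" "pdist_set I E \<le> pdist_set I Q"
    "pdist_set I Q \<le> ennreal (b * rdiam Q)"
    using I(1) by (auto simp: whitney_near_def)
  have bQ: "0 < b * rdiam Q" using b Q by simp
  have "pdist_set I Q < ennreal (2 * (b * rdiam Q))"
    using bQ by (intro le_less_trans[OF IW(4)] ennreal_lessI) auto
  then obtain z' w where w: "z' \<in> I" "w \<in> Q" "pdist z' w < 2 * (b * rdiam Q)"
    by (rule pdist_set_lessE)
  have ne: "E \<noteq> {}" using w Q by auto
  obtain l where l: "0 < l" "pdist_set I E = ennreal l" "\<And>z z'. z \<in> I \<Longrightarrow> z' \<in> I \<Longrightarrow> pdist z z' \<le> l / 4"
    using whitney_cubeE[OF W IW(1) ne] by metis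
  have "ennreal l \<le> ennreal (b * rdiam Q)" using IW(3,4) l(2) by (metis order_trans)
  then have "l \<le> b * rdiam Q" using bQ by (simp add: ennreal_le_iff)
  then have "pdist z w \<le> 3 * (b * rdiam Q)"
    using pdist_triangle[of z w z'] l(3)[OF I(2) w(1)] w(3) bQ by linarith
  then show "\<exists>w\<in>Q. pdist z w \<le> 3 * b * rdiam Q" using w(2) by (auto simp: mult.assoc)
  fix e assume "e \<in> E"
  then have "ennreal (a * rdiam Q) \<le> ennreal (pdist z e)"
    using IW(2) pdist_set_le[OF I(2)] by (meson order_trans)
  then show "a * rdiam Q \<le> pdist z e" by (simp add: ennreal_le_iff)
qed

lemma connected_nonzero_sign:
  fixes f :: "'a::topological_space \<Rightarrow> real"
  assumes "connected I" "continuous_on I f" "\<And>x. x \<in> I \<Longrightarrow> f x \<noteq> 0"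
  shows "(\<forall>x\<in>I. 0 < f x) \<or> (\<forall>x\<in>I. f x < 0)"
proof (rule ccontr)
  assume "\<not> ?thesis"
  then obtain x y where "x \<in> I" "y \<in> I" "f x \<le> 0" "0 \<le> f y" by (meson not_less)
  moreover have "connected (f ` I)" by (rule connected_continuous_image[OF assms(2,1)])
  ultimately have "0 \<in> f ` I" by (meson connectedD_interval imageI)
  then show False using assms(3) by auto
qed

section \<open>Fractional powers and data extracted from the corona decomposition\<close>

lemma power_16_powr: "0 < \<theta> \<Longrightarrow> (\<theta> ^ 16) powr (real k / 16) = \<theta> ^ k"
  using powr_powr[of \<theta> 16 "real k / 16"] by (simp add: powr_realpow)

lemma inverse_power_16_powr: "0 < \<theta> \<Longrightarrow> (1 / \<theta> ^ 16) powr (real k / 16) = 1 / \<theta> ^ k"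
  by (simp add: powr_divide power_16_powr)

text \<open>Each supremum is bounded by the sum of both. The strict inequality also excludes cubes
  of diameter zero, such as single points.\<close>

lemma bilateral_coronaD:
  fixes E :: "'n::finite stpt set"
  assumes "bilateral_corona TYPE('m::finite) E D ctr \<eta> b2 C\<eta> \<G> \<B> \<S> \<Gamma>" "T \<in> \<S>"
  shows "regular_graph TYPE('m) \<eta> b2 (\<Gamma> T)"
    and "\<And>Q e. Q \<in> T \<Longrightarrow> e \<in> dilate_cube E (1 / \<eta>) Q \<Longrightarrow> pdist_pt e (\<Gamma> T) < ennreal (\<eta> * rdiam Q)"
    and "\<And>Q p. Q \<in> T \<Longrightarrow> p \<in> pball (ctr Q) (1 / \<eta> * rdiam Q) \<inter> \<Gamma> T \<Longrightarrow> pdist_pt p E < ennreal (\<eta> * rdiam Q)"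
    and "\<And>Q. 0 < \<eta> \<Longrightarrow> Q \<in> T \<Longrightarrow> 0 < rdiam Q"
proof -
  have "\<forall>T\<in>\<S>. regular_graph TYPE('m) \<eta> b2 (\<Gamma> T) \<and>
        (\<forall>Q\<in>T.
           (SUP z \<in> dilate_cube E (1 / \<eta>) Q. pdist_pt z (\<Gamma> T)) +
           (SUP z \<in> pball (ctr Q) (1 / \<eta> * rdiam Q) \<inter> \<Gamma> T. pdist_pt z E)
           < ennreal (\<eta> * rdiam Q))"
    using assms(1) unfolding bilateral_corona_def by (elim conjE)
  then have *: "regular_graph TYPE('m) \<eta> b2 (\<Gamma> T)"
    "\<And>Q. Q \<in> T \<Longrightarrow> (SUP z \<in> dilate_cube E (1 / \<eta>) Q. pdist_pt z (\<Gamma> T)) +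
           (SUP z \<in> pball (ctr Q) (1 / \<eta> * rdiam Q) \<inter> \<Gamma> T. pdist_pt z E)
           < ennreal (\<eta> * rdiam Q)"
    using assms(2) by blast+
  show "regular_graph TYPE('m) \<eta> b2 (\<Gamma> T)" by (rule *(1))
  fix Q assume Q: "Q \<in> T"
  show "pdist_pt e (\<Gamma> T) < ennreal (\<eta> * rdiam Q)" if "e \<in> dilate_cube E (1 / \<eta>) Q" for e
    using SUP_upper[OF that, of "\<lambda>z. pdist_pt z (\<Gamma> T)"]
    by (intro le_less_trans[OF _ *(2)[OF Q]]) (rule add_increasing2, auto)
  show "pdist_pt p E < ennreal (\<eta> * rdiam Q)" if "p \<in> pball (ctr Q) (1 / \<eta> * rdiam Q) \<inter> \<Gamma> T" for p
    using SUP_upper[OF that, of "\<lambda>z. pdist_pt z E"]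
    by (intro le_less_trans[OF _ *(2)[OF Q]]) (rule add_increasing, auto)
  show "0 < rdiam Q" if "0 < \<eta>"
  proof -
    have "0 < ennreal (\<eta> * rdiam Q)" by (rule le_less_trans[OF zero_le *(2)[OF Q]])
    then show ?thesis using that by (simp add: zero_less_mult_iff)
  qed
qed

lemma is_center_mem:
  assumes "is_center E Cc Q z" "0 < Cc" "0 < rdiam Q"
  shows "z \<in> Q"
proof -
  obtain r where r: "rdiam Q / Cc \<le> r" "E \<inter> pball z r \<subseteq> Q" and z: "z \<in> E"
    using assms(1) by (auto simp: is_center_def)
  have "0 < rdiam Q / Cc" using assms by simp
  then have "0 < r" using r(1) by linarith
  then show ?thesis using r(2) z by (auto simp: pball_def)
qed

lemma regular_fun_mono:
  assumes "regular_fun b1 b2 \<psi>" "b1 \<le> b1'" "b2 \<le> b2'"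
  shows "regular_fun b1' b2' \<psi>"
proof -
  have "b1 * pdist z w \<le> b1' * pdist z w" for z w :: "real \<times> 'a"
    using assms(2) by (intro mult_right_mono) auto
  then show ?thesis
    using assms(1) ennreal_leI[OF assms(3)] unfolding regular_fun_def lip_half_one_def by (meson order_trans)
qed

lemma pball_subset_pball: "pdist z w + r \<le> r' \<Longrightarrow> pball w r \<subseteq> pball z r'"
proof
  fix v assume "pdist z w + r \<le> r'" "v \<in> pball w r"
  then show "v \<in> pball z r'" using pdist_triangle[of z v w] by (simp add: pball_def)
qed

text \<open>All constants are explicit here, so that only thresholds remain to be chosen. Both
  graphs use the plane and function of the surrounding regime \<open>T\<close>, while g is built
  from the cubes of the subregime \<open>S\<close>.\<close>

lemma corona_subregime_graphs:
  fixes E :: "'n::finite stpt set"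
  assumes card: "CARD('n) = CARD('m::finite) + 1"
    and adr: "ADR C0 E" and D: "dyadic_system E a0 \<gamma> cs D" and a0: "0 < a0"
    and ctr: "\<forall>Q\<in>cubes D. is_center E Cc Q (ctr Q)" and Cc: "0 < Cc"
    and W: "whitney E W" and \<eta>: "\<eta> = \<theta> ^ 16" and \<theta>: "0 < \<theta>" "\<theta> \<le> 1 / 100"
    and \<theta>Cr: "max 1 (8 * cs * (max 1 C0)\<^sup>2 / a0) * \<theta> \<le> 1 / 100"
    and \<theta>Cb: "\<theta> * (2 * (96 * 2 ^ CARD('m) + 8)) \<le> 1"
    and corona: "bilateral_corona TYPE('m) E D ctr \<eta> b2 C\<eta> \<G> \<B> \<S> \<Gamma>" and b2: "0 \<le> b2"
    and T: "T \<in> \<S>" and S: "S \<subseteq> T" "coherent D S"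
    and \<eta>1: "\<eta> < \<eta>1 \<Longrightarrow> M0 * \<theta>\<^sup>2 \<le> 1 / 2"
  shows "\<exists>P q (L :: real^'m \<Rightarrow> real^'n) \<nu>.
        \<exists>\<psi> :: real \<Rightarrow> 'm stpt \<Rightarrow> real.
        \<exists>Wpm :: real \<Rightarrow> 'n cube \<Rightarrow> 'n stpt set set.
          t_indep_plane P \<and> plane_coords P q L \<nu> \<and>
          (\<forall>s\<in>{1, -1}. regular_fun (2 * \<eta> powr (15/16)) (1 + b2) (\<psi> s)) \<and>
          (\<forall>Q\<in>S. W_Q E W \<eta> Q = Wpm 1 Q \<union> Wpm (-1) Q \<and> Wpm 1 Q \<inter> Wpm (-1) Q = {} \<and>
             (\<forall>s\<in>{1, -1}. \<Union>(Wpm s Q)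
                \<subseteq> pball (ctr (top_cube S)) ((1 / \<eta>) powr (3/4) * rdiam (top_cube S)) \<inter> graph_side q L \<nu> s (\<psi> s))) \<and>
          (\<forall>s\<in>{1, -1}. (\<Union>Q\<in>S. \<Union>(Wpm s Q))
                \<subseteq> pball (ctr (top_cube S)) ((1 / \<eta>) powr (3/4) * rdiam (top_cube S)) \<inter> graph_side q L \<nu> s (\<psi> s)) \<and>
          (\<forall>s\<in>{1, -1}. \<forall>z \<in> (\<Union>Q\<in>S. \<Union>(Wpm s Q)).
             pdist_pt z E \<le> ennreal (100 / \<eta> powr (1/2)) * pdist_pt z (graph_over q L \<nu> (\<psi> s)) \<and>
             pdist_pt z (graph_over q L \<nu> (\<psi> s)) \<le> ennreal (100 / \<eta> powr (1/2)) * pdist_pt z E) \<and>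
          (\<forall>s\<in>{1, -1}. \<forall>z \<in> pball (ctr (top_cube S)) ((1 / \<eta>) / 32 * rdiam (top_cube S)) \<inter> graph_side q L \<nu> s (\<psi> s).
             pdist_pt z E \<ge> pdist_pt z (graph_over q L \<nu> (\<psi> s))) \<and>
          (\<forall>s\<in>{1, -1}. pball (ctr (top_cube S)) ((1 / \<eta>) / 32 * rdiam (top_cube S)) \<inter> graph_side q L \<nu> s (\<psi> s)
             \<subseteq> (\<Union>Q\<in>S. Ustar_Q E W \<eta> Q)) \<and>
          (\<forall>s\<in>{1, -1}. \<exists>z \<in> graph_over q L \<nu> (\<psi> s).
             (\<eta> < \<eta>1 \<longrightarrow>
                pball (ctr (top_cube S)) (M0 * (1 / \<eta>) powr (3/4) * rdiam (top_cube S)) \<subseteq> pball z ((1 / \<eta>) powr (7/8) * rdiam (top_cube S))) \<and>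
             pball z ((1 / \<eta>) powr (7/8) * rdiam (top_cube S)) \<subseteq> pball (ctr (top_cube S)) ((1 / \<eta>) / 32 * rdiam (top_cube S)))"
proof -
  let ?Cr = "max 1 (8 * cs * (max 1 C0)\<^sup>2 / a0)" and ?QS = "top_cube S" and ?zS = "ctr (top_cube S)"
  let ?dS = "rdiam (top_cube S)"
  have \<eta>pos: "0 < \<eta>" using \<eta> \<theta> by simp
  note cor = bilateral_coronaD[OF corona T]
  have pos: "0 < rdiam Q" if "Q \<in> S" for Q using cor(4)[OF \<eta>pos] S(1) that by blast
  have cubes: "S \<subseteq> cubes D" using S(2) by (simp add: coherent_def)
  have top: "?QS \<in> S" "\<And>Q. Q \<in> S \<Longrightarrow> Q \<subseteq> ?QS"
    using top_cube_is_top[OF S(2)] by (auto simp: is_top_def)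
  have QE: "Q \<subseteq> E" and fin: "pdiam Q < \<infinity>" if Q: "Q \<in> S" for Q
  proof -
    obtain k where k: "Q \<in> D k" using cubes Q by (auto simp: cubes_def)
    show "Q \<subseteq> E" by (rule dyadic_subset[OF D k])
    show "pdiam Q < \<infinity>" using dyadic_diam[OF D k] by (simp add: le_less_trans)
  qed
  have rdiam_le: "rdiam Q \<le> ?dS" if "Q \<in> S" for Q
    unfolding rdiam_def using pdiam_mono[OF top(2)[OF that]] fin[OF top(1)] by (intro enn2real_mono) auto
  have ctrQ: "ctr Q \<in> Q" if "Q \<in> S" for Q
    using ctr cubes that by (intro is_center_mem[OF _ Cc pos[OF that]]) auto
  obtain P q and L :: "real^'m \<Rightarrow> real^'n" and \<nu> \<psi> where P: "t_indep_plane P" "plane_coords P q L \<nu>"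
    and reg: "regular_fun \<eta> b2 \<psi>" and \<Gamma>: "\<Gamma> T = graph_over q L \<nu> \<psi>"
    using cor(1) unfolding regular_graph_def by blast
  obtain cx cy where coords: "\<And>X. X = q + L (cx X) + cy X *\<^sub>R \<nu>"
    "\<And>x y. cx (q + L x + y *\<^sub>R \<nu>) = x" "\<And>x y. cy (q + L x + y *\<^sub>R \<nu>) = y"
    and cx: "\<And>X Y. norm (cx X - cx Y) \<le> norm (X - Y)" and cy: "\<And>X Y. \<bar>cy X - cy Y\<bar> \<le> norm (X - Y)"
    and cxy: "\<And>X Y. norm (X - Y) \<le> norm (cx X - cx Y) + \<bar>cy X - cy Y\<bar>"
    by (rule plane_coords_inverse[OF P(2) card]) (rule that)
  define pr :: "'n stpt \<Rightarrow> 'm stpt" where "pr z = (fst z, cx (snd z))" for z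
  define hz :: "'n stpt \<Rightarrow> real" where "hz z = cy (snd z)" for z
  define lift :: "'m stpt \<Rightarrow> real \<Rightarrow> 'n stpt" where "lift p y = chart q L \<nu> (fst p) (snd p) y" for p y
  have chart: "z = chart q L \<nu> (fst z) (cx (snd z)) (cy (snd z))" for z
    unfolding chart_def using coords(1)[of "snd z"] by (metis prod.collapse)
  have over: "z \<in> graph_over q L \<nu> f \<longleftrightarrow> hz z = f (pr z)" for z f
  proof
    assume "z \<in> graph_over q L \<nu> f"
    then show "hz z = f (pr z)" by (auto simp: graph_over_def chart_def hz_def pr_def coords)
  next
    assume "hz z = f (pr z)"
    then show "z \<in> graph_over q L \<nu> f"
      using chart[of z] unfolding graph_over_def hz_def pr_def by (metis (mono_tags, lifting) mem_Collect_eq)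
  qed
  have side: "z \<in> graph_side q L \<nu> s f \<longleftrightarrow> s * hz z > s * f (pr z)" for z f s
  proof
    assume "z \<in> graph_side q L \<nu> s f"
    then show "s * hz z > s * f (pr z)" by (auto simp: graph_side_def chart_def hz_def pr_def coords)
  next
    assume "s * hz z > s * f (pr z)"
    then show "z \<in> graph_side q L \<nu> s f"
      using chart[of z] unfolding graph_side_def hz_def pr_def by blast
  qed
  have pr1: "pdist (pr z) (pr w) \<le> pdist z w" for z w
    using cx[of "snd z" "snd w"] by (simp add: pdist_def pr_def)
  have hz1: "\<bar>hz z - hz w\<bar> \<le> pdist z w" for z w
    using cy[of "snd z" "snd w"] by (simp add: pdist_def hz_def add_increasing2)
  have prhz1: "pdist z w \<le> pdist (pr z) (pr w) + \<bar>hz z - hz w\<bar>" for z w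
    using cxy[of "snd z" "snd w"] by (simp add: pdist_def hz_def pr_def)
  have lip: "lip_half_one \<eta> \<psi>" using reg by (simp add: regular_fun_def)
  have \<eta>_le_1: "\<eta> \<le> 1"
    unfolding \<eta> using \<theta> by (intro power_le_one) auto
  interpret G: corona_graph E S ?QS ?zS \<theta> ?Cr \<psi> pr hz lift
  proof
    show "0 < \<theta>" "\<theta> \<le> 1 / 100" by (fact \<theta>)+
    show "0 \<le> ?Cr" by simp
    show "?Cr * \<theta> \<le> 1 / 100" by (fact \<theta>Cr)
    show "?QS \<in> S" "?zS \<in> ?QS" using top(1) ctrQ by auto
    show "lip_half_one (\<theta> ^ 16) \<psi>" using lip \<eta> by simp
    show "pr (lift p y) = p" "hz (lift p y) = y" for p y
      by (simp_all add: lift_def chart_def pr_def hz_def coords)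
    show "\<exists>Q'\<in>S. Q \<subseteq> Q' \<and> l \<le> rdiam Q' \<and> rdiam Q' \<le> max (rdiam Q) (?Cr * l)"
      if "Q \<in> S" "l \<le> rdiam ?QS" for Q l
      by (rule coherent_ancestor[OF D adr a0 S(2) pos that])
    show "pdist z w \<le> rdiam Q" if "Q \<in> S" "z \<in> Q" "w \<in> Q" for Q z w
      using pdist_le_rdiam[OF fin] that by blast
    show "\<bar>hz e - \<psi> (pr e)\<bar> \<le> 2 * \<theta> ^ 16 * rdiam Q"
      if "Q \<in> S" "e \<in> E" "w \<in> Q" and d: "pdist e w < (1 / \<theta> ^ 16 - 1) * rdiam Q" for Q e w
    proof -
      have "pdist_pt e Q < ennreal ((1 / \<eta> - 1) * rdiam Q)"
        unfolding \<eta>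
        by (intro le_less_trans[OF pdist_pt_le[OF that(3)]] ennreal_lessI le_less_trans[OF pdist_nonneg d] d)
      then have "pdist_pt e (\<Gamma> T) < ennreal (\<eta> * rdiam Q)"
        using that S(1) by (intro cor(2)) (auto simp: dilate_cube_def)
      then obtain p where p: "hz p = \<psi> (pr p)" "pdist e p < \<eta> * rdiam Q"
        unfolding \<Gamma> by (auto elim!: pdist_pt_lessE simp: over)
      \<comment> \<open>Distance to the graph is turned into vertical height; the variation of
        \<psi> between the two projections costs the factor 2.\<close>
      have "\<bar>\<psi> (pr e) - \<psi> (pr p)\<bar> \<le> \<eta> * pdist (pr e) (pr p)"
        by (rule lip[unfolded lip_half_one_def, rule_format])
      also have "\<dots> \<le> 1 * pdist e p" using pr1[of e p] \<eta>_le_1 \<eta>pos by (intro mult_mono) auto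
      finally have "\<bar>hz e - \<psi> (pr e)\<bar> \<le> 2 * (\<eta> * rdiam Q)" using hz1[of e p] p by linarith
      then show ?thesis by (simp add: \<eta>)
    qed
    show "\<exists>e\<in>E. pdist p e < \<theta> ^ 16 * rdiam Q"
      if "Q \<in> S" "w \<in> Q" "hz p = \<psi> (pr p)" "pdist p w < (1 / \<theta> ^ 16 - 1) * rdiam Q" for Q p w
    proof -
      \<comment> \<open>The corona controls a ball of radius K diam(Q) about the centre; starting
        from an arbitrary w in Q uses up one diameter, hence K - 1.\<close>
      have "pdist (ctr Q) w \<le> rdiam Q" by (rule pdist_le_rdiam[OF fin[OF that(1)] ctrQ[OF that(1)] that(2)])
      then have "pdist (ctr Q) p < 1 / \<eta> * rdiam Q"
        using pdist_triangle[of "ctr Q" p w] pdist_commute[of w p] that(4) \<eta> by (simp add: algebra_simps)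
      then have "pdist_pt p E < ennreal (\<eta> * rdiam Q)"
        using that S(1) by (intro cor(3)) (auto simp: pball_def \<Gamma> over)
      then show ?thesis unfolding \<eta> by (rule pdist_pt_lessE) blast
    qed
  qed (erule QE top(2) pos | rule pr1 hz1 prhz1)+
  have dS: "G.dS = ?dS" and eta: "G.eta = \<eta>" and K: "G.K = 1 / \<eta>" and kap: "G.kap = \<theta> ^ 15"
    by (simp_all add: G.dS_def G.eta_def G.K_def G.kap_def \<eta>)
  have powers: "\<eta> powr (1/4) = \<theta> ^ 4" "(1 / \<eta>) powr (1/4) = 1 / \<theta> ^ 4" "\<eta> powr (15/16) = \<theta> ^ 15"
    "(1 / \<eta>) powr (3/4) = 1 / \<theta> ^ 12" "(1 / \<eta>) powr (7/8) = 1 / \<theta> ^ 14" "\<eta> powr (1/2) = \<theta> ^ 8"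
    unfolding \<eta> using power_16_powr[OF \<theta>(1), of 4] power_16_powr[OF \<theta>(1), of 15] power_16_powr[OF \<theta>(1), of 8]
      inverse_power_16_powr[OF \<theta>(1), of 4] inverse_power_16_powr[OF \<theta>(1), of 12] inverse_power_16_powr[OF \<theta>(1), of 14]
    by simp_all
  define psi where "psi s p = \<psi> p + s * G.kap * G.g p" for s p
  define Wpm where "Wpm s Q = {I \<in> W_Q E W \<eta> Q. I \<subseteq> graph_side q L \<nu> s (psi s)}" for s Q
  have side_psi: "z \<in> graph_side q L \<nu> s (psi s) \<longleftrightarrow> G.kap * G.g (pr z) < s * G.Phi z"
    if "s \<in> {1, -1}" for s z
    using that unfolding side psi_def G.Phi_def by auto
  have over_psi: "z \<in> graph_over q L \<nu> (psi s) \<longleftrightarrow> hz z = \<psi> (pr z) + s * G.kap * G.g (pr z)" for s z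
    unfolding over psi_def ..
  interpret R: time_regular G.g G.dS
    unfolding G.g_def using G.dS_pos by (intro time_regular_reg_dist) simp
  have regular: "regular_fun (2 * \<eta> powr (15/16)) (1 + b2) (psi s)" if s: "s \<in> {1, -1}" for s
  proof -
    have abs: "\<bar>s * G.kap\<bar> = G.kap" using s G.kap_pos by auto
    have r: "regular_fun (\<eta> + \<bar>s * G.kap\<bar>) (b2 + \<bar>s * G.kap\<bar> * (2 * (96 * 2 ^ DIM(real^'m) + 8)))
        (\<lambda>p. \<psi> p + (s * G.kap) * G.g p)"
      by (rule R.regular_fun_add_scaled[OF reg b2])
    have eq: "(\<lambda>p. \<psi> p + (s * G.kap) * G.g p) = psi s" by (intro ext) (simp add: psi_def)
    \<comment> \<open>The Lipschitz constant \<eta> of the corona graph is at most a hundredth of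
      \<open>kap\<close>, so the two together stay below twice \<open>kap\<close>: this is the
      dimensional constant 2.\<close>
    have le1: "\<eta> + \<bar>s * G.kap\<bar> \<le> 2 * \<eta> powr (15/16)"
      unfolding abs powers using G.eta_le[unfolded eta kap] G.kap_pos[unfolded kap] unfolding kap by linarith
    have le2: "b2 + \<bar>s * G.kap\<bar> * (2 * (96 * 2 ^ DIM(real^'m) + 8)) \<le> 1 + b2"
    proof -
      have "\<theta> ^ 15 \<le> \<theta> ^ 1" using \<theta> by (intro power_decreasing) auto
      then have "G.kap * (2 * (96 * 2 ^ CARD('m) + 8)) \<le> \<theta> * (2 * (96 * 2 ^ CARD('m) + 8))"
        unfolding kap by (intro mult_right_mono) auto
      then show ?thesis unfolding abs using \<theta>Cb by simp
    qed
    show ?thesis by (rule regular_fun_mono[OF r[unfolded eq] le1 le2])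
  qed
  have point: "\<exists>w\<in>Q. pdist z w \<le> 3 / \<theta> ^ 4 * rdiam Q" "\<And>e. e \<in> E \<Longrightarrow> \<theta> ^ 4 * rdiam Q \<le> pdist z e"
    if "Q \<in> S" "I \<in> W_Q E W \<eta> Q" "z \<in> I" for Q I z
    using whitney_near_point[OF W that(2)[unfolded W_Q_def powers] that(3) QE[OF that(1)] pos[OF that(1)]] \<theta>
    by auto
  have Ene: "E \<noteq> {}" using G.zS_E by auto
  have split: "I \<in> Wpm 1 Q \<or> I \<in> Wpm (-1) Q" "I \<notin> Wpm 1 Q \<or> I \<notin> Wpm (-1) Q"
    if "Q \<in> S" "I \<in> W_Q E W \<eta> Q" for Q I
  proof -
    have IW: "I \<in> W" using that(2) by (simp add: W_Q_def whitney_near_def)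
    obtain z where z: "z \<in> I" and conn: "connected I"
      using whitney_cubeE[OF W IW Ene] by (metis ex_in_conv)
    have gt: "G.kap * G.g (pr z) < \<bar>G.Phi z\<bar>" if "z \<in> I" for z
      using point[OF \<open>Q \<in> S\<close> \<open>I \<in> W_Q E W \<eta> Q\<close> that] G.Phi_gt_kap_g[OF \<open>Q \<in> S\<close>] by blast
    have nn: "0 \<le> G.kap * G.g (pr z)" for z using G.kap_pos G.g_nonneg by simp
    have "lip_half_one 2 G.Phi" unfolding lip_half_one_def using G.Phi_lip by blast
    then have cont: "continuous_on I G.Phi"
      using lip_half_one_continuous continuous_on_subset by blast
    \<comment> \<open>The height never vanishes on the connected cube I, so all of I lies on one
      side of the corona graph, and beyond the shift.\<close>
    have "(\<forall>z\<in>I. 0 < G.Phi z) \<or> (\<forall>z\<in>I. G.Phi z < 0)"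
    proof (rule connected_nonzero_sign[OF conn cont])
      show "G.Phi z \<noteq> 0" if "z \<in> I" for z using gt[OF that] nn[of z] by linarith
    qed
    then show "I \<in> Wpm 1 Q \<or> I \<in> Wpm (-1) Q"
    proof
      assume p: "\<forall>z\<in>I. 0 < G.Phi z"
      have "I \<subseteq> graph_side q L \<nu> 1 (psi 1)"
      proof
        fix z assume "z \<in> I"
        then show "z \<in> graph_side q L \<nu> 1 (psi 1)" using gt[of z] p by (auto simp: side_psi)
      qed
      then show ?thesis using that(2) by (simp add: Wpm_def)
    next
      assume p: "\<forall>z\<in>I. G.Phi z < 0"
      have "I \<subseteq> graph_side q L \<nu> (-1) (psi (-1))"
      proof
        fix z assume "z \<in> I"
        then show "z \<in> graph_side q L \<nu> (-1) (psi (-1))" using gt[of z] p by (auto simp: side_psi)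
      qed
      then show ?thesis using that(2) by (simp add: Wpm_def)
    qed
    show "I \<notin> Wpm 1 Q \<or> I \<notin> Wpm (-1) Q"
    proof (rule ccontr)
      assume "\<not> ?thesis"
      then have "z \<in> graph_side q L \<nu> 1 (psi 1)" "z \<in> graph_side q L \<nu> (-1) (psi (-1))"
        using z by (auto simp: Wpm_def)
      then show False using nn[of z] by (auto simp: side_psi)
    qed
  qed
  have in_ball: "z \<in> pball ?zS ((1 / \<eta>) powr (3/4) * ?dS)"
    if Q: "Q \<in> S" "I \<in> W_Q E W \<eta> Q" "z \<in> I" for Q I z
  proof -
    obtain w where w: "w \<in> Q" "pdist z w \<le> 3 / \<theta> ^ 4 * rdiam Q" using point(1)[OF Q] by blast
    have "pdist ?zS w \<le> ?dS" using top(2)[OF Q(1)] w(1) G.QS by (intro G.diam) auto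
    moreover have "3 / \<theta> ^ 4 * rdiam Q \<le> 3 / \<theta> ^ 4 * ?dS"
      using rdiam_le[OF Q(1)] \<theta> by (intro mult_left_mono) auto
    ultimately have "pdist ?zS z \<le> (1 + 3 / \<theta> ^ 4) * ?dS"
      using pdist_triangle[of ?zS z w] pdist_commute[of w z] w(2) by (simp add: algebra_simps)
    also have "\<dots> < 1 / \<theta> ^ 12 * ?dS"
    proof (intro mult_strict_right_mono)
      have "\<theta> ^ 12 + 3 * \<theta> ^ 8 < 1" using G.power_theta_le[of 12] G.power_theta_le[of 8] by simp
      moreover have "\<theta> ^ 12 * (1 + 3 / \<theta> ^ 4) = \<theta> ^ 12 + 3 * \<theta> ^ 8"
        using \<theta> by (simp add: field_simps flip: power_add)
      ultimately have "(1 + 3 / \<theta> ^ 4) * \<theta> ^ 12 < 1" by (simp add: mult.commute)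
      then show "1 + 3 / \<theta> ^ 4 < 1 / \<theta> ^ 12" using \<theta> by (subst pos_less_divide_eq) auto
      show "0 < ?dS" using pos[OF top(1)] .
    qed
    finally show ?thesis unfolding powers pball_def by simp
  qed
  have part1: "\<Union>(Wpm s Q) \<subseteq> pball ?zS ((1 / \<eta>) powr (3/4) * ?dS) \<inter> graph_side q L \<nu> s (psi s)"
    if "Q \<in> S" for Q s
    using in_ball[OF that] by (auto simp: Wpm_def)
  have part2: "pdist_pt z E \<le> ennreal (100 / \<eta> powr (1/2)) * pdist_pt z (graph_over q L \<nu> (psi s)) \<and>
             pdist_pt z (graph_over q L \<nu> (psi s)) \<le> ennreal (100 / \<eta> powr (1/2)) * pdist_pt z E"
    if s: "s \<in> {1, -1}" and z: "z \<in> (\<Union>Q\<in>S. \<Union>(Wpm s Q))" for s z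
  proof -
    obtain Q I where Q: "Q \<in> S" "I \<in> W_Q E W \<eta> Q" "z \<in> I" using z by (auto simp: Wpm_def)
    obtain w where w: "w \<in> Q" "pdist z w \<le> 3 / \<theta> ^ 4 * rdiam Q" using point(1)[OF Q] by blast
    let ?\<delta> = "rdiam Q"
    have \<delta>: "0 < ?\<delta>" by (rule pos[OF Q(1)])
    have 1: "pdist_pt z E \<le> ennreal (3 / \<theta> ^ 4 * ?\<delta>)"
      using w QE[OF Q(1)] by (intro order_trans[OF pdist_pt_le[of w]] ennreal_leI) auto
    have 2: "ennreal (\<theta> ^ 4 * ?\<delta>) \<le> pdist_pt z E"
      using point(2)[OF Q] by (intro pdist_pt_geI ennreal_leI)
    have 3: "pdist_pt z (graph_over q L \<nu> (psi s)) \<le> ennreal (11 / \<theta> ^ 4 * ?\<delta>)"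
      using G.graph_dist_le[OF Q(1) w s]
      by (intro order_trans[OF pdist_pt_le] ennreal_leI) (auto simp: over_psi G.lift)
    have 4: "ennreal (\<theta> ^ 4 / 8 * ?\<delta>) \<le> pdist_pt z (graph_over q L \<nu> (psi s))"
      using G.graph_dist_ge[OF Q(1) w point(2)[OF Q] s] by (intro pdist_pt_geI ennreal_leI) (simp add: over_psi)
    \<comment> \<open>Both distances lie between \<theta>^4 / 8 and 11 / \<theta>^4 times diam(Q),
      so their ratio is at most 88 / \<theta>^8; this is the source of 100 / \<eta>^(1/2).\<close>
    have "3 / \<theta> ^ 4 * ?\<delta> \<le> 100 / \<theta> ^ 8 * (\<theta> ^ 4 / 8 * ?\<delta>)"
      using \<theta> \<delta> by (simp add: field_simps flip: power_add)
    then have "ennreal (3 / \<theta> ^ 4 * ?\<delta>) \<le> ennreal (100 / \<theta> ^ 8) * ennreal (\<theta> ^ 4 / 8 * ?\<delta>)"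
      using \<theta> \<delta> by (subst ennreal_mult[symmetric]) (auto intro: ennreal_leI)
    also have "\<dots> \<le> ennreal (100 / \<theta> ^ 8) * pdist_pt z (graph_over q L \<nu> (psi s))"
      by (intro mult_left_mono 4) auto
    finally have A: "pdist_pt z E \<le> ennreal (100 / \<theta> ^ 8) * pdist_pt z (graph_over q L \<nu> (psi s))"
      using 1 by (rule order_trans[rotated])
    have "11 / \<theta> ^ 4 * ?\<delta> \<le> 100 / \<theta> ^ 8 * (\<theta> ^ 4 * ?\<delta>)"
      using \<theta> \<delta> by (simp add: field_simps flip: power_add)
    then have "ennreal (11 / \<theta> ^ 4 * ?\<delta>) \<le> ennreal (100 / \<theta> ^ 8) * ennreal (\<theta> ^ 4 * ?\<delta>)"
      using \<theta> \<delta> by (subst ennreal_mult[symmetric]) (auto intro: ennreal_leI)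
    also have "\<dots> \<le> ennreal (100 / \<theta> ^ 8) * pdist_pt z E"
      by (intro mult_left_mono 2) auto
    finally have B: "pdist_pt z (graph_over q L \<nu> (psi s)) \<le> ennreal (100 / \<theta> ^ 8) * pdist_pt z E"
      using 3 by (rule order_trans[rotated])
    show ?thesis unfolding powers using A B by (rule conjI)
  qed
  have ballD: "pdist z ?zS < G.K / 32 * G.dS" if "z \<in> pball ?zS ((1 / \<eta>) / 32 * ?dS)" for z
    using that pdist_commute[of z ?zS] by (simp add: pball_def K dS)
  have part3: "pdist_pt z E \<ge> pdist_pt z (graph_over q L \<nu> (psi s))"
    if s: "s \<in> {1, -1}" and z: "z \<in> pball ?zS ((1 / \<eta>) / 32 * ?dS) \<inter> graph_side q L \<nu> s (psi s)" for s z
  proof (rule pdist_pt_geI)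
    fix e assume e: "e \<in> E"
    have "G.kap * G.g (pr z) < s * G.Phi z" using z side_psi[OF s] by blast
    then obtain p where "hz p = \<psi> (pr p) + s * G.kap * G.g (pr p)" "pdist z p \<le> pdist z e"
      using G.graph_separates_E[OF ballD s _ e, of z] z by blast
    then show "pdist_pt z (graph_over q L \<nu> (psi s)) \<le> ennreal (pdist z e)"
      by (intro order_trans[OF pdist_pt_le[of p]] ennreal_leI) (auto simp: over_psi)
  qed
  have part4: "pball ?zS ((1 / \<eta>) / 32 * ?dS) \<inter> graph_side q L \<nu> s (psi s) \<subseteq> (\<Union>Q\<in>S. Ustar_Q E W \<eta> Q)"
    if s: "s \<in> {1, -1}" for s
  proof
    fix z assume z: "z \<in> pball ?zS ((1 / \<eta>) / 32 * ?dS) \<inter> graph_side q L \<nu> s (psi s)"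
    have ball: "pdist z ?zS < G.K / 32 * G.dS" using z ballD by blast
    have above: "G.kap * G.g (pr z) < s * G.Phi z" using z side_psi[OF s] by blast
    have "z \<in> \<Union>W" using G.above_graph_off_E[OF ball s above] W by (auto simp: whitney_def)
    then obtain I where I: "I \<in> W" "z \<in> I" by blast
    obtain l where l: "0 < l" "pdist_set I E = ennreal l" "\<And>z z'. z \<in> I \<Longrightarrow> z' \<in> I \<Longrightarrow> pdist z z' \<le> l / 4"
      using whitney_cubeE[OF W I(1) Ene] by metis
    have far: "l \<le> pdist z e" if "e \<in> E" for e
      using pdist_set_le[OF I(2) that] l(2) by (simp add: ennreal_le_iff)
    \<comment> \<open>The infimum may not be attained, so a pair at distance below 2 l is taken; the
      cube adds at most l / 4, within the 3 l allowed.\<close>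
    have "pdist_set I E < ennreal (2 * l)" using l by (simp add: ennreal_lessI)
    then obtain z' e where e: "z' \<in> I" "e \<in> E" "pdist z' e < 2 * l" by (rule pdist_set_lessE)
    have "pdist z e \<le> 3 * l"
      using pdist_triangle[of z e z'] l(3)[OF I(2) e(1)] e(3) l(1) by linarith
    then obtain Q w where Q: "Q \<in> S" "w \<in> Q" "G.eta ^ 4 * rdiam Q \<le> l" "pdist z w \<le> G.K * rdiam Q"
      using G.cube_seeing_above_graph[OF ball s above l(1) far e(2)] by blast
    have "I \<in> Wstar_Q E W \<eta> Q"
      unfolding Wstar_Q_def whitney_near_def
    proof (intro CollectI conjI)
      show "ennreal (\<eta> ^ 4 * rdiam Q) \<le> pdist_set I E"
        using Q(3) by (simp add: l(2) eta ennreal_leI)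
      show "pdist_set I E \<le> pdist_set I Q"
        unfolding pdist_set_def by (intro INF_mono INF_superset_mono QE[OF Q(1)]) auto
      show "pdist_set I Q \<le> ennreal (1 / \<eta> * rdiam Q)"
        using Q(4) by (intro order_trans[OF pdist_set_le[OF I(2) Q(2)]] ennreal_leI) (simp add: K)
    qed (fact I(1))
    then show "z \<in> (\<Union>Q\<in>S. Ustar_Q E W \<eta> Q)" using Q(1) I(2) by (auto simp: Ustar_Q_def)
  qed
  have part5: "\<exists>z \<in> graph_over q L \<nu> (psi s).
             (\<eta> < \<eta>1 \<longrightarrow> pball ?zS (M0 * (1 / \<eta>) powr (3/4) * ?dS) \<subseteq> pball z ((1 / \<eta>) powr (7/8) * ?dS)) \<and>
             pball z ((1 / \<eta>) powr (7/8) * ?dS) \<subseteq> pball ?zS ((1 / \<eta>) / 32 * ?dS)"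
    if s: "s \<in> {1, -1}" for s
  proof -
    let ?p = "lift (pr ?zS) (\<psi> (pr ?zS) + s * G.kap * G.g (pr ?zS))"
    have p: "pdist ?zS ?p \<le> ?dS" using G.center_near_graph[OF s] by (simp add: dS)
    have dpos: "0 < ?dS" by (rule pos[OF top(1)])
    have "?p \<in> graph_over q L \<nu> (psi s)" by (simp add: over_psi G.lift)
    moreover have "pball ?p ((1 / \<eta>) powr (7/8) * ?dS) \<subseteq> pball ?zS ((1 / \<eta>) / 32 * ?dS)"
    proof (rule pball_subset_pball)
      \<comment> \<open>The graph point is within \<open>?dS\<close> of the centre, so 1 + K^(7/8)
        must not exceed K / 32; this holds because \<theta>^2 \<le> 10^(-4).\<close>
      have "1 + 1 / \<theta> ^ 14 \<le> 1 / \<theta> ^ 16 / 32"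
      proof -
        have "\<theta>\<^sup>2 \<le> (1 / 100)\<^sup>2" using \<theta> by (intro power_mono) auto
        moreover have "\<theta> ^ 16 \<le> 1 / 100" by (rule G.power_theta_le) simp
        moreover have "(1 + 1 / \<theta> ^ 14) * \<theta> ^ 16 = \<theta> ^ 16 + \<theta>\<^sup>2"
          using \<theta> by (simp add: field_simps flip: power_add)
        ultimately have "(1 + 1 / \<theta> ^ 14) * \<theta> ^ 16 \<le> 1 / 32" by (simp add: power_divide)
        then have "1 + 1 / \<theta> ^ 14 \<le> 1 / 32 / \<theta> ^ 16" using \<theta> by (subst pos_le_divide_eq) auto
        then show ?thesis by (simp add: mult.commute)
      qed
      then have "(1 + 1 / \<theta> ^ 14) * ?dS \<le> 1 / \<theta> ^ 16 / 32 * ?dS" using dpos by (intro mult_right_mono) auto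
      then show "pdist ?zS ?p + (1 / \<eta>) powr (7/8) * ?dS \<le> (1 / \<eta>) / 32 * ?dS"
        unfolding powers using p by (simp add: \<eta> algebra_simps)
    qed
    moreover have "pball ?zS (M0 * (1 / \<eta>) powr (3/4) * ?dS) \<subseteq> pball ?p ((1 / \<eta>) powr (7/8) * ?dS)" if "\<eta> < \<eta>1"
    proof (rule pball_subset_pball)
      have M: "M0 * \<theta>\<^sup>2 \<le> 1 / 2" by (rule \<eta>1[OF that])
      \<comment> \<open>Multiplied by \<theta>^14 this reads \<theta>^14 + M0 \<theta>^2 \<le> 1; it
        suffices that M0 is at most half of K^(1/8) = \<theta>^(-2).\<close>
      have "1 + M0 / \<theta> ^ 12 \<le> 1 / \<theta> ^ 14"
      proof -
        have "\<theta> ^ 14 \<le> 1 / 100" by (rule G.power_theta_le) simp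
        moreover have "(1 + M0 / \<theta> ^ 12) * \<theta> ^ 14 = \<theta> ^ 14 + M0 * \<theta>\<^sup>2"
          using \<theta> by (simp add: field_simps flip: power_add)
        ultimately have "(1 + M0 / \<theta> ^ 12) * \<theta> ^ 14 \<le> 1" using M by simp
        then show ?thesis using \<theta> by (subst pos_le_divide_eq) auto
      qed
      then have "(1 + M0 / \<theta> ^ 12) * ?dS \<le> 1 / \<theta> ^ 14 * ?dS" using dpos by (intro mult_right_mono) auto
      then show "pdist ?p ?zS + M0 * (1 / \<eta>) powr (3/4) * ?dS \<le> (1 / \<eta>) powr (7/8) * ?dS"
        unfolding powers using p pdist_commute[of ?p ?zS] by (simp add: algebra_simps)
    qed
    ultimately show ?thesis by blast
  qed
  have part1_cubes: "\<forall>Q\<in>S. W_Q E W \<eta> Q = Wpm 1 Q \<union> Wpm (-1) Q \<and> Wpm 1 Q \<inter> Wpm (-1) Q = {} \<and>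
      (\<forall>s\<in>{1, -1}. \<Union>(Wpm s Q)
         \<subseteq> pball ?zS ((1 / \<eta>) powr (3/4) * ?dS) \<inter> graph_side q L \<nu> s (psi s))"
  proof (intro ballI conjI)
    fix Q assume Q: "Q \<in> S"
    show "W_Q E W \<eta> Q = Wpm 1 Q \<union> Wpm (-1) Q"
      using split(1)[OF Q] by (auto simp: Wpm_def)
    show "Wpm 1 Q \<inter> Wpm (-1) Q = {}"
      using split(2)[OF Q] by (auto simp: Wpm_def)
  qed (rule part1)
  have part1_union: "\<forall>s\<in>{1, -1}. (\<Union>Q\<in>S. \<Union>(Wpm s Q))
      \<subseteq> pball ?zS ((1 / \<eta>) powr (3/4) * ?dS) \<inter> graph_side q L \<nu> s (psi s)"
    by (intro ballI UN_least part1)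
  show ?thesis
    by (intro exI[of _ P] exI[of _ q] exI[of _ L] exI[of _ \<nu>] exI[of _ psi] exI[of _ Wpm] conjI P part1_cubes part1_union)
      (intro ballI regular part2 part3 part4 part5; assumption)+
qed

theorem proposition3p25:
  assumes "CARD('n::finite) \<ge> 2" and "CARD('n) = CARD('m::finite) + 1"
  shows
   "\<exists>Cn>0. \<forall>C0>0. \<forall>a0>0. \<forall>\<gamma>>0. \<forall>cs. \<forall>Cc>0.
    \<exists>\<eta>0>0. \<exists>A :: real \<Rightarrow> real.
    \<forall>b2\<ge>0. \<forall>M0. square_function_const TYPE('m) 2 (1 + b2) M0 \<longrightarrow>
    (\<exists>\<eta>1>0.
     \<forall>(E :: 'n stpt set) M D ctr W \<eta> C\<eta> \<G> \<B> \<S> \<Gamma>.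
      PUR C0 M E \<and> dyadic_system E a0 \<gamma> cs D \<and> (\<forall>Q\<in>cubes D. is_center E Cc Q (ctr Q)) \<and>
      whitney E W \<and> 0 < \<eta> \<and> \<eta> < \<eta>0 \<and>
      bilateral_corona TYPE('m) E D ctr \<eta> b2 C\<eta> \<G> \<B> \<S> \<Gamma> \<longrightarrow>
      (\<forall>Sstar\<in>\<S>. \<forall>S. S \<subseteq> Sstar \<and> coherent D S \<longrightarrow>
       (let K = 1 / \<eta>; QS = top_cube S; zS = ctr QS; dS = rdiam QS in
        \<exists>P q (L :: real^'m \<Rightarrow> real^'n) \<nu>.
        \<exists>\<psi> :: real \<Rightarrow> 'm stpt \<Rightarrow> real.
        \<exists>Wpm :: real \<Rightarrow> 'n cube \<Rightarrow> 'n stpt set set.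
          t_indep_plane P \<and> plane_coords P q L \<nu> \<and>
          (\<forall>s\<in>{1, -1}. regular_fun (Cn * \<eta> powr (15/16)) (1 + b2) (\<psi> s)) \<and>
          \<comment> \<open>(1)\<close>
          (\<forall>Q\<in>S. W_Q E W \<eta> Q = Wpm 1 Q \<union> Wpm (-1) Q \<and> Wpm 1 Q \<inter> Wpm (-1) Q = {} \<and>
             (\<forall>s\<in>{1, -1}. \<Union>(Wpm s Q)
                \<subseteq> pball zS (K powr (3/4) * dS) \<inter> graph_side q L \<nu> s (\<psi> s))) \<and>
          (\<forall>s\<in>{1, -1}. (\<Union>Q\<in>S. \<Union>(Wpm s Q))
                \<subseteq> pball zS (K powr (3/4) * dS) \<inter> graph_side q L \<nu> s (\<psi> s)) \<and>
          \<comment> \<open>(2)\<close>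
          (\<forall>s\<in>{1, -1}. \<forall>z \<in> (\<Union>Q\<in>S. \<Union>(Wpm s Q)).
             pdist_pt z E \<le> ennreal (A \<eta>) * pdist_pt z (graph_over q L \<nu> (\<psi> s)) \<and>
             pdist_pt z (graph_over q L \<nu> (\<psi> s)) \<le> ennreal (A \<eta>) * pdist_pt z E) \<and>
          \<comment> \<open>(3)\<close>
          (\<forall>s\<in>{1, -1}. \<forall>z \<in> pball zS (K / 32 * dS) \<inter> graph_side q L \<nu> s (\<psi> s).
             pdist_pt z E \<ge> pdist_pt z (graph_over q L \<nu> (\<psi> s))) \<and>
          \<comment> \<open>(4)\<close>
          (\<forall>s\<in>{1, -1}. pball zS (K / 32 * dS) \<inter> graph_side q L \<nu> s (\<psi> s)
             \<subseteq> (\<Union>Q\<in>S. Ustar_Q E W \<eta> Q)) \<and>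
          \<comment> \<open>(5): its first inclusion forces \<open>M0 \<le> K powr (1/8)\<close>, hence the threshold \<open>\<eta>1\<close>\<close>
          (\<forall>s\<in>{1, -1}. \<exists>z \<in> graph_over q L \<nu> (\<psi> s).
             (\<eta> < \<eta>1 \<longrightarrow>
                pball zS (M0 * K powr (3/4) * dS) \<subseteq> pball z (K powr (7/8) * dS)) \<and>
             pball z (K powr (7/8) * dS) \<subseteq> pball zS (K / 32 * dS)))))"
proof (rule exI[of _ 2], intro conjI allI impI, goal_cases)
  case 1
  show ?case by simp
next
  case (2 C0 a0 \<gamma> cs Cc)
  note a0 = 2(2) and Cc = 2(4)
  let ?Cb = "2 * (96 * 2 ^ CARD('m) + 8) :: real" and ?Cr = "max 1 (8 * cs * (max 1 C0)\<^sup>2 / a0)"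
  \<comment> \<open>The three bounds provide absolute smallness, smallness against the parent-child
    diameter ratio, and smallness against the BMO constant of g. None of them involves
    \<open>b2\<close> or \<open>M0\<close>.\<close>
  define \<theta>0 where "\<theta>0 = min (1 / 100) (min (1 / (100 * ?Cr)) (1 / ?Cb))"
  have Cb: "0 < ?Cb" by (simp add: add_pos_pos)
  have Cr: "0 < ?Cr" by simp
  have "0 < 1 / (100 * ?Cr)" "0 < 1 / ?Cb"
    by (intro divide_pos_pos mult_pos_pos Cr Cb; simp)+
  then have \<theta>0: "0 < \<theta>0" "\<theta>0 \<le> 1 / 100" "\<theta>0 \<le> 1 / (100 * ?Cr)" "\<theta>0 \<le> 1 / ?Cb"
    by (simp_all only: \<theta>0_def min_less_iff_conj min.coboundedI1 min.coboundedI2 order_refl) simp_all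
  show ?case
  proof (rule exI[of _ "\<theta>0 ^ 16"], rule conjI, goal_cases)
    case 1
    show ?case using \<theta>0(1) by simp
  next
    case 2
    show ?case
    proof (rule exI[of _ "\<lambda>\<eta>. 100 / \<eta> powr (1/2)"], intro allI impI, goal_cases)
      case (1 b2 M0)
      \<comment> \<open>For \<theta> below this value M0 \<theta>^2 \<le> |M0| \<theta> \<le> 1/2,
        which is the bound required for the first inclusion of balls.\<close>
      let ?m = "1 / (2 * (\<bar>M0\<bar> + 1))"
      have m: "0 < ?m" by (simp add: add_nonneg_pos)
      show ?case
      proof (rule exI[of _ "?m ^ 16"], rule conjI, goal_cases)
        case 1
        show ?case using m by (rule zero_less_power)
      next
        case 2
        show ?case
        proof (intro allI impI ballI, goal_cases)
          case (1 E M D ctr W \<eta> C\<eta> \<G> \<B> \<S> \<Gamma> Sstar S)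
          then have H: "PUR C0 M E" "dyadic_system E a0 \<gamma> cs D" "\<forall>Q\<in>cubes D. is_center E Cc Q (ctr Q)"
            "whitney E W" "0 < \<eta>" "\<eta> < \<theta>0 ^ 16" "bilateral_corona TYPE('m) E D ctr \<eta> b2 C\<eta> \<G> \<B> \<S> \<Gamma>"
            "S \<subseteq> Sstar" "coherent D S" "Sstar \<in> \<S>"
            by blast+
          define \<theta> where "\<theta> = \<eta> powr (1/16)"
          have \<theta>: "0 < \<theta>" using H(5) by (simp add: \<theta>_def)
          have \<eta>: "\<eta> = \<theta> ^ 16"
            using H(5) powr_realpow[of \<theta> 16] \<theta> by (simp add: \<theta>_def powr_powr)
          have less: "\<theta> < c" if "\<eta> < c ^ 16" "0 < c" for c
            using that power_mono[of c \<theta> 16] unfolding \<eta> by (meson less_imp_le not_le)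
          have "\<theta> < \<theta>0" using less[OF H(6) \<theta>0(1)] .
          then have le: "\<theta> \<le> 1 / 100" "\<theta> \<le> 1 / (100 * ?Cr)" "\<theta> \<le> 1 / ?Cb"
            using \<theta>0(2-4) by linarith+
          have "?Cr * \<theta> \<le> ?Cr * (1 / (100 * ?Cr))" using le(2) Cr by (intro mult_left_mono) auto
          then have Cr\<theta>: "?Cr * \<theta> \<le> 1 / 100" using Cr by (simp del: max_def)
          have Cb\<theta>: "\<theta> * ?Cb \<le> 1" using le(3) Cb by (simp only: pos_le_divide_eq)
          have M0\<theta>: "M0 * \<theta>\<^sup>2 \<le> 1 / 2" if "\<eta> < ?m ^ 16"
          proof -
            have "\<theta> < ?m" using less[OF that m] .
            then have "\<theta> * (2 * (\<bar>M0\<bar> + 1)) < 1" by (subst (asm) pos_less_divide_eq) auto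
            then have "\<bar>M0\<bar> * \<theta> \<le> 1 / 2" using \<theta> by (simp add: algebra_simps)
            moreover have "M0 * \<theta>\<^sup>2 \<le> \<bar>M0\<bar> * \<theta>"
            proof -
              have "\<theta>\<^sup>2 \<le> \<theta> * 1" unfolding power2_eq_square using \<theta> le(1) by (intro mult_left_mono) auto
              then show ?thesis by (intro mult_mono) auto
            qed
            ultimately show ?thesis by linarith
          qed
          have adr: "ADR C0 E" using H(1) by (simp add: PUR_def)
          show ?case
            unfolding Let_def
            by (rule corona_subregime_graphs[OF assms(2) adr H(2) a0 H(3) Cc H(4) \<eta> \<theta> le(1) Cr\<theta> Cb\<theta> H(7)
                \<open>0 \<le> b2\<close> H(10,8,9) M0\<theta>])
        qed
      qed
    qed
  qed
qed

end
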